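(* Let $V\in L^\infty(\mathbb R;\mathbb R)$ with $|V(x)|\to 0$ as $|x|\to\infty$, and consider the $\lambda$-nonlinear eigenvalue problem $$-\phi''+(1-\lambda^2)\phi=-(1-\lambda)V\phi,\qquad \phi\in H^1(\mathbb R)\setminus\{0\},\ \lambda\in\mathbb R. \qquad (\ast)$$ Assume that the negative part $V^{(-)}(x)=\max\{0,-V(x)\}$ satisfies $\|V^{(-)}\|_{L^\infty(\mathbb R)}\leq 1$. Then: (a) For each $j\in N_-^0$ there exists a unique $\beta_j\in(0,1]$ such that $\beta_j=-\frac{1}{\mu_j(\beta_j)}\bigl(2+\frac{1}{\mu_j(\beta_j)}\bigr)$. (b) The set of eigenvalues of $(\ast)$ lying in $(-1,1)$ is $\{\lambda_j:=1+\frac{1}{\mu_j(\beta_j)}\,:\, j\in N_-^0\}\subset(-1,1)$, and the eigenspace of $(\ast)$ for $\lambda_j$ coincides with the eigenspace of the operator $K_{\beta_j}$ associated with its eigenvalue $\mu_j(\beta_j)$. (c) $(\lambda_j)_{j\in N_-^0}$ is non-increasing and $0<\lambda_j+1\leq\|V^{(-)}\|_{L^\infty}$ for all $j\in N_-^0$.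
   Context: For $\beta>0$ let $K_\beta=(-\partial_x^2+\beta)^{-1}K:H^1(\mathbb R)\to H^1(\mathbb R)$, where $K:H^1(\mathbb R)\to L^2(\mathbb R)$, $Ku=Vu$. Equip $H^1(\mathbb R)$ with the inner product $\langle u,v\rangle_\beta=\langle u',v'\rangle_{L^2}+\beta\langle u,v\rangle_{L^2}$; then $K_\beta$ is symmetric and compact. Let $\{\mu_j(\beta)\}_{j\in N_-}\subset(-\infty,0)$ be all its negative eigenvalues (with multiplicity), ordered so that $|\mu_1(\beta)|\geq|\mu_2(\beta)|\geq\cdots>0$. The index set $N_-$ (which may be $\mathbb N$, finite, or empty) is independent of $\beta$, and each $\mu_j:(0,\infty)\to(-\infty,0)$ is strictly increasing and continuous, so $\mu_j(0_+)=\lim_{\beta\to0_+}\mu_j(\beta)\in[-\infty,0)$ exists. Define $N_-^0:=\{j\in N_-: \mu_j(0_+)<-\tfrac12\}$. *)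

theory Defs
  imports "HOL-Analysis.Analysis"
begin

(* Elements of L^2(R), H^1(R) are represented by functions real => real;
   equality in these spaces is equality almost everywhere (lborel). *)

definition L2 :: "(real \<Rightarrow> real) set" where
  "L2 = {u. u \<in> borel_measurable lborel \<and> integrable lborel (\<lambda>x. (u x)^2)}"

definition test_fun :: "(real \<Rightarrow> real) \<Rightarrow> bool" where
  "test_fun \<phi> \<longleftrightarrow> (\<forall>k x. ((deriv ^^ k) \<phi>) differentiable (at x))
                    \<and> (\<exists>R. \<forall>x. R < \<bar>x\<bar> \<longrightarrow> \<phi> x = 0)"

definition weak_deriv :: "(real \<Rightarrow> real) \<Rightarrow> (real \<Rightarrow> real) \<Rightarrow> bool" where
  "weak_deriv u w \<longleftrightarrow> (\<forall>\<phi>. test_fun \<phi> \<longrightarrow>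
      (LINT x|lborel. u x * deriv \<phi> x) = - (LINT x|lborel. w x * \<phi> x))"

definition H1 :: "(real \<Rightarrow> real) set" where
  "H1 = {u. u \<in> L2 \<and> (\<exists>w\<in>L2. weak_deriv u w)}"

(* the weak derivative u' (unique up to null sets) *)
definition wd :: "(real \<Rightarrow> real) \<Rightarrow> (real \<Rightarrow> real)" where
  "wd u = (SOME w. w \<in> L2 \<and> weak_deriv u w)"

definition inner_beta :: "real \<Rightarrow> (real \<Rightarrow> real) \<Rightarrow> (real \<Rightarrow> real) \<Rightarrow> real" where
  "inner_beta \<beta> u v = (LINT x|lborel. wd u x * wd v x) + \<beta> * (LINT x|lborel. u x * v x)"

(* K_beta u = (-d^2/dx^2 + beta)^{-1} (V u), i.e. the (a.e. unique) v in H^1 which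
   weakly solves -v'' + beta v = V u:  <v,psi>_beta = <V u, psi>_{L^2} for all psi in H^1 *)
definition K_beta :: "(real \<Rightarrow> real) \<Rightarrow> real \<Rightarrow> (real \<Rightarrow> real) \<Rightarrow> (real \<Rightarrow> real)" where
  "K_beta V \<beta> u = (SOME v. v \<in> H1 \<and>
       (\<forall>\<psi>\<in>H1. inner_beta \<beta> v \<psi> = (LINT x|lborel. V x * u x * \<psi> x)))"

definition K_eigenspace :: "(real \<Rightarrow> real) \<Rightarrow> real \<Rightarrow> real \<Rightarrow> (real \<Rightarrow> real) set" where
  "K_eigenspace V \<beta> \<mu> = {u \<in> H1. AE x in lborel. K_beta V \<beta> u x = \<mu> * u x}"

definition K_eigenvalue :: "(real \<Rightarrow> real) \<Rightarrow> real \<Rightarrow> real \<Rightarrow> bool" where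
  "K_eigenvalue V \<beta> \<mu> \<longleftrightarrow> (\<exists>u\<in>K_eigenspace V \<beta> \<mu>. \<not> (AE x in lborel. u x = 0))"

definition ae_lin_indep :: "(real \<Rightarrow> real) list \<Rightarrow> bool" where
  "ae_lin_indep fs \<longleftrightarrow> (\<forall>c::nat \<Rightarrow> real.
      (AE x in lborel. (\<Sum>i<length fs. c i * (fs ! i) x) = 0) \<longrightarrow> (\<forall>i<length fs. c i = 0))"

definition K_mult :: "(real \<Rightarrow> real) \<Rightarrow> real \<Rightarrow> real \<Rightarrow> nat" where
  "K_mult V \<beta> \<mu> = Sup {k. \<exists>fs. length fs = k \<and> set fs \<subseteq> K_eigenspace V \<beta> \<mu> \<and> ae_lin_indep fs}"

definition neg_count :: "(real \<Rightarrow> real) \<Rightarrow> real \<Rightarrow> real \<Rightarrow> nat" where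
  "neg_count V \<beta> t = (\<Sum>\<mu>\<in>{\<nu>. \<nu> < 0 \<and> \<nu> \<le> t \<and> K_eigenvalue V \<beta> \<nu>}. K_mult V \<beta> \<mu>)"

(* mu_j(beta), j = 1,2,...: the negative eigenvalues counted with multiplicity,
   ordered by |mu_1| >= |mu_2| >= ... *)
definition mu :: "(real \<Rightarrow> real) \<Rightarrow> nat \<Rightarrow> real \<Rightarrow> real" where
  "mu V j \<beta> = Inf {t. t < 0 \<and> j \<le> neg_count V \<beta> t}"

definition Nminus_at :: "(real \<Rightarrow> real) \<Rightarrow> real \<Rightarrow> nat set" where
  "Nminus_at V \<beta> = {j. 1 \<le> j \<and> (\<exists>t<0. j \<le> neg_count V \<beta> t)}"

(* N_- (independent of beta) *)
definition Nminus :: "(real \<Rightarrow> real) \<Rightarrow> nat set" where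
  "Nminus V = {j. \<forall>\<beta>>0. j \<in> Nminus_at V \<beta>}"

definition Nminus0 :: "(real \<Rightarrow> real) \<Rightarrow> nat set" where
  "Nminus0 V = {j \<in> Nminus V. \<exists>L::ereal.
      ((\<lambda>\<beta>. ereal (mu V j \<beta>)) \<longlongrightarrow> L) (at_right 0) \<and> L < ereal (-1/2)}"

definition star_solution :: "(real \<Rightarrow> real) \<Rightarrow> real \<Rightarrow> (real \<Rightarrow> real) \<Rightarrow> bool" where
  "star_solution V lam \<phi> \<longleftrightarrow> \<phi> \<in> H1 \<and> (\<forall>\<psi>. test_fun \<psi> \<longrightarrow>
      (LINT x|lborel. wd \<phi> x * deriv \<psi> x) + (1 - lam^2) * (LINT x|lborel. \<phi> x * \<psi> x)
        = - (1 - lam) * (LINT x|lborel. V x * \<phi> x * \<psi> x))"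

definition star_eigenspace :: "(real \<Rightarrow> real) \<Rightarrow> real \<Rightarrow> (real \<Rightarrow> real) set" where
  "star_eigenspace V lam = {\<phi>. star_solution V lam \<phi>}"

definition star_eigenvalue :: "(real \<Rightarrow> real) \<Rightarrow> real \<Rightarrow> bool" where
  "star_eigenvalue V lam \<longleftrightarrow> (\<exists>\<phi>. star_solution V lam \<phi> \<and> \<not> (AE x in lborel. \<phi> x = 0))"

definition Linf_norm :: "(real \<Rightarrow> real) \<Rightarrow> real" where
  "Linf_norm f = Inf {M. 0 \<le> M \<and> (AE x in lborel. \<bar>f x\<bar> \<le> M)}"

definition beta_j :: "(real \<Rightarrow> real) \<Rightarrow> nat \<Rightarrow> real" where
  "beta_j V j = (THE \<beta>. 0 < \<beta> \<and> \<beta> \<le> 1 \<and>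
      \<beta> = - (1 / mu V j \<beta>) * (2 + 1 / mu V j \<beta>))"

definition lambda_j :: "(real \<Rightarrow> real) \<Rightarrow> nat \<Rightarrow> real" where
  "lambda_j V j = 1 + 1 / mu V j (beta_j V j)"

end

theory Submission
  imports Defs "HOL-Complex_Analysis.Great_Picard"
begin

text \<open>
  Fix \<open>t < 0\<close>. By compactness the eigenvectors of \<open>K\<^sub>\<beta>\<close> with eigenvalue at most \<open>t\<close> span a
  finite-dimensional space, and minimising the Rayleigh quotient on its orthogonal complement shows
  that it has maximal dimension among the subspaces on which
  \<open>\<integral>V u\<^sup>2 \<le> t \<langle>u, u\<rangle>\<^sub>\<beta>\<close>. Since \<open>\<langle>u, u\<rangle>\<^sub>\<beta> \<le> \<langle>u, u\<rangle>\<^sub>\<gamma> \<le> (\<gamma>/\<beta>) \<langle>u, u\<rangle>\<^sub>\<beta>\<close>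
  for \<open>\<beta> \<le> \<gamma>\<close>, the eigenvalues satisfy \<open>\<mu>\<^sub>j(\<beta>) \<le> \<mu>\<^sub>j(\<gamma>) \<le> (\<beta>/\<gamma>) \<mu>\<^sub>j(\<beta>)\<close>, so they are
  monotone and continuous in \<open>\<beta>\<close>, and the index set does not depend on \<open>\<beta>\<close>.

  A number \<open>\<lambda> \<in> (-1, 1)\<close> is an eigenvalue of the nonlinear problem iff \<open>1/(\<lambda> - 1)\<close> is an eigenvalue
  of \<open>K\<^sub>\<beta>\<close> for \<open>\<beta> = 1 - \<lambda>\<^sup>2\<close>. The bound on the negative part of \<open>V\<close> gives \<open>\<mu>\<^sub>j(\<beta>) \<ge> -1/\<beta>\<close>,
  which forces \<open>\<lambda> = - \<surd>(1 - \<beta>)\<close>; on this branch the two sides of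
  \<open>1 + 1/\<mu>\<^sub>j(\<beta>) = - \<surd>(1 - \<beta>)\<close> have opposite monotonicity.
\<close>

section \<open>Spectral theory of compact quadratic forms\<close>

text \<open>Everything runs through two symmetric forms, \<open>G u v\<close> for the inner product
  with parameter \<beta> and \<open>B u v\<close> for the integral of V u v. The eigenvalue equation
  becomes \<open>B u \<psi> = \<mu> * G u \<psi>\<close>, in which \<beta> enters through
  \<open>G\<close> alone, so comparing two parameters amounts to an inequality between quadratic
  forms on one vector space. The definitions make finiteness an obligation: \<open>neg_count\<close>
  is a sum over a set, \<open>K_mult\<close> a \<open>Sup\<close> of naturals and \<open>mu\<close>
  an \<open>Inf\<close> of reals, and these carry their intended meaning only when the sets
  concerned are finite or bounded. Hence the counting of independent vectors that precedes any
  statement about \<open>mu\<close>. A second obstacle is that \<open>star_solution\<close> tests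
  with smooth compactly supported functions but \<open>K_beta\<close> with all of \<open>H1\<close>.
  The two are reconciled by regularity: for a solution \<phi> the weak derivative
  \<open>wd \<phi>\<close> lies in \<open>H1\<close> itself, and integration by parts over the whole
  line applies. The threshold -1/2 in \<open>Nminus0\<close> is the value of 1/(\<lambda> - 1) at
  \<lambda> = -1.\<close>

lemma nontrivial_common_zero:
  fixes f :: "'i \<Rightarrow> 'a::real_vector \<Rightarrow> real"
  assumes "finite I" "finite T" "independent T" "card I < card T" "\<And>i. i \<in> I \<Longrightarrow> linear (f i)"
  shows "\<exists>s\<in>span T. s \<noteq> 0 \<and> (\<forall>i\<in>I. f i s = 0)"
  using assms
proof (induction I arbitrary: T rule: finite_induct)
  case empty
  then obtain v where "v \<in> T" by fastforce
  moreover from this have "v \<noteq> 0" using empty dependent_zero by blast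
  ultimately show ?case by (auto intro: span_base)
next
  case (insert k I T)
  have lin: "linear (f k)" using insert by simp
  show ?case
  proof (cases "\<forall>v\<in>T. f k v = 0")
    case True
    obtain s where s: "s \<in> span T" "s \<noteq> 0" "\<forall>i\<in>I. f i s = 0"
      using insert.IH[of T] insert.prems insert.hyps by auto
    have "f k s = 0"
      using linear_eq_0_on_span[OF lin _ s(1)] True by blast
    with s show ?thesis by auto
  next
    case False
    then obtain w where w: "w \<in> T" "f k w \<noteq> 0" by blast
    \<comment> \<open>\<open>g\<close> projects along \<open>w\<close> onto the kernel of
      \<open>f k\<close>. It is injective on \<open>span (T - {w})\<close> because its kernel is the
      line through \<open>w\<close>, so the image of \<open>T - {w}\<close> is independent, and both
      the number of vectors and the number of functionals have dropped by one.\<close>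
    define g where "g v = v - (f k v / f k w) *\<^sub>R w" for v
    let ?T = "g ` (T - {w})"
    have indw: "independent (T - {w})" "w \<notin> span (T - {w})"
      using insert.prems(2) w independent_mono[of T "T - {w}"] dependent_def by blast+
    have ling: "linear g"
      unfolding g_def using lin by (auto intro!: linearI simp: linear_add linear_scale algebra_simps add_divide_distrib)
    have inj: "inj_on g (span (T - {w}))"
      unfolding linear_injective_on_subspace_0[OF ling subspace_span]
    proof (intro ballI impI)
      fix x assume x: "x \<in> span (T - {w})" "g x = 0"
      then have xe: "x = (f k x / f k w) *\<^sub>R w" by (simp add: g_def)
      show "x = 0"
      proof (rule ccontr)
        assume "x \<noteq> 0"
        then have "f k x / f k w \<noteq> 0" using xe by auto
        moreover have "(1 / (f k x / f k w)) *\<^sub>R x = (1 / (f k x / f k w)) *\<^sub>R ((f k x / f k w) *\<^sub>R w)"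
          using xe by (rule arg_cong)
        ultimately have "w = (1 / (f k x / f k w)) *\<^sub>R x" by simp
        moreover have "(1 / (f k x / f k w)) *\<^sub>R x \<in> span (T - {w})" using x(1) by (rule span_scale)
        ultimately have "w \<in> span (T - {w})" by simp
        then show False using indw by blast
      qed
    qed
    have indT: "independent ?T"
      using linear_independent_injective_image[OF ling indw(1) inj] .
    have "card ?T = card (T - {w})"
      using inj_on_subset[OF inj span_superset] by (rule card_image)
    also have "\<dots> > card I" using insert.prems insert.hyps w by (simp add: card_Diff_singleton)
    finally obtain s where s: "s \<in> span ?T" "s \<noteq> 0" "\<forall>i\<in>I. f i s = 0"
      using insert.IH[of ?T] insert.prems indT by auto
    have "span ?T \<subseteq> span T"
      unfolding g_def using w
      by (intro span_minimal subspace_span image_subsetI span_diff span_scale) (auto intro: span_base)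
    moreover have "f k s = 0"
    proof (rule linear_eq_0_on_span[OF lin _ s(1)])
      fix x assume "x \<in> ?T" then show "f k x = 0" using w(2) lin by (auto simp: g_def linear_diff linear_scale)
    qed
    ultimately show ?thesis using s by auto
  qed
qed

text \<open>The parabola in \<open>c\<close> is evaluated at its minimum \<open>- b / d\<close>. For
  \<open>d = 0\<close> it is a line, and unless \<open>b = 0\<close> the chosen argument gives it
  the value -1. Both Cauchy-Schwarz inequalities below, for forms and for \<open>L2\<close>, come
  from here.\<close>

lemma nonneg_quadratic_discriminant:
  fixes a b d :: real
  assumes nonneg: "\<And>c. 0 \<le> a + 2 * c * b + c\<^sup>2 * d" and d: "0 \<le> d"
  shows "b\<^sup>2 \<le> a * d"
proof (cases "d = 0")
  case True
  have "b = 0"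
  proof (rule ccontr)
    assume "b \<noteq> 0"
    then show False using nonneg[of "- (a + 1) / (2 * b)"] True by (simp add: field_simps)
  qed
  then show ?thesis using True by simp
next
  case False
  then have "d > 0" using d by simp
  then show ?thesis using nonneg[of "- b / d"] by (simp add: field_simps power2_eq_square)
qed

text \<open>No sign condition, so that \<open>G\<close>, the indefinite \<open>B\<close> and the
  shifted form \<open>B - m G\<close> are all instances.\<close>

locale sym_form =
  fixes F :: "'a::real_vector \<Rightarrow> 'a \<Rightarrow> real"
  assumes add_left: "F (x + y) z = F x z + F y z"
    and scale_left: "F (c *\<^sub>R x) y = c * F x y"
    and sym: "F x y = F y x"
begin

lemma add_right: "F z (x + y) = F z x + F z y"
  using add_left sym by metis

lemma scale_right: "F y (c *\<^sub>R x) = c * F y x"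
  using scale_left sym by metis

lemma linear_left: "linear (\<lambda>x. F x y)"
  by (auto intro!: linearI simp: add_left scale_left)

lemma linear_right: "linear (F y)"
  by (auto intro!: linearI simp: add_right scale_right)

lemma zero [simp]: "F 0 y = 0" "F y 0 = 0"
  using linear_0[OF linear_left] linear_0[OF linear_right] by auto

lemma diff_left: "F (x - y) z = F x z - F y z"
  using linear_diff[OF linear_left] by auto

lemma diff_right: "F z (x - y) = F z x - F z y"
  using linear_diff[OF linear_right] by auto

lemma sum_left: "F (\<Sum>i\<in>I. f i) y = (\<Sum>i\<in>I. F (f i) y)"
  using linear_sum[OF linear_left] by auto

lemma sum_right: "F y (\<Sum>i\<in>I. f i) = (\<Sum>i\<in>I. F y (f i))"
  using linear_sum[OF linear_right] by auto

lemmas expand = add_left add_right scale_left scale_right diff_left diff_right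

text \<open>Restricted to a subspace \<open>X\<close>, because the shifted form
  \<open>B - m G\<close> is nonnegative only on an orthogonal complement.\<close>

lemma Cauchy_Schwarz:
  assumes "subspace X" and psd: "\<And>x. x \<in> X \<Longrightarrow> 0 \<le> F x x" and a: "a \<in> X" and b: "b \<in> X"
  shows "(F a b)\<^sup>2 \<le> F a a * F b b"
proof (rule nonneg_quadratic_discriminant)
  fix c
  have "a + c *\<^sub>R b \<in> X" using assms by (simp add: subspace_add subspace_scale)
  then have "0 \<le> F (a + c *\<^sub>R b) (a + c *\<^sub>R b)" by (rule psd)
  also have "\<dots> = F a a + 2 * c * F a b + c\<^sup>2 * F b b"
    using sym[of b a] by (simp add: expand algebra_simps power2_eq_square)
  finally show "0 \<le> F a a + 2 * c * F a b + c\<^sup>2 * F b b" .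
qed (rule psd[OF b])

text \<open>The parallelogram law with the term in \<open>x + y\<close> dropped; it replaces the
  triangle inequality for a form that is only semidefinite.\<close>

lemma diff_le_parallelogram:
  assumes "0 \<le> F (x + y) (x + y)"
  shows "F (x - y) (x - y) \<le> 2 * F x x + 2 * F y y"
  using assms sym[of x y] by (simp add: expand)

end

text \<open>A locale and not a type class, since the inner product varies with \<beta> on one and
  the same vector space. \<open>complete\<close> is completeness for the norm whose square is
  \<open>G x x\<close>.\<close>

locale hilbert_form = sym_form G for G :: "'a::real_vector \<Rightarrow> 'a \<Rightarrow> real" +
  assumes pos: "x \<noteq> 0 \<Longrightarrow> 0 < G x x"
    and complete: "\<And>x :: nat \<Rightarrow> 'a. (\<And>e. 0 < e \<Longrightarrow> \<exists>N. \<forall>m\<ge>N. \<forall>n\<ge>N. G (x m - x n) (x m - x n) < e)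
      \<Longrightarrow> \<exists>l. (\<lambda>n. G (x n - l) (x n - l)) \<longlonglongrightarrow> 0"
begin

lemma nonneg: "0 \<le> G x x"
  by (cases "x = 0") (auto simp: pos less_imp_le)

lemma CS: "(G a b)\<^sup>2 \<le> G a a * G b b"
  by (rule Cauchy_Schwarz[of UNIV]) (auto simp: nonneg)

lemma eq_0_iff: "G x x = 0 \<longleftrightarrow> x = 0"
  using pos[of x] by (cases "x = 0") auto

lemma tendsto_right:
  assumes "(\<lambda>n. G (x n - l) (x n - l)) \<longlonglongrightarrow> 0"
  shows "(\<lambda>n. G e (x n)) \<longlonglongrightarrow> G e l"
proof -
  have "(\<lambda>n. G e (x n - l)) \<longlonglongrightarrow> 0"
  proof (rule Lim_null_comparison)
    show "(\<lambda>n. sqrt (G e e * G (x n - l) (x n - l))) \<longlonglongrightarrow> 0"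
      using tendsto_real_sqrt[OF tendsto_mult_left[OF assms, of "G e e"]] by simp
    show "\<forall>\<^sub>F n in sequentially. norm (G e (x n - l)) \<le> sqrt (G e e * G (x n - l) (x n - l))"
      using CS by (intro always_eventually allI real_le_rsqrt) simp
  qed
  then show ?thesis unfolding diff_right by (simp add: LIM_zero_iff)
qed

text \<open>The representing vector minimises the energy \<open>J\<close>. Completeness yields the
  minimiser, and the first variation of \<open>J\<close> vanishes there.\<close>

lemma Riesz_representation:
  assumes lin: "linear f" and bd: "\<And>x. (f x)\<^sup>2 \<le> C * G x x"
  shows "\<exists>v. \<forall>x. G v x = f x"
proof -
  define J where "J x = G x x - 2 * f x" for x
  \<comment> \<open>AM-GM for \<open>\<bar>C\<bar>\<close> and \<open>G x x\<close>; it bounds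
    \<open>J\<close> below by \<open>- \<bar>C\<bar>\<close>.\<close>
  have C: "\<bar>f x\<bar> \<le> (\<bar>C\<bar> + G x x) / 2" for x
  proof -
    have "(f x)\<^sup>2 \<le> \<bar>C\<bar> * G x x" using bd[of x] nonneg[of x]
      by (meson abs_ge_self dual_order.trans mult_right_mono)
    also have "\<dots> \<le> ((\<bar>C\<bar> + G x x) / 2)\<^sup>2"
      using sum_squares_ge_zero[of "\<bar>C\<bar> - G x x" 0] by (simp add: power2_eq_square field_simps)
    finally show ?thesis
      using nonneg[of x] abs_le_square_iff[of "f x" "(\<bar>C\<bar> + G x x) / 2"] by simp
  qed
  define m where "m = Inf (range J)"
  have bdd: "bdd_below (range J)"
  proof (rule bdd_belowI2)
    fix x show "- \<bar>C\<bar> \<le> J x" using C[of x] abs_ge_self[of "f x"] unfolding J_def by (simp add: field_simps)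
  qed
  have mJ: "m \<le> J x" for x unfolding m_def using bdd by (simp add: cInf_lower)
  have "\<exists>x. J x < m + 1 / Suc n" for n
    using cInf_lessD[of "range J" "m + 1 / Suc n"] unfolding m_def by auto
  then obtain x where x: "\<And>n. J (x n) < m + 1 / Suc n" by metis
  \<comment> \<open>The linear part cancels in the parallelogram law for \<open>J\<close>. Two
    points with values near the infimum \<open>m\<close> are therefore close, as the value at their
    midpoint is still at least \<open>m\<close>.\<close>
  have mid: "G (a - b) (a - b) = 2 * J a + 2 * J b - 4 * J ((1/2) *\<^sub>R (a + b))" for a b
    unfolding J_def by (simp add: expand linear_add[OF lin] linear_scale[OF lin] sym[of b a] algebra_simps)
  have "\<exists>l. (\<lambda>n. G (x n - l) (x n - l)) \<longlonglongrightarrow> 0"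
  proof (rule complete)
    fix e :: real assume "0 < e"
    then obtain N where N: "1 / Suc N < e / 4" using nat_approx_posE[of "e/4"] by auto
    have "G (x i - x j) (x i - x j) < e" if "N \<le> i" "N \<le> j" for i j
    proof -
      have "1 / Suc i \<le> 1 / Suc N" "1 / Suc j \<le> 1 / Suc N" using that by (auto simp: field_simps)
      then have "J (x i) < m + e / 4" "J (x j) < m + e / 4" using x[of i] x[of j] N by linarith+
      then show ?thesis using mid[of "x i" "x j"] mJ[of "(1/2) *\<^sub>R (x i + x j)"] by linarith
    qed
    then show "\<exists>N. \<forall>i\<ge>N. \<forall>j\<ge>N. G (x i - x j) (x i - x j) < e" by blast
  qed
  then obtain v where v: "(\<lambda>n. G (x n - v) (x n - v)) \<longlonglongrightarrow> 0" by blast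
  have Jlim: "J v \<le> J y" for y
  proof -
    have fl: "(\<lambda>n. f (x n - v)) \<longlonglongrightarrow> 0"
    proof (rule Lim_null_comparison)
      show "(\<lambda>n. sqrt (C * G (x n - v) (x n - v))) \<longlonglongrightarrow> 0"
        using tendsto_real_sqrt[OF tendsto_mult_left[OF v, of C]] by simp
      show "\<forall>\<^sub>F n in sequentially. norm (f (x n - v)) \<le> sqrt (C * G (x n - v) (x n - v))"
        using bd by (intro always_eventually allI real_le_rsqrt) simp
    qed
    have "(\<lambda>n. J (x n)) \<longlonglongrightarrow> J v"
    proof -
      have "J (x n) = G (x n - v) (x n - v) + 2 * G v (x n) - G v v - 2 * f v - 2 * f (x n - v)" for n
        unfolding J_def by (simp add: expand linear_diff[OF lin] sym[of "x n" v])
      then have "(\<lambda>n. J (x n)) = (\<lambda>n. G (x n - v) (x n - v) + 2 * G v (x n) - G v v - 2 * f v - 2 * f (x n - v))"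
        by auto
      moreover have "\<dots> \<longlonglongrightarrow> 0 + 2 * G v v - G v v - 2 * f v - 2 * 0"
        by (intro tendsto_intros v tendsto_right fl)
      ultimately show ?thesis by (simp add: J_def)
    qed
    moreover have "(\<lambda>n. m + 1 / real (Suc n)) \<longlonglongrightarrow> m + 0"
      by (intro tendsto_intros LIMSEQ_Suc[OF lim_1_over_n])
    ultimately have "J v \<le> m + 0"
      by (rule LIMSEQ_le) (use x less_imp_le in blast)
    with mJ[of y] show ?thesis by simp
  qed
  have "G v y = f y" for y
  proof (rule ccontr)
    assume ne: "G v y \<noteq> f y"
    define d where "d = G v y - f y"
    \<comment> \<open>The optimal step would be \<open>- d / G y y\<close>; the added 1 keeps the
      denominator positive for \<open>y = 0\<close> and still makes the variation negative.\<close>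
    define c where "c = - d / (G y y + 1)"
    have "J v \<le> J (v + c *\<^sub>R y)" by (rule Jlim)
    then have "0 \<le> 2 * c * d + c\<^sup>2 * G y y"
      unfolding J_def d_def
      by (simp add: expand linear_add[OF lin] linear_scale[OF lin] sym[of y v] algebra_simps power2_eq_square)
    also have "\<dots> = (d / (G y y + 1))\<^sup>2 * (- G y y - 2)"
    proof -
      define k where "k = G y y + 1"
      have k: "k > 0" "G y y = k - 1" using nonneg[of y] by (auto simp: k_def)
      show ?thesis unfolding c_def k_def[symmetric] using k(1)
        by (simp add: k(2) field_simps power2_eq_square)
    qed
    finally have "0 \<le> (d / (G y y + 1))\<^sup>2 * (- G y y - 2)" .
    moreover have "(d / (G y y + 1))\<^sup>2 > 0" using ne nonneg[of y] by (simp add: d_def)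
    ultimately show False using nonneg[of y] by (simp add: zero_le_mult_iff)
  qed
  then show ?thesis by blast
qed

end

text \<open>Compactness is imposed on the quadratic form of \<open>B\<close> and not on an operator:
  a bounded sequence has a subsequence whose differences become small for \<open>B\<close>.\<close>

locale compact_forms = hilbert_form G + B: sym_form B
  for G B :: "'a::real_vector \<Rightarrow> 'a \<Rightarrow> real" +
  fixes C :: real
  assumes bound: "\<bar>B x x\<bar> \<le> C * G x x"
    and compact: "\<And>x :: nat \<Rightarrow> 'a. \<lbrakk>\<And>n. G (x n) (x n) \<le> M\<rbrakk> \<Longrightarrow>
      \<exists>r :: nat \<Rightarrow> nat. strict_mono r \<and> (\<forall>e>0. \<exists>N. \<forall>m\<ge>N. \<forall>n\<ge>N. \<bar>B (x (r m) - x (r n)) (x (r m) - x (r n))\<bar> < e)"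
begin

text \<open>The weak form of \<open>K u = \<mu> *\<^sub>R u\<close>, where \<open>K\<close>
  represents \<open>B\<close> with respect to \<open>G\<close>.\<close>

definition eig :: "real \<Rightarrow> 'a set" where
  "eig \<mu> = {u. \<forall>\<psi>. B u \<psi> = \<mu> * G u \<psi>}"

definition low :: "real \<Rightarrow> 'a set" where
  "low t = span (\<Union>\<mu>\<in>{..t}. eig \<mu>)"

lemma eigD: "u \<in> eig \<mu> \<Longrightarrow> B u \<psi> = \<mu> * G u \<psi>"
  by (simp add: eig_def)

lemma subspace_eig: "subspace (eig \<mu>)"
  by (auto simp: subspace_def eig_def expand B.expand algebra_simps)

lemma eig_orthogonal:
  assumes "u \<in> eig \<mu>" "v \<in> eig \<nu>" "\<mu> \<noteq> \<nu>"
  shows "G u v = 0"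
proof -
  have "\<mu> * G u v = \<nu> * G u v"
    using eigD[OF assms(1), of v] eigD[OF assms(2), of u] sym B.sym by metis
  then show ?thesis using assms(3) by simp
qed

text \<open>Indexing the sum by eigenvalues collects all contributions to one eigenvalue, which
  makes the summands pairwise orthogonal.\<close>

lemma low_decompose:
  assumes "u \<in> low t"
  shows "\<exists>M f. finite M \<and> M \<subseteq> {..t} \<and> (\<forall>\<mu>\<in>M. f \<mu> \<in> eig \<mu>) \<and> u = (\<Sum>\<mu>\<in>M. f \<mu>)"
  using assms unfolding low_def
proof (induction rule: span_induct_alt)
  case base
  show ?case by (intro exI[of _ "{}"]) auto
next
  case (step c x y)
  then obtain \<nu> M f where x: "\<nu> \<le> t" "x \<in> eig \<nu>"
    and M: "finite M" "M \<subseteq> {..t}" "\<forall>\<mu>\<in>M. f \<mu> \<in> eig \<mu>" "y = (\<Sum>\<mu>\<in>M. f \<mu>)" by auto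
  define g where "g \<mu> = (if \<mu> \<in> M then f \<mu> else 0) + (if \<mu> = \<nu> then c *\<^sub>R x else 0)" for \<mu>
  have "(\<Sum>\<mu>\<in>insert \<nu> M. g \<mu>) = (\<Sum>\<mu>\<in>insert \<nu> M. if \<mu> \<in> M then f \<mu> else 0) + c *\<^sub>R x"
    using M(1) by (simp add: g_def sum.distrib)
  also have "(\<Sum>\<mu>\<in>insert \<nu> M. if \<mu> \<in> M then f \<mu> else 0) = (\<Sum>\<mu>\<in>M. f \<mu>)"
    using M(1) by (intro sum.mono_neutral_cong_right) auto
  finally have "c *\<^sub>R x + y = (\<Sum>\<mu>\<in>insert \<nu> M. g \<mu>)" using M(4) by simp
  moreover have "g \<mu> \<in> eig \<mu>" if "\<mu> \<in> insert \<nu> M" for \<mu>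
    using that M(3) x(2) subspace_eig by (auto simp: g_def subspace_add subspace_scale subspace_0)
  ultimately show ?case using M x by (intro exI[of _ "insert \<nu> M"] exI[of _ g]) auto
qed

lemma low_form_le:
  assumes "u \<in> low t"
  shows "B u u \<le> t * G u u"
proof -
  obtain M f where M: "finite M" "M \<subseteq> {..t}" "\<forall>\<mu>\<in>M. f \<mu> \<in> eig \<mu>" "u = (\<Sum>\<mu>\<in>M. f \<mu>)"
    using low_decompose[OF assms] by blast
  have Guf: "G (f \<mu>) u = G (f \<mu>) (f \<mu>)" if "\<mu> \<in> M" for \<mu>
  proof -
    have "G (f \<mu>) u = (\<Sum>\<nu>\<in>M. if \<nu> = \<mu> then G (f \<mu>) (f \<mu>) else 0)"
      unfolding M(4) sum_right using M(3) that by (intro sum.cong) (auto intro!: eig_orthogonal)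
    then show ?thesis using M(1) that by simp
  qed
  have "B u u = (\<Sum>\<mu>\<in>M. B (f \<mu>) u)" by (subst M(4)) (simp add: B.sum_left)
  also have "\<dots> = (\<Sum>\<mu>\<in>M. \<mu> * G (f \<mu>) (f \<mu>))"
    using M(3) Guf by (intro sum.cong) (auto simp: eigD)
  also have "\<dots> \<le> (\<Sum>\<mu>\<in>M. t * G (f \<mu>) (f \<mu>))"
    using M(2) nonneg by (intro sum_mono mult_right_mono) auto
  also have "\<dots> = t * (\<Sum>\<mu>\<in>M. G (f \<mu>) u)" using Guf by (simp add: sum_distrib_left)
  also have "(\<Sum>\<mu>\<in>M. G (f \<mu>) u) = G u u" by (subst (2) M(4)) (simp add: sum_left)
  finally show ?thesis .
qed

text \<open>Differences within an orthonormal sequence in \<open>S\<close> have \<open>G\<close>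
  equal to 2, hence \<open>B\<close> at most \<open>2 * t < 0\<close>, and no subsequence can make
  that small. Unbounded dimension would supply such a sequence.\<close>

lemma independent_card_bounded:
  assumes S: "subspace S" and t: "t < 0" and le: "\<And>u. u \<in> S \<Longrightarrow> B u u \<le> t * G u u"
  shows "\<exists>N. \<forall>T. T \<subseteq> S \<longrightarrow> finite T \<longrightarrow> independent T \<longrightarrow> card T \<le> N"
proof (rule ccontr)
  assume "\<not> ?thesis"
  then have big: "\<exists>T. T \<subseteq> S \<and> finite T \<and> independent T \<and> N < card T" for N by (meson not_le)
  \<comment> \<open>An independent set larger than \<open>I\<close> spans a nonzero common zero of
    the functionals \<open>G v\<close> with \<open>v \<in> I\<close>, which is then
    normalised.\<close>
  have step: "\<exists>e\<in>S. G e e = 1 \<and> (\<forall>v\<in>I. G v e = 0)" if "finite I" for I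
  proof -
    obtain T where T: "T \<subseteq> S" "finite T" "independent T" "card I < card T" using big by blast
    obtain s where s: "s \<in> span T" "s \<noteq> 0" "\<forall>v\<in>I. G v s = 0"
      using nontrivial_common_zero[of I T G] \<open>finite I\<close> T(2-4) linear_right by auto
    have "s \<in> S" using s(1) span_minimal[OF T(1) S] by blast
    then have "(1 / sqrt (G s s)) *\<^sub>R s \<in> S" using S by (simp add: subspace_scale)
    moreover have "G ((1 / sqrt (G s s)) *\<^sub>R s) ((1 / sqrt (G s s)) *\<^sub>R s) = 1"
      using pos[OF s(2)] by (simp add: expand)
    moreover have "\<forall>v\<in>I. G v ((1 / sqrt (G s s)) *\<^sub>R s) = 0" using s(3) by (simp add: expand)
    ultimately show ?thesis by blast
  qed
  \<comment> \<open>Well-founded recursion, since the choice of \<open>x n\<close> refers to all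
    earlier terms.\<close>
  define x where "x = wfrec less_than (\<lambda>x n. SOME e. e \<in> S \<and> G e e = 1 \<and> (\<forall>i<n. G (x i) e = 0))"
  have xn: "x n = (SOME e. e \<in> S \<and> G e e = 1 \<and> (\<forall>i<n. G (x i) e = 0))" for n
    unfolding x_def by (subst wfrec) (auto simp: cut_def cong: conj_cong)
  have ex: "\<exists>e. e \<in> S \<and> G e e = 1 \<and> (\<forall>i<n. G (x i) e = 0)" for n
    using step[of "x ` {..<n}"] by auto
  have x: "x n \<in> S \<and> G (x n) (x n) = 1 \<and> (\<forall>i<n. G (x i) (x n) = 0)" for n
    using someI_ex[OF ex[of n]] unfolding xn[of n, symmetric] .
  have dist: "B (x m - x n) (x m - x n) \<le> 2 * t" if "m \<noteq> n" for m n
  proof -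
    have "G (x m) (x n) = 0" using x[of m] x[of n] that sym[of "x m" "x n"] by (cases "m < n") auto
    then have "G (x m - x n) (x m - x n) = 2" using x[of m] x[of n] sym[of "x n" "x m"] by (simp add: expand)
    then show ?thesis using le[of "x m - x n"] x S by (simp add: subspace_diff)
  qed
  obtain r where r: "strict_mono (r :: nat \<Rightarrow> nat)"
    "\<forall>e>0. \<exists>N. \<forall>m\<ge>N. \<forall>n\<ge>N. \<bar>B (x (r m) - x (r n)) (x (r m) - x (r n))\<bar> < e"
    using compact[of x 1] x by auto
  obtain N where "\<forall>m\<ge>N. \<forall>n\<ge>N. \<bar>B (x (r m) - x (r n)) (x (r m) - x (r n))\<bar> < - t"
    using r(2)[rule_format, of "- t"] t by auto
  then have "\<bar>B (x (r N) - x (r (Suc N))) (x (r N) - x (r (Suc N)))\<bar> < - t" by simp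
  moreover have "r N \<noteq> r (Suc N)" using r(1) by (metis n_not_Suc_n strict_mono_eq)
  ultimately show False using dist[of "r N" "r (Suc N)"] t by linarith
qed

lemma independent_finite:
  assumes S: "subspace S" and t: "t < 0" and le: "\<And>u. u \<in> S \<Longrightarrow> B u u \<le> t * G u u"
    and T: "T \<subseteq> S" "independent T"
  shows "finite T"
proof -
  obtain N where N: "\<And>T. T \<subseteq> S \<Longrightarrow> finite T \<Longrightarrow> independent T \<Longrightarrow> card T \<le> N"
    using independent_card_bounded[OF S t le] by blast
  show ?thesis
  proof (rule ccontr)
    assume "infinite T"
    then obtain T' where T': "T' \<subseteq> T" "finite T'" "card T' = Suc N"
      using infinite_arbitrarily_large by blast
    then show False using N[of T'] T independent_mono by fastforce
  qed
qed

lemma low_basis: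
  assumes "t < 0"
  obtains T where "finite T" "independent T" "T \<subseteq> low t" "low t = span T" "card T = dim (low t)"
proof -
  have sub: "subspace (low t)" by (simp add: low_def)
  obtain T where T: "T \<subseteq> low t" "independent T" "low t \<subseteq> span T" "card T = dim (low t)"
    using basis_exists by blast
  moreover have "span T \<subseteq> low t" using T(1) sub by (simp add: span_minimal)
  moreover have "finite T" using independent_finite[OF sub assms low_form_le T(1,2)] .
  ultimately show ?thesis using that by blast
qed

text \<open>Orthogonal projection by counting: \<open>span (insert \<psi> T)\<close> has one
  dimension more than there are conditions \<open>G v s = 0\<close>, so a nonzero solution
  \<open>s\<close> exists. Its coefficient \<open>k\<close> of \<psi> cannot vanish, for otherwise
  \<open>s\<close> would lie in \<open>low t\<close> and be orthogonal to itself.\<close>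

lemma low_complement:
  assumes "t < 0"
  shows "\<exists>e\<in>low t. \<forall>v\<in>low t. G v (\<psi> - e) = 0"
proof (cases "\<psi> \<in> low t")
  case True
  then show ?thesis by (intro bexI[of _ \<psi>]) auto
next
  case False
  obtain T where T: "finite T" "independent T" "T \<subseteq> low t" "low t = span T"
    using low_basis[OF assms] by metis
  have "independent (insert \<psi> T)" "\<psi> \<notin> T"
    using False T by (auto simp: independent_insert span_base)
  then obtain s where s: "s \<in> span (insert \<psi> T)" "s \<noteq> 0" "\<forall>v\<in>T. G v s = 0"
    using nontrivial_common_zero[of T "insert \<psi> T" G] T(1) linear_right by auto
  have orth: "G v s = 0" if "v \<in> low t" for v
    using linear_eq_0_on_span[OF linear_left, of T s v] s(3) that T(4) by auto
  obtain k where k: "s - k *\<^sub>R \<psi> \<in> low t" using s(1) T(4) by (auto simp: span_insert)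
  have "k \<noteq> 0"
  proof
    assume "k = 0"
    then have "s \<in> low t" using k by simp
    then have "G s s = 0" using orth by blast
    then show False using s(2) eq_0_iff by blast
  qed
  define e where "e = (- 1 / k) *\<^sub>R (s - k *\<^sub>R \<psi>)"
  have "e \<in> low t" using k T(4) by (metis e_def span_scale)
  moreover have "\<psi> - e = (1 / k) *\<^sub>R s" using \<open>k \<noteq> 0\<close> by (simp add: e_def algebra_simps)
  ultimately show ?thesis using orth by (intro bexI[of _ e]) (auto simp: expand)
qed

text \<open>If the infimum \<open>m\<close> of the Rayleigh quotient on the complement were at most \<open>t\<close>, then
  \<open>F = B - m G\<close> is nonnegative there, so the parallelogram law and compactness of \<open>B\<close> make every
  minimising sequence Cauchy for \<open>- m G\<close>; its limit is an eigenvector orthogonal to itself.\<close>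

lemma form_gt_on_complement:
  assumes t: "t < 0" and u: "u \<noteq> 0" and orth: "\<And>e. e \<in> low t \<Longrightarrow> G e u = 0"
  shows "t * G u u < B u u"
proof (rule ccontr)
  assume "\<not> ?thesis"
  then have ule: "B u u \<le> t * G u u" by simp
  define X where "X = {x. \<forall>e\<in>low t. G e x = 0}"
  have subX: "subspace X" by (auto simp: X_def subspace_def expand)
  define A where "A = {B x x |x. x \<in> X \<and> G x x = 1}"
  define m where "m = Inf A"
  define u1 where "u1 = (1 / sqrt (G u u)) *\<^sub>R u"
  have u1: "u1 \<in> X" "G u1 u1 = 1" "B u1 u1 \<le> t"
    using orth pos[OF u] ule by (auto simp: u1_def X_def expand B.expand field_simps)
  have bdd: "bdd_below A"
  proof (rule bdd_belowI)
    fix a assume "a \<in> A"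
    then obtain x where "a = B x x" "G x x = 1" by (auto simp: A_def)
    then show "- C \<le> a" using bound[of x] by simp
  qed
  have mt: "m \<le> t" using cInf_lower[OF _ bdd, of "B u1 u1"] u1 unfolding m_def A_def by force
  have mle: "m * G x x \<le> B x x" if "x \<in> X" for x
  proof (cases "x = 0")
    case False
    define y where "y = (1 / sqrt (G x x)) *\<^sub>R x"
    have "y \<in> X" "G y y = 1" "B y y = B x x / G x x"
      using that pos[OF False] by (auto simp: y_def X_def expand B.expand field_simps)
    then have "m \<le> B x x / G x x" unfolding m_def using bdd
      by (intro cInf_lower) (auto simp: A_def intro!: exI[of _ y])
    then show ?thesis using pos[OF False] by (simp add: field_simps)
  qed simp
  define F where "F x y = B x y - m * G x y" for x y
  interpret F: sym_form F
    by unfold_locales (auto simp: F_def expand B.expand algebra_simps sym B.sym)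
  have Fpos: "0 \<le> F x x" if "x \<in> X" for x using mle[OF that] by (simp add: F_def)
  have "\<exists>x. x \<in> X \<and> G x x = 1 \<and> B x x < m + 1 / Suc n" for n
    using cInf_lessD[of A "m + 1 / Suc n"] u1 unfolding m_def A_def by auto
  then obtain x where x: "\<And>n. x n \<in> X" "\<And>n. G (x n) (x n) = 1" "\<And>n. B (x n) (x n) < m + 1 / Suc n"
    by metis
  obtain r where r: "strict_mono (r :: nat \<Rightarrow> nat)"
    "\<forall>e>0. \<exists>N. \<forall>i\<ge>N. \<forall>j\<ge>N. \<bar>B (x (r i) - x (r j)) (x (r i) - x (r j))\<bar> < e"
    using compact[of x 1] x(2) by auto
  have Fx: "F (x (r n)) (x (r n)) < 1 / Suc n" for n
  proof -
    have "1 / Suc (r n) \<le> 1 / Suc n" using seq_suble[OF r(1), of n] by (simp add: field_simps)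
    then show ?thesis using x(3)[of "r n"] x(2)[of "r n"] unfolding F_def by simp
  qed
  have "\<exists>l. (\<lambda>n. G (x (r n) - l) (x (r n) - l)) \<longlonglongrightarrow> 0"
  proof (rule complete)
    fix e :: real assume "0 < e"
    then have e': "0 < e * (- t)" using t by (simp add: mult_pos_neg)
    obtain N1 where N1: "1 / Suc N1 < e * (- t) / 8" using nat_approx_posE[of "e * (- t) / 8"] e' by auto
    obtain N2 where N2: "\<forall>i\<ge>N2. \<forall>j\<ge>N2. \<bar>B (x (r i) - x (r j)) (x (r i) - x (r j))\<bar> < e * (- t) / 2"
      using r(2)[rule_format, of "e * (- t) / 2"] e' by auto
    have "G (x (r i) - x (r j)) (x (r i) - x (r j)) < e" if "max N1 N2 \<le> i" "max N1 N2 \<le> j" for i j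
    proof -
      let ?d = "x (r i) - x (r j)"
      have "1 / Suc i \<le> 1 / Suc N1" "1 / Suc j \<le> 1 / Suc N1" using that by (auto simp: field_simps)
      then have "F (x (r i)) (x (r i)) < e * (- t) / 8" "F (x (r j)) (x (r j)) < e * (- t) / 8"
        using Fx[of i] Fx[of j] N1 by linarith+
      moreover have "F ?d ?d \<le> 2 * F (x (r i)) (x (r i)) + 2 * F (x (r j)) (x (r j))"
        using Fpos x(1) subX by (intro F.diff_le_parallelogram) (simp add: subspace_add)
      ultimately have "F ?d ?d < e * (- t) / 2" by linarith
      moreover have "\<bar>B ?d ?d\<bar> < e * (- t) / 2" using N2 that by simp
      ultimately have "(- m) * G ?d ?d < e * (- t)" unfolding F_def by linarith
      moreover have "(- t) * G ?d ?d \<le> (- m) * G ?d ?d" using mt nonneg by (intro mult_right_mono) auto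
      ultimately have "(- t) * G ?d ?d < (- t) * e" by (simp add: mult.commute)
      then show ?thesis using t by simp
    qed
    then show "\<exists>N. \<forall>i\<ge>N. \<forall>j\<ge>N. G (x (r i) - x (r j)) (x (r i) - x (r j)) < e" by blast
  qed
  then obtain l where l: "(\<lambda>n. G (x (r n) - l) (x (r n) - l)) \<longlonglongrightarrow> 0" by blast
  have lX: "l \<in> X" unfolding X_def
  proof (intro CollectI ballI)
    fix e assume "e \<in> low t"
    then have "(\<lambda>n. G e (x (r n))) = (\<lambda>n. 0)" using x(1) by (auto simp: X_def)
    then show "G e l = 0" using tendsto_right[OF l, of e] LIMSEQ_const_iff by metis
  qed
  have "l \<noteq> 0"
  proof
    assume "l = 0"
    then have "(\<lambda>n::nat. 1::real) \<longlonglongrightarrow> 0" using l x(2) by simp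
    then show False by (simp add: LIMSEQ_const_iff)
  qed
  \<comment> \<open>With \<open>l = y - (y - l)\<close> and \<open>y = x (r n)\<close>, the
    parallelogram bound leaves \<open>F y y\<close>, which is below \<open>1 / Suc n\<close>, and
    \<open>F (y - l) (y - l)\<close>, which is at most \<open>C - m\<close> times a null
    sequence.\<close>
  have "F l l \<le> 0"
  proof (rule LIMSEQ_le_const)
    have "(\<lambda>n. 1 / real (Suc n)) \<longlonglongrightarrow> 0" by (rule LIMSEQ_Suc[OF lim_1_over_n])
    then have "(\<lambda>n. 2 * (1 / real (Suc n)) + 2 * ((C - m) * G (x (r n) - l) (x (r n) - l))) \<longlonglongrightarrow> 2 * 0 + 2 * ((C - m) * 0)"
      by (intro tendsto_intros l)
    then show "(\<lambda>n. 2 * (1 / real (Suc n)) + 2 * ((C - m) * G (x (r n) - l) (x (r n) - l))) \<longlonglongrightarrow> 0"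
      by simp
    have "F l l \<le> 2 * (1 / real (Suc n)) + 2 * ((C - m) * G (x (r n) - l) (x (r n) - l))" for n
    proof -
      let ?y = "x (r n)"
      have "F (?y - (?y - l)) (?y - (?y - l)) \<le> 2 * F ?y ?y + 2 * F (?y - l) (?y - l)"
        using Fpos x(1) subX lX by (intro F.diff_le_parallelogram) (simp add: subspace_add subspace_diff)
      moreover have "F (?y - l) (?y - l) \<le> (C - m) * G (?y - l) (?y - l)"
        using bound[of "?y - l"] unfolding F_def by (simp add: algebra_simps)
      ultimately show ?thesis using Fx[of n] by simp
    qed
    then show "\<exists>N. \<forall>n\<ge>N. F l l \<le> 2 * (1 / real (Suc n)) + 2 * ((C - m) * G (x (r n) - l) (x (r n) - l))" by blast
  qed
  then have Fl: "F l l = 0" using Fpos[OF lX] by simp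
  \<comment> \<open>Cauchy-Schwarz for the semidefinite form: \<open>F l l = 0\<close> makes
    \<open>F l\<close> vanish on the whole complement.\<close>
  have FlX: "F l y = 0" if "y \<in> X" for y
    using F.Cauchy_Schwarz[OF subX Fpos lX that] Fl by simp
  \<comment> \<open>On an eigenvector in \<open>low t\<close> the functional \<open>G l\<close>
    vanishes by orthogonality, and then so does \<open>B l\<close> by the eigenvalue equation. With
    \<open>FlX\<close> and the decomposition of an arbitrary vector this makes \<open>l\<close> an
    eigenvector for \<open>m\<close>.\<close>
  have Fle: "F l e = 0" if el: "e \<in> low t" for e
  proof -
    have Ge: "G l v = 0" if "v \<in> low t" for v using lX that sym by (auto simp: X_def)
    obtain M f where M: "finite M" "M \<subseteq> {..t}" "\<forall>\<mu>\<in>M. f \<mu> \<in> eig \<mu>" "e = (\<Sum>\<mu>\<in>M. f \<mu>)"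
      using low_decompose[OF el] by blast
    have "F l (f \<mu>) = 0" if "\<mu> \<in> M" for \<mu>
    proof -
      have "f \<mu> \<in> low t" using that M unfolding low_def by (intro span_base) auto
      then show ?thesis
        using eigD[of "f \<mu>" \<mu> l] M(3) that Ge[of "f \<mu>"] sym[of l "f \<mu>"] B.sym[of l "f \<mu>"]
        by (simp add: F_def)
    qed
    then show ?thesis unfolding M(4) F.sum_right by simp
  qed
  have "F l \<psi> = 0" for \<psi>
  proof -
    obtain e where e: "e \<in> low t" "\<forall>v\<in>low t. G v (\<psi> - e) = 0" using low_complement[OF t] by blast
    then have "F l (\<psi> - e) = 0" by (intro FlX) (simp add: X_def)
    then show ?thesis using Fle[OF e(1)] by (simp add: F.diff_right)
  qed
  then have "l \<in> eig m" by (simp add: eig_def F_def)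
  then have "l \<in> low t" unfolding low_def using mt by (intro span_base) auto
  then have "G l l = 0" using lX by (auto simp: X_def)
  then show False using \<open>l \<noteq> 0\<close> eq_0_iff by blast
qed

text \<open>More than \<open>dim (low t)\<close> independent vectors span a nonzero vector
  orthogonal to \<open>low t\<close>, where \<open>B\<close> strictly exceeds \<open>t * G\<close>.
  This half of the min-max principle is what compares eigenvalue counts for different
  \<open>G\<close>.\<close>

lemma card_le_dim_low:
  assumes t: "t < 0" and S: "subspace S" and T: "finite T" "independent T" "T \<subseteq> S"
    and le: "\<And>u. u \<in> S \<Longrightarrow> B u u \<le> t * G u u"
  shows "card T \<le> dim (low t)"
proof (rule ccontr)
  assume "\<not> ?thesis"
  moreover obtain E where E: "finite E" "independent E" "E \<subseteq> low t" "low t = span E" "card E = dim (low t)"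
    using low_basis[OF t] by metis
  ultimately obtain s where s: "s \<in> span T" "s \<noteq> 0" "\<forall>v\<in>E. G v s = 0"
    using nontrivial_common_zero[of E T G] T linear_right by auto
  have "G v s = 0" if "v \<in> low t" for v
    using linear_eq_0_on_span[OF linear_left, of E s v] s(3) that E(4) by auto
  then have "t * G s s < B s s" using form_gt_on_complement[OF t s(2)] by blast
  moreover have "s \<in> S" using s(1) span_minimal[OF T(3) S] by blast
  ultimately show False using le by fastforce
qed

lemma independent_Union_eig:
  assumes "finite M" and Bs: "\<And>\<mu>. \<mu> \<in> M \<Longrightarrow> finite (Bs \<mu>) \<and> independent (Bs \<mu>) \<and> Bs \<mu> \<subseteq> eig \<mu>"
  shows "independent (\<Union>\<mu>\<in>M. Bs \<mu>)" "card (\<Union>\<mu>\<in>M. Bs \<mu>) = (\<Sum>\<mu>\<in>M. card (Bs \<mu>))"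
proof -
  have disj: "Bs \<mu> \<inter> Bs \<nu> = {}" if "\<mu> \<in> M" "\<nu> \<in> M" "\<mu> \<noteq> \<nu>" for \<mu> \<nu>
  proof (rule ccontr)
    assume "\<not> ?thesis"
    then obtain v where v: "v \<in> Bs \<mu>" "v \<in> Bs \<nu>" by blast
    then have "G v v = 0" using eig_orthogonal[of v \<mu> v \<nu>] Bs that by blast
    then have "v = 0" using eq_0_iff by blast
    then show False using Bs[OF that(1)] v(1) dependent_zero by blast
  qed
  show "card (\<Union>\<mu>\<in>M. Bs \<mu>) = (\<Sum>\<mu>\<in>M. card (Bs \<mu>))"
    using assms disj by (intro card_UN_disjoint) auto
  show "independent (\<Union>\<mu>\<in>M. Bs \<mu>)"
  proof (rule independent_if_scalars_zero)
    show "finite (\<Union>\<mu>\<in>M. Bs \<mu>)" using assms by auto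
    fix c v
    assume z: "(\<Sum>x\<in>(\<Union>\<mu>\<in>M. Bs \<mu>). c x *\<^sub>R x) = 0" and v: "v \<in> (\<Union>\<mu>\<in>M. Bs \<mu>)"
    define y where "y \<mu> = (\<Sum>x\<in>Bs \<mu>. c x *\<^sub>R x)" for \<mu>
    have "(\<Sum>\<mu>\<in>M. y \<mu>) = 0"
      unfolding y_def using z assms disj by (subst (asm) sum.UNION_disjoint) auto
    obtain \<nu> where \<nu>: "\<nu> \<in> M" "v \<in> Bs \<nu>" using v by blast
    have yeig: "y \<mu> \<in> eig \<mu>" if "\<mu> \<in> M" for \<mu>
      unfolding y_def using Bs[OF that] subspace_eig by (intro subspace_sum subspace_scale) auto
    have "0 = G (y \<nu>) (\<Sum>\<mu>\<in>M. y \<mu>)" using \<open>(\<Sum>\<mu>\<in>M. y \<mu>) = 0\<close> by simp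
    also have "\<dots> = (\<Sum>\<mu>\<in>M. if \<mu> = \<nu> then G (y \<nu>) (y \<nu>) else 0)"
      unfolding sum_right using \<nu>(1) by (intro sum.cong) (auto intro: eig_orthogonal yeig)
    also have "\<dots> = G (y \<nu>) (y \<nu>)" using \<nu>(1) assms(1) by simp
    finally have "y \<nu> = 0" using eq_0_iff by metis
    then show "c v = 0" using Bs[OF \<nu>(1)] \<nu>(2) unfolding y_def by (metis independentD subset_refl)
  qed
qed

section \<open>Multiplicities and the dimension of the low spectral subspace\<close>

lemma eig_subset_low: "\<mu> \<le> t \<Longrightarrow> eig \<mu> \<subseteq> low t"
  unfolding low_def by (auto intro!: span_base)

lemma eig_basis:
  assumes "\<mu> < 0"
  obtains T where "finite T" "independent T" "T \<subseteq> eig \<mu>" "eig \<mu> = span T" "card T = dim (eig \<mu>)"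
proof -
  obtain T where T: "T \<subseteq> eig \<mu>" "independent T" "eig \<mu> \<subseteq> span T" "card T = dim (eig \<mu>)"
    using basis_exists by blast
  moreover have "span T \<subseteq> eig \<mu>" using T(1) subspace_eig by (simp add: span_minimal)
  moreover have "finite T"
    using independent_finite[OF subspace_eig assms _ T(1,2)] by (simp add: eigD)
  ultimately show ?thesis using that by blast
qed

text \<open>One eigenvector chosen per eigenvalue gives an independent set in \<open>low t\<close>,
  whose size is bounded.\<close>

lemma finite_eigenvalues_le:
  assumes "t < 0"
  shows "finite {\<mu>. \<mu> \<le> t \<and> eig \<mu> \<noteq> {0}}"
proof -
  obtain N where N: "\<And>T. T \<subseteq> low t \<Longrightarrow> finite T \<Longrightarrow> independent T \<Longrightarrow> card T \<le> N"
    using independent_card_bounded[of "low t", OF _ assms low_form_le] by (auto simp: low_def)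
  have "\<exists>v. v \<in> eig \<mu> \<and> v \<noteq> 0" if "eig \<mu> \<noteq> {0}" for \<mu>
    using that subspace_0[OF subspace_eig] by blast
  then obtain v where v: "\<And>\<mu>. eig \<mu> \<noteq> {0} \<Longrightarrow> v \<mu> \<in> eig \<mu> \<and> v \<mu> \<noteq> 0" by metis
  have "card M \<le> N" if M: "M \<subseteq> {\<mu>. \<mu> \<le> t \<and> eig \<mu> \<noteq> {0}}" "finite M" for M
  proof -
    have *: "finite {v \<mu>} \<and> independent {v \<mu>} \<and> {v \<mu>} \<subseteq> eig \<mu>" if "\<mu> \<in> M" for \<mu>
      using v[of \<mu>] subsetD[OF M(1) that] by auto
    have "card (\<Union>\<mu>\<in>M. {v \<mu>}) \<le> N"
    proof (rule N)
      show "(\<Union>\<mu>\<in>M. {v \<mu>}) \<subseteq> low t" using * M eig_subset_low by blast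
      show "independent (\<Union>\<mu>\<in>M. {v \<mu>})" using independent_Union_eig(1)[OF M(2) *] .
    qed (use M in auto)
    then show ?thesis using independent_Union_eig(2)[OF M(2) *] by simp
  qed
  then show ?thesis using finite_if_finite_subsets_card_bdd by blast
qed

text \<open>Bases of the eigenspaces unite to a basis of \<open>low t\<close>. The right-hand side
  has the shape in which \<open>neg_count\<close> is defined.\<close>

lemma dim_low:
  assumes "t < 0"
  shows "dim (low t) = (\<Sum>\<mu>\<in>{\<mu>. \<mu> \<le> t \<and> eig \<mu> \<noteq> {0}}. dim (eig \<mu>))"
proof -
  let ?M = "{\<mu>. \<mu> \<le> t \<and> eig \<mu> \<noteq> {0}}"
  have "\<exists>T. finite T \<and> independent T \<and> T \<subseteq> eig \<mu> \<and> eig \<mu> = span T \<and> card T = dim (eig \<mu>)" if "\<mu> \<le> t" for \<mu>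
    using eig_basis[of \<mu>] that assms by (metis le_less_trans)
  then obtain Bs where Bs: "\<And>\<mu>. \<mu> \<le> t \<Longrightarrow> finite (Bs \<mu>) \<and> independent (Bs \<mu>) \<and> Bs \<mu> \<subseteq> eig \<mu>
      \<and> eig \<mu> = span (Bs \<mu>) \<and> card (Bs \<mu>) = dim (eig \<mu>)" by metis
  let ?U = "\<Union>\<mu>\<in>?M. Bs \<mu>"
  have ind: "independent ?U" and card: "card ?U = (\<Sum>\<mu>\<in>?M. card (Bs \<mu>))"
    using independent_Union_eig[OF finite_eigenvalues_le[OF assms], of Bs] Bs by auto
  have "low t \<subseteq> span ?U" unfolding low_def
  proof (intro span_minimal subspace_span UN_least)
    fix \<mu> assume "\<mu> \<in> {..t}"
    then show "eig \<mu> \<subseteq> span ?U"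
    proof (cases "eig \<mu> = {0}")
      case False
      then have "span (Bs \<mu>) \<subseteq> span ?U" using \<open>\<mu> \<in> {..t}\<close> by (intro span_mono) auto
      then show ?thesis using Bs \<open>\<mu> \<in> {..t}\<close> by auto
    qed (auto simp: span_zero)
  qed
  moreover have "?U \<subseteq> low t" using Bs eig_subset_low by blast
  ultimately have "card ?U = dim (low t)" using ind by (intro basis_card_eq_dim) auto
  then show ?thesis using card Bs by simp
qed

end

section \<open>Test functions and the du Bois-Reymond lemma\<close>

text \<open>\<open>n\<close>-fold differentiability, without continuity of the last derivative;
  demanded for all \<open>n\<close> it is smoothness. Recursion through \<open>deriv\<close> allows
  closure under products and affine substitution to be shown by induction.\<close>

fun Ck :: "nat \<Rightarrow> (real \<Rightarrow> real) \<Rightarrow> bool" where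
  "Ck 0 f = True"
| "Ck (Suc n) f = ((\<forall>x. f differentiable (at x)) \<and> Ck n (deriv f))"

lemma Ck_iff: "Ck n f \<longleftrightarrow> (\<forall>k<n. \<forall>x. ((deriv ^^ k) f) differentiable (at x))"
proof (induction n arbitrary: f)
  case (Suc n)
  have "(\<forall>k<Suc n. \<forall>x. ((deriv ^^ k) f) differentiable (at x)) \<longleftrightarrow>
      (\<forall>x. f differentiable (at x)) \<and> (\<forall>k<n. \<forall>x. ((deriv ^^ Suc k) f) differentiable (at x))"
    by (auto simp: less_Suc_eq_0_disj simp del: funpow.simps)
  then show ?case using Suc by (simp add: funpow_swap1 del: funpow.simps add: funpow_Suc_right)
qed simp

definition smooth :: "(real \<Rightarrow> real) \<Rightarrow> bool" where
  "smooth f \<longleftrightarrow> (\<forall>n. Ck n f)"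

lemma smooth_iff: "smooth f \<longleftrightarrow> (\<forall>k x. ((deriv ^^ k) f) differentiable (at x))"
  unfolding smooth_def Ck_iff by blast

lemma smooth_deriv_iff: "smooth f \<longleftrightarrow> (\<forall>x. f differentiable (at x)) \<and> smooth (deriv f)"
  unfolding smooth_def by (metis Ck.simps(2) Ck.simps(1) not0_implies_Suc)

lemma smooth_has_deriv: "smooth f \<Longrightarrow> (f has_real_derivative deriv f x) (at x)"
  using smooth_deriv_iff DERIV_deriv_iff_real_differentiable by blast

lemma Ck_mono: "Ck (Suc n) f \<Longrightarrow> Ck n f"
  by (simp add: Ck_iff)

lemma Ck_add: "Ck n f \<Longrightarrow> Ck n g \<Longrightarrow> Ck n (\<lambda>x. f x + g x)"
proof (induction n arbitrary: f g)
  case (Suc n)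
  have "deriv (\<lambda>x. f x + g x) = (\<lambda>x. deriv f x + deriv g x)"
    using Suc.prems by (auto intro!: ext DERIV_imp_deriv derivative_eq_intros simp: DERIV_deriv_iff_real_differentiable)
  then show ?case using Suc by auto
qed simp

lemma Ck_mult: "Ck n f \<Longrightarrow> Ck n g \<Longrightarrow> Ck n (\<lambda>x. f x * g x)"
proof (induction n arbitrary: f g)
  case (Suc n)
  have *: "deriv (\<lambda>x. f x * g x) = (\<lambda>x. deriv f x * g x + f x * deriv g x)"
  proof
    fix x
    have d: "(f has_real_derivative deriv f x) (at x)" "(g has_real_derivative deriv g x) (at x)"
      using Suc.prems by (auto simp: DERIV_deriv_iff_real_differentiable)
    show "deriv (\<lambda>x. f x * g x) x = deriv f x * g x + f x * deriv g x"
      using DERIV_imp_deriv[OF DERIV_mult[OF d]] by (simp add: mult.commute)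
  qed
  have "Ck n f" "Ck n g" using Suc.prems Ck_mono by auto
  then have "Ck n (\<lambda>x. deriv f x * g x + f x * deriv g x)"
    using Suc by (intro Ck_add Suc.IH) auto
  then show ?case using Suc.prems * by auto
qed simp

lemma Ck_const: "Ck n (\<lambda>x. c)"
proof (induction n arbitrary: c)
  case (Suc n)
  have "deriv (\<lambda>x. c) = (\<lambda>x. 0)" by (auto intro!: ext DERIV_imp_deriv derivative_eq_intros)
  then show ?case using Suc by simp
qed simp

lemma smooth_add: "smooth f \<Longrightarrow> smooth g \<Longrightarrow> smooth (\<lambda>x. f x + g x)"
  unfolding smooth_def using Ck_add by blast

lemma smooth_mult: "smooth f \<Longrightarrow> smooth g \<Longrightarrow> smooth (\<lambda>x. f x * g x)"
  unfolding smooth_def using Ck_mult by blast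

lemma smooth_const: "smooth (\<lambda>x. c)"
  unfolding smooth_def using Ck_const by blast

lemma smooth_diff: "smooth f \<Longrightarrow> smooth g \<Longrightarrow> smooth (\<lambda>x. f x - c * g x)"
  using smooth_add[OF _ smooth_mult[OF smooth_const[of "-c"]], of f g] by (simp add: algebra_simps)

lemma Ck_affine: "Ck n f \<Longrightarrow> Ck n (\<lambda>x. f (a * x + b))"
proof (induction n arbitrary: f)
  case (Suc n)
  have der: "((\<lambda>x. f (a * x + b)) has_real_derivative a * deriv f (a * x + b)) (at x)" for x
  proof -
    have "(f has_real_derivative deriv f (a * x + b)) (at (a * x + b))"
      using Suc.prems by (simp add: DERIV_deriv_iff_real_differentiable)
    moreover have "((\<lambda>x. a * x + b) has_real_derivative a) (at x)" by (auto intro!: derivative_eq_intros)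
    ultimately have "((\<lambda>x. f (a * x + b)) has_real_derivative deriv f (a * x + b) * a) (at x)"
      by (rule DERIV_chain2)
    then show ?thesis by (simp only: mult.commute[of a])
  qed
  then have "deriv (\<lambda>x. f (a * x + b)) = (\<lambda>x. a * deriv f (a * x + b))"
    by (intro ext DERIV_imp_deriv)
  then show ?case using Suc Ck_mult[OF Ck_const[of n a], of "\<lambda>x. deriv f (a * x + b)"] der
    by (auto simp: real_differentiable_def)
qed simp

lemma smooth_affine: "smooth f \<Longrightarrow> smooth (\<lambda>x. f (a * x + b))"
  unfolding smooth_def using Ck_affine by blast

text \<open>The family p(1/x) exp(-1/x) is closed under differentiation: \<open>p\<close> is
  replaced by the square of the variable times \<open>p - pderiv p\<close>. Smoothness across 0 then
  follows by induction with \<open>p\<close> arbitrary.\<close>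

definition flat :: "real poly \<Rightarrow> real \<Rightarrow> real" where
  "flat p x = (if 0 < x then poly p (1 / x) * exp (- (1 / x)) else 0)"

lemma poly_exp_decay: "((\<lambda>y::real. poly p y * exp (- y)) \<longlongrightarrow> 0) at_top"
proof -
  have "((\<lambda>y::real. \<Sum>i\<le>degree p. coeff p i * (y ^ i / exp y)) \<longlongrightarrow> (\<Sum>i\<le>degree p. coeff p i * 0)) at_top"
    by (intro tendsto_sum tendsto_mult tendsto_const tendsto_power_div_exp_0)
  then show ?thesis by (simp add: poly_altdef exp_minus sum_distrib_right divide_inverse mult.assoc)
qed

lemma flat_has_derivative:
  "(flat p has_real_derivative flat ([:0, 0, 1:] * (p - pderiv p)) x) (at x)"
proof -
  consider "x < 0" | "x > 0" | "x = 0" by linarith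
  then show ?thesis
  proof cases
    case 1
    have "((\<lambda>x. 0) has_real_derivative 0) (at x)" by simp
    moreover have "eventually (\<lambda>y. flat p y = 0) (nhds x)"
      using eventually_nhds_in_open[of "{..<0}" x] 1 by (auto elim!: eventually_mono simp: flat_def)
    ultimately have "(flat p has_real_derivative 0) (at x)"
      by (subst DERIV_cong_ev[OF refl _ refl]) auto
    then show ?thesis using 1 by (simp add: flat_def)
  next
    case 2
    have "((\<lambda>x. poly p (1 / x) * exp (- (1 / x))) has_real_derivative
        poly (pderiv p) (1 / x) * (- (1 / x\<^sup>2)) * exp (- (1 / x)) + poly p (1 / x) * (exp (- (1 / x)) * (1 / x\<^sup>2))) (at x)"
      using 2 by (auto intro!: derivative_eq_intros DERIV_chain2[OF poly_DERIV] simp: power2_eq_square)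
    moreover have "eventually (\<lambda>y. flat p y = poly p (1 / y) * exp (- (1 / y))) (nhds x)"
      using eventually_nhds_in_open[of "{0<..}" x] 2 by (auto elim!: eventually_mono simp: flat_def)
    ultimately have "(flat p has_real_derivative
        poly (pderiv p) (1 / x) * (- (1 / x\<^sup>2)) * exp (- (1 / x)) + poly p (1 / x) * (exp (- (1 / x)) * (1 / x\<^sup>2))) (at x)"
      by (subst DERIV_cong_ev[OF refl _ refl]) auto
    then show ?thesis using 2 by (simp add: flat_def power2_eq_square algebra_simps)
  next
    case 3
    have "((\<lambda>h. (flat p h - flat p 0) / h) \<longlongrightarrow> 0) (at 0)"
    proof (rule filterlim_split_at_real)
      show "((\<lambda>h. (flat p h - flat p 0) / h) \<longlongrightarrow> 0) (at_left 0)"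
      proof (rule tendsto_eventually)
        show "\<forall>\<^sub>F h in at_left 0. (flat p h - flat p 0) / h = 0"
          using eventually_at_left_real[of "-1" "0::real", OF neg_less_0_iff_less[THEN iffD2, OF zero_less_one]]
          by eventually_elim (auto simp: flat_def)
      qed
      \<comment> \<open>With y = 1/h the difference quotient at 0 is y p(y) exp(-y), again a
        polynomial against a decaying exponential.\<close>
      have "((\<lambda>h. poly ([:0, 1:] * p) (inverse h) * exp (- inverse h)) \<longlongrightarrow> 0) (at_right 0)"
        by (rule filterlim_compose[OF poly_exp_decay filterlim_inverse_at_top_right])
      then show "((\<lambda>h. (flat p h - flat p 0) / h) \<longlongrightarrow> 0) (at_right (0::real))"
      proof (rule Lim_transform_eventually)
        show "\<forall>\<^sub>F h in at_right (0::real). poly ([:0, 1:] * p) (inverse h) * exp (- inverse h) = (flat p h - flat p 0) / h"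
          using eventually_at_right_real[OF zero_less_one] by eventually_elim (auto simp: flat_def field_simps)
      qed
    qed
    then show ?thesis using 3 by (simp add: has_field_derivative_iff flat_def)
  qed
qed

lemma smooth_flat: "smooth (flat p)"
proof -
  have "Ck n (flat p)" for n
  proof (induction n arbitrary: p)
    case (Suc n)
    have "deriv (flat p) = flat ([:0, 0, 1:] * (p - pderiv p))"
      by (intro ext DERIV_imp_deriv flat_has_derivative)
    then show ?case using Suc flat_has_derivative real_differentiable_def by auto
  qed simp
  then show ?thesis by (simp add: smooth_def)
qed

text \<open>A smooth function supported in [a, b]; the factor \<open>Suc n\<close> steepens both
  flanks, so that the pointwise limit is the indicator of the open interval.\<close>

definition bump :: "real \<Rightarrow> real \<Rightarrow> nat \<Rightarrow> real \<Rightarrow> real" where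
  "bump a b n x = flat 1 (real (Suc n) * (x - a)) * flat 1 (real (Suc n) * (b - x))"

lemma smooth_test_fun:
  "test_fun \<phi> \<longleftrightarrow> smooth \<phi> \<and> (\<exists>R. \<forall>x. R < \<bar>x\<bar> \<longrightarrow> \<phi> x = 0)"
  by (simp add: test_fun_def smooth_iff)

lemma bump_zero: "x \<le> a \<or> b \<le> x \<Longrightarrow> bump a b n x = 0"
  by (auto simp: bump_def flat_def zero_less_mult_iff)

lemma test_fun_bump: "test_fun (bump a b n)"
proof -
  have "smooth (\<lambda>x. flat 1 (real (Suc n) * x + (- real (Suc n) * a)) * flat 1 ((- real (Suc n)) * x + real (Suc n) * b))"
    by (intro smooth_mult smooth_affine smooth_flat)
  also have "(\<lambda>x. flat 1 (real (Suc n) * x + (- real (Suc n) * a)) * flat 1 ((- real (Suc n)) * x + real (Suc n) * b)) = bump a b n"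
    by (rule ext) (simp add: bump_def algebra_simps)
  finally have "smooth (bump a b n)" .
  moreover have "\<forall>x. max \<bar>a\<bar> \<bar>b\<bar> < \<bar>x\<bar> \<longrightarrow> bump a b n x = 0"
    by (auto simp: abs_if intro!: bump_zero split: if_splits)
  ultimately show ?thesis unfolding smooth_test_fun by blast
qed

lemma bump_bounds: "0 \<le> bump a b n x" "bump a b n x \<le> 1"
proof -
  have "0 \<le> flat 1 y \<and> flat 1 y \<le> 1" for y by (auto simp: flat_def)
  then show "0 \<le> bump a b n x" "bump a b n x \<le> 1" unfolding bump_def by (auto intro: mult_le_one)
qed

lemma bump_tendsto: "(\<lambda>n. bump a b n x) \<longlonglongrightarrow> indicator {a<..<b} x"
proof (cases "a < x \<and> x < b")
  case True
  have *: "(\<lambda>n. flat 1 (real (Suc n) * c)) \<longlonglongrightarrow> 1" if "c > 0" for c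
  proof -
    have "(\<lambda>n. exp (- ((1 / c) * (1 / real (Suc n))))) \<longlonglongrightarrow> exp (- ((1 / c) * 0))"
      by (intro tendsto_intros LIMSEQ_Suc[OF lim_1_over_n])
    then show ?thesis using that by (simp add: flat_def mult.commute)
  qed
  have "(\<lambda>n. bump a b n x) \<longlonglongrightarrow> 1 * 1" unfolding bump_def
    using True by (intro tendsto_mult *) auto
  then show ?thesis using True by simp
next
  case False
  then have "bump a b n x = 0" for n by (intro bump_zero) auto
  then show ?thesis using False by auto
qed

lemma test_fun_continuous: "test_fun \<phi> \<Longrightarrow> continuous_on A \<phi>"
  unfolding smooth_test_fun using smooth_has_deriv
  by (meson DERIV_continuous continuous_at_imp_continuous_on)

lemma test_fun_deriv: "test_fun \<phi> \<Longrightarrow> test_fun (deriv \<phi>)"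
proof -
  assume "test_fun \<phi>"
  then obtain R where R: "smooth \<phi>" "\<And>x. R < \<bar>x\<bar> \<Longrightarrow> \<phi> x = 0" unfolding smooth_test_fun by blast
  have "deriv \<phi> x = 0" if "R < \<bar>x\<bar>" for x
  proof -
    have "((\<lambda>x. 0) has_real_derivative 0) (at x)" by simp
    moreover have "open {x. R < \<bar>x\<bar>}" by (intro open_Collect_less continuous_intros)
    then have "eventually (\<lambda>y. \<phi> y = 0) (nhds x)"
      using eventually_nhds_in_open[of "{x. R < \<bar>x\<bar>}" x] R(2) that by (auto elim!: eventually_mono)
    ultimately have "(\<phi> has_real_derivative 0) (at x)"
      by (subst DERIV_cong_ev[OF refl _ refl]) auto
    then show ?thesis by (rule DERIV_imp_deriv)
  qed
  then show ?thesis using R(1) smooth_deriv_iff unfolding smooth_test_fun by blast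
qed

lemma test_fun_support:
  assumes "test_fun \<phi>"
  obtains R where "0 < R" "\<And>x. x \<notin> {-R..R} \<Longrightarrow> \<phi> x = 0" "\<And>x. x \<notin> {-R<..<R} \<Longrightarrow> \<phi> x = 0 \<and> deriv \<phi> x = 0"
proof -
  obtain R1 where R1: "\<And>x. R1 < \<bar>x\<bar> \<Longrightarrow> \<phi> x = 0" using assms unfolding smooth_test_fun by blast
  obtain R2 where R2: "\<And>x. R2 < \<bar>x\<bar> \<Longrightarrow> deriv \<phi> x = 0"
    using test_fun_deriv[OF assms] unfolding smooth_test_fun by blast
  \<comment> \<open>The added 1 makes \<open>R\<close> positive and lets the function and its
    derivative vanish at the endpoints as well, so that boundary terms drop out.\<close>
  define R where "R = max 0 (max R1 R2) + 1"
  show ?thesis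
    by (rule that[of R]) (auto simp: R_def abs_if intro!: R1 R2)
qed

lemma test_fun_bounded:
  assumes "test_fun \<phi>"
  obtains C where "\<And>x. \<bar>\<phi> x\<bar> \<le> C"
proof -
  obtain R where R: "0 < R" "\<And>x. x \<notin> {-R..R} \<Longrightarrow> \<phi> x = 0" using test_fun_support[OF assms] by metis
  have "compact (\<phi> ` {-R..R})"
    by (intro compact_continuous_image test_fun_continuous assms compact_Icc)
  then have "bounded (\<phi> ` {-R..R})" by (rule compact_imp_bounded)
  then obtain C where "\<forall>x\<in>{-R..R}. \<bar>\<phi> x\<bar> \<le> C" by (auto simp: bounded_iff)
  then have C: "\<And>x. x \<in> {-R..R} \<Longrightarrow> \<bar>\<phi> x\<bar> \<le> C" by blast
  show ?thesis
  proof (rule that[of "max C 0"])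
    fix x show "\<bar>\<phi> x\<bar> \<le> max C 0" using C[of x] R(2)[of x] by (cases "x \<in> {-R..R}") auto
  qed
qed

section \<open>Locally integrable functions tested against smooth functions\<close>

lemma test_fun_measurable: "test_fun \<phi> \<Longrightarrow> \<phi> \<in> borel_measurable borel"
  by (intro borel_measurable_continuous_onI test_fun_continuous)

lemma mult_test_fun_integrable:
  fixes f :: "real \<Rightarrow> real"
  assumes f: "\<And>a b. set_integrable lborel {a..b} f" and \<phi>: "test_fun \<phi>"
    and m: "f \<in> borel_measurable borel"
  shows "integrable lborel (\<lambda>x. f x * \<phi> x)"
proof -
  obtain R where R: "0 < R" "\<And>x. x \<notin> {-R..R} \<Longrightarrow> \<phi> x = 0" using test_fun_support[OF \<phi>] by metis
  obtain C where C: "\<And>x. \<bar>\<phi> x\<bar> \<le> C" using test_fun_bounded[OF \<phi>] by blast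
  show ?thesis
  proof (rule Bochner_Integration.integrable_bound)
    show "integrable lborel (\<lambda>x. C * (indicator {-R..R} x *\<^sub>R \<bar>f x\<bar>))"
      using set_integrable_abs[OF f[of "-R" R]] unfolding set_integrable_def by simp
    show "(\<lambda>x. f x * \<phi> x) \<in> borel_measurable lborel"
      using m test_fun_measurable[OF \<phi>] by simp
    have "\<bar>f x * \<phi> x\<bar> \<le> \<bar>C * (indicator {-R..R} x *\<^sub>R \<bar>f x\<bar>)\<bar>" for x
    proof (cases "x \<in> {-R..R}")
      case True
      have "\<bar>\<phi> x\<bar> * \<bar>f x\<bar> \<le> \<bar>C\<bar> * \<bar>f x\<bar>" using C[of x] by (intro mult_right_mono) auto
      then show ?thesis using True by (simp add: abs_mult mult.commute)
    qed (use R in auto)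
    then show "AE x in lborel. norm (f x * \<phi> x) \<le> norm (C * (indicator {-R..R} x *\<^sub>R \<bar>f x\<bar>))" by simp
  qed
qed

text \<open>Cut off to (-N, N), the function is integrable, and its positive and negative parts are
  densities of finite measures that agree on all half-lines. The measures are equal, and densities
  are unique almost everywhere.\<close>

lemma AE_zero_if_interval_integrals_zero:
  fixes f :: "real \<Rightarrow> real"
  assumes f: "\<And>a b. set_integrable lborel {a..b} f" and m: "f \<in> borel_measurable borel"
    and z: "\<And>a b. a < b \<Longrightarrow> (LBINT x:{a<..<b}. f x) = 0"
  shows "AE x in lborel. f x = 0"
proof -
  have *: "AE x in lborel. x \<in> {- real N<..<real N} \<longrightarrow> f x = 0" for N :: nat
  proof -
    define g where "g x = indicator {- real N<..<real N} x *\<^sub>R f x" for x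
    have fo: "set_integrable lborel {a<..<b} f" for a b
      by (rule set_integrable_subset[OF f[of a b]]) auto
    have gi: "integrable lborel g" using fo unfolding g_def set_integrable_def by simp
    have gx: "integrable lborel (\<lambda>y. indicator {x<..} y * g y)" for x
      using integrable_mult_indicator[OF _ gi, of "{x<..}"] by simp
    have "(LBINT y. indicator {x<..} y * g y) = 0" for x
    proof -
      have "(LBINT y. indicator {x<..} y * g y) = (LBINT y:{max x (- real N)<..<real N}. f y)"
        unfolding set_lebesgue_integral_def g_def
        by (intro Bochner_Integration.integral_cong) (auto simp: indicator_def)
      also have "\<dots> = 0" using z[of "max x (- real N)" "real N"]
        by (cases "max x (- real N) < real N") (auto simp: set_lebesgue_integral_def)
      finally show ?thesis .
    qed
    note gz = this
    define gp where "gp x = max 0 (g x)" for x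
    define gn where "gn x = max 0 (- g x)" for x
    have gpi: "integrable lborel gp" "integrable lborel gn" unfolding gp_def gn_def using gi by auto
    have gm [measurable]: "gp \<in> borel_measurable borel" "gn \<in> borel_measurable borel"
      using gpi by auto
    have em: "emeasure (density lborel (\<lambda>x. ennreal (h x))) {x<..} = ennreal (LBINT y. indicator {x<..} y * h y)"
      if "integrable lborel h" "\<And>x. 0 \<le> h x" for h :: "real \<Rightarrow> real" and x
    proof -
      have "emeasure (density lborel (\<lambda>x. ennreal (h x))) {x<..} = (\<integral>\<^sup>+y. ennreal (h y) * indicator {x<..} y \<partial>lborel)"
        using that by (subst emeasure_density) auto
      also have "\<dots> = (\<integral>\<^sup>+y. ennreal (indicator {x<..} y * h y) \<partial>lborel)"
        by (intro nn_integral_cong) (auto simp: indicator_def)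
      also have "\<dots> = ennreal (LBINT y. indicator {x<..} y * h y)"
        using that integrable_mult_indicator[OF _ that(1), of "{x<..}"] by (intro nn_integral_eq_integral) auto
      finally show ?thesis .
    qed
    have eq: "(LBINT y. indicator {x<..} y * gp y) = (LBINT y. indicator {x<..} y * gn y)" for x
    proof -
      have "(LBINT y. indicator {x<..} y * gp y) - (LBINT y. indicator {x<..} y * gn y)
        = (LBINT y. indicator {x<..} y * gp y - indicator {x<..} y * gn y)"
        using integrable_mult_indicator[OF _ gpi(1), of "{x<..}"] integrable_mult_indicator[OF _ gpi(2), of "{x<..}"]
        by (intro Bochner_Integration.integral_diff[symmetric]) auto
      also have "(\<lambda>y. indicator {x<..} y * gp y - indicator {x<..} y * gn y) = (\<lambda>y. indicator {x<..} y * g y)"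
        by (rule ext) (simp add: gp_def gn_def indicator_def max_def)
      finally show ?thesis using gz by simp
    qed
    have "density lborel (\<lambda>x. ennreal (gp x)) = density lborel (\<lambda>x. ennreal (gn x))"
    proof (rule measure_eqI_lessThan)
      fix x
      show "emeasure (density lborel (\<lambda>x. ennreal (gp x))) {x<..} < \<infinity>"
        using gpi by (subst em) (auto simp: gp_def)
      show "emeasure (density lborel (\<lambda>x. ennreal (gp x))) {x<..} = emeasure (density lborel (\<lambda>x. ennreal (gn x))) {x<..}"
        using gpi eq by (subst (1 2) em) (auto simp: gp_def gn_def)
    qed auto
    then have "AE x in lborel. ennreal (gp x) = ennreal (gn x)"
      by (intro sigma_finite_measure.density_unique[OF sigma_finite_lborel]) auto
    then have "AE x in lborel. g x = 0"
      by eventually_elim (auto simp: gp_def gn_def max_def split: if_splits)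
    then show ?thesis by eventually_elim (auto simp: g_def)
  qed
  then have "AE x in lborel. \<forall>N. x \<in> {- real N<..<real N} \<longrightarrow> f x = 0" unfolding AE_all_countable by blast
  then show ?thesis
  proof eventually_elim
    case (elim x)
    obtain N :: nat where "\<bar>x\<bar> < real N" using reals_Archimedean2 by blast
    then show ?case using elim by (auto simp: abs_less_iff)
  qed
qed

text \<open>By dominated convergence along \<open>bump a b n\<close>, vanishing against test
  functions passes to integrals over intervals.\<close>

lemma fundamental_lemma:
  fixes f :: "real \<Rightarrow> real"
  assumes f: "\<And>a b. set_integrable lborel {a..b} f" and m: "f \<in> borel_measurable borel"
    and z: "\<And>\<phi>. test_fun \<phi> \<Longrightarrow> (LBINT x. f x * \<phi> x) = 0"
  shows "AE x in lborel. f x = 0"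
proof (rule AE_zero_if_interval_integrals_zero[OF f m])
  fix a b :: real assume "a < b"
  have "(\<lambda>n. LBINT x. f x * bump a b n x) \<longlonglongrightarrow> (LBINT x. f x * indicator {a<..<b} x)"
  proof (rule integral_dominated_convergence)
    show "integrable lborel (\<lambda>x. indicator {a..b} x *\<^sub>R \<bar>f x\<bar>)"
      using set_integrable_abs[OF f[of a b]] unfolding set_integrable_def by simp
    show "AE x in lborel. (\<lambda>n. f x * bump a b n x) \<longlonglongrightarrow> f x * indicator {a<..<b} x"
      by (intro AE_I2 tendsto_mult tendsto_const bump_tendsto)
    show "AE x in lborel. norm (f x * bump a b n x) \<le> indicator {a..b} x *\<^sub>R \<bar>f x\<bar>" for n
    proof (rule AE_I2)
      fix x
      show "norm (f x * bump a b n x) \<le> indicator {a..b} x *\<^sub>R \<bar>f x\<bar>"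
      proof (cases "x \<in> {a..b}")
        case True
        have "\<bar>f x\<bar> * bump a b n x \<le> \<bar>f x\<bar> * 1" by (intro mult_left_mono bump_bounds) auto
        then show ?thesis using True bump_bounds(1)[of a b n x] by (simp add: abs_mult)
      next
        case False
        then have "bump a b n x = 0" by (intro bump_zero) auto
        then show ?thesis by simp
      qed
    qed
    show "(\<lambda>x. f x * bump a b n x) \<in> borel_measurable lborel" for n
      using m test_fun_measurable[OF test_fun_bump] by simp
  qed (use m in simp)
  then have "(LBINT x. f x * indicator {a<..<b} x) = 0"
    using z[OF test_fun_bump] by (simp add: LIMSEQ_const_iff)
  then show "(LBINT x:{a<..<b}. f x) = 0" by (simp add: set_lebesgue_integral_def mult.commute)
qed

text \<open>Mean zero is what makes the primitive started at \<open>-R\<close> vanish again to the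
  right of the support.\<close>

lemma antiderivative_test_fun:
  assumes \<psi>: "test_fun \<psi>" and z: "(LBINT x. \<psi> x) = 0"
  shows "\<exists>\<phi>. test_fun \<phi> \<and> deriv \<phi> = \<psi>"
proof -
  obtain R where R: "0 < R" "\<And>x. x \<notin> {-R<..<R} \<Longrightarrow> \<psi> x = 0 \<and> deriv \<psi> x = 0"
    using test_fun_support[OF \<psi>] by metis
  have c: "continuous_on A \<psi>" for A using test_fun_continuous[OF \<psi>] .
  define \<phi> where "\<phi> x = (LBINT y=ereal (-R)..ereal x. \<psi> y)" for x
  have d: "(\<phi> has_real_derivative \<psi> x) (at x)" for x
  proof -
    define a where "a = - R - \<bar>x\<bar> - 1"
    define b where "b = R + \<bar>x\<bar> + 1"
    have "((\<lambda>u. LBINT y=ereal (-R)..ereal u. \<psi> y) has_vector_derivative \<psi> x) (at x within {a..b})"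
      by (rule interval_integral_FTC2) (use R c in \<open>auto simp: a_def b_def\<close>)
    moreover have "at x within {a..b} = at x"
      by (rule at_within_interior) (use R in \<open>auto simp: a_def b_def\<close>)
    moreover have "\<phi> = (\<lambda>u. LBINT y=ereal (-R)..ereal u. \<psi> y)" by (simp add: \<phi>_def fun_eq_iff)
    ultimately show ?thesis by (simp only: has_real_derivative_iff_has_vector_derivative)
  qed
  have "\<phi> x = 0" if "R < \<bar>x\<bar>" for x
  proof (cases "x < 0")
    case True
    have "\<phi> x = - (LBINT y:{x..-R}. \<psi> y)"
      using that True R(1) interval_integral_Icc[of x "-R" \<psi>] unfolding \<phi>_def
      by (subst interval_integral_endpoints_reverse) simp
    also have "(LBINT y:{x..-R}. \<psi> y) = (LBINT y:{x..-R}. 0)"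
      using R by (intro set_lebesgue_integral_cong) auto
    finally show ?thesis by (simp add: set_lebesgue_integral_def)
  next
    case False
    then have xR: "R < x" using that by auto
    have "\<phi> x = (LBINT y:{-R..x}. \<psi> y)"
      using xR R(1) interval_integral_Icc[of "-R" x \<psi>] unfolding \<phi>_def by simp
    also have "\<dots> = (LBINT y. \<psi> y)"
      unfolding set_lebesgue_integral_def
    proof (rule Bochner_Integration.integral_cong[OF refl])
      fix y show "indicat_real {- R..x} y *\<^sub>R \<psi> y = \<psi> y"
        using R(2)[of y] xR by (cases "y \<in> {-R<..<R}") auto
    qed
    finally show ?thesis using z by simp
  qed
  moreover have "deriv \<phi> = \<psi>" using d by (intro ext DERIV_imp_deriv)
  moreover have "smooth \<phi>"
    using d \<psi> \<open>deriv \<phi> = \<psi>\<close> smooth_deriv_iff[of \<phi>] unfolding smooth_test_fun real_differentiable_def by auto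
  ultimately show ?thesis unfolding smooth_test_fun by blast
qed

lemma test_fun_integrable: "test_fun \<phi> \<Longrightarrow> integrable lborel \<phi>"
  using mult_test_fun_integrable[of "\<lambda>x. 1" \<phi>]
    borel_integrable_atLeastAtMost'[of _ _ "\<lambda>x. 1::real"] by simp

lemma test_fun_lincomb:
  assumes "test_fun \<phi>" "test_fun \<psi>"
  shows "test_fun (\<lambda>x. \<phi> x - c * \<psi> x)"
proof -
  obtain R S where "\<And>x. R < \<bar>x\<bar> \<Longrightarrow> \<phi> x = 0" "\<And>x. S < \<bar>x\<bar> \<Longrightarrow> \<psi> x = 0"
    using assms unfolding smooth_test_fun by blast
  then have "\<forall>x. max R S < \<bar>x\<bar> \<longrightarrow> \<phi> x - c * \<psi> x = 0" by auto
  then show ?thesis using assms smooth_diff unfolding smooth_test_fun by blast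
qed

text \<open>Subtracting \<open>J / I\<close> times a fixed bump \<open>\<rho>\<close> gives any test
  function mean zero and thus turns it into the derivative of a test function. The correction
  accounts for the constant \<open>c\<close>, the average of \<open>f\<close> weighted by
  \<open>\<rho>\<close>.\<close>

lemma du_Bois_Reymond:
  fixes f :: "real \<Rightarrow> real"
  assumes f: "\<And>a b. set_integrable lborel {a..b} f" and m: "f \<in> borel_measurable borel"
    and z: "\<And>\<phi>. test_fun \<phi> \<Longrightarrow> (LBINT x. f x * deriv \<phi> x) = 0"
  shows "\<exists>c. AE x in lborel. f x = c"
proof -
  define \<rho> where "\<rho> = bump 0 1 0"
  have \<rho>: "test_fun \<rho>" unfolding \<rho>_def by (rule test_fun_bump)
  define I where "I = (LBINT x. \<rho> x)"
  have "I \<noteq> 0"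
  proof
    assume "I = 0"
    then have "AE x in lborel. \<rho> x = 0"
      using test_fun_integrable[OF \<rho>] bump_bounds(1) unfolding I_def \<rho>_def
      by (subst (asm) integral_nonneg_eq_0_iff_AE) auto
    then have "AE x in lborel. x \<notin> {0<..<1::real}"
    proof eventually_elim
      case (elim x)
      have "bump 0 1 0 x > 0" if "x \<in> {0<..<1}" using that by (auto simp: bump_def flat_def)
      then show ?case using elim by (auto simp: \<rho>_def)
    qed
    then have "emeasure lborel {0<..<1::real} = 0" by (subst (asm) AE_iff_null_sets[symmetric]) auto
    then show False by simp
  qed
  define c where "c = (LBINT x. f x * \<rho> x) / I"
  have ci: "set_integrable lborel {a..b} (\<lambda>x. c)" for a b :: real
    by (rule borel_integrable_atLeastAtMost') simp
  have "AE x in lborel. f x - c = 0"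
  proof (rule fundamental_lemma)
    show "set_integrable lborel {a..b} (\<lambda>x. f x - c)" for a b
      using f ci by (intro set_integral_diff)
    fix \<psi> assume \<psi>: "test_fun \<psi>"
    define J where "J = (LBINT x. \<psi> x)"
    have t: "test_fun (\<lambda>x. \<psi> x - (J / I) * \<rho> x)" by (rule test_fun_lincomb[OF \<psi> \<rho>])
    have "(LBINT x. \<psi> x - (J / I) * \<rho> x) = 0"
      using test_fun_integrable[OF \<psi>] test_fun_integrable[OF \<rho>] \<open>I \<noteq> 0\<close>
      by (simp add: J_def[symmetric] I_def[symmetric])
    then obtain \<phi> where "test_fun \<phi>" "deriv \<phi> = (\<lambda>x. \<psi> x - (J / I) * \<rho> x)"
      using antiderivative_test_fun[OF t] by blast
    then have "(LBINT x. f x * (\<psi> x - (J / I) * \<rho> x)) = 0" using z[of \<phi>] by simp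
    moreover have "(LBINT x. f x * (\<psi> x - (J / I) * \<rho> x)) =
        (LBINT x. f x * \<psi> x - (J / I) * (f x * \<rho> x))" by (simp add: algebra_simps)
    moreover have "\<dots> = (LBINT x. f x * \<psi> x) - (J / I) * (LBINT x. f x * \<rho> x)"
      using mult_test_fun_integrable[OF f \<psi> m] mult_test_fun_integrable[OF f \<rho> m] by simp
    ultimately have "(LBINT x. f x * \<psi> x) = c * J" using \<open>I \<noteq> 0\<close> by (simp add: c_def field_simps)
    moreover have "(LBINT x. (f x - c) * \<psi> x) = (LBINT x. f x * \<psi> x) - c * J"
      using mult_test_fun_integrable[OF f \<psi> m] test_fun_integrable[OF \<psi>]
      by (simp add: left_diff_distrib J_def)
    ultimately show "(LBINT x. (f x - c) * \<psi> x) = 0" by simp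
  qed (use m in auto)
  then show ?thesis by auto
qed

section \<open>Square-integrable functions and integration by parts\<close>

lemma L2_measurable: "u \<in> L2 \<Longrightarrow> u \<in> borel_measurable borel"
  by (simp add: L2_def)

lemma L2_integrable_square: "u \<in> L2 \<Longrightarrow> integrable lborel (\<lambda>x. (u x)\<^sup>2)"
  by (simp add: L2_def)

lemma L2_mult_integrable:
  assumes "u \<in> L2" "v \<in> L2"
  shows "integrable lborel (\<lambda>x. u x * v x)"
proof (rule Bochner_Integration.integrable_bound)
  show "integrable lborel (\<lambda>x. (u x)\<^sup>2 + (v x)\<^sup>2)"
    using assms L2_integrable_square by simp
  show "(\<lambda>x. u x * v x) \<in> borel_measurable lborel"
    using assms L2_measurable by simp
  have "\<bar>a * b\<bar> \<le> a\<^sup>2 + b\<^sup>2" for a b :: real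
  proof -
    have "0 \<le> \<bar>a\<bar> * \<bar>b\<bar>" by simp
    moreover have "2 * (\<bar>a\<bar> * \<bar>b\<bar>) \<le> a\<^sup>2 + b\<^sup>2"
      using sum_squares_bound[of "\<bar>a\<bar>" "\<bar>b\<bar>"] by (simp add: mult.assoc)
    ultimately show ?thesis unfolding abs_mult by linarith
  qed
  then show "AE x in lborel. norm (u x * v x) \<le> norm ((u x)\<^sup>2 + (v x)\<^sup>2)"
    by (intro AE_I2) (simp add: abs_of_nonneg)
qed

lemma L2_scale: "u \<in> L2 \<Longrightarrow> (\<lambda>x. c * u x) \<in> L2"
  by (auto simp: L2_def power_mult_distrib)

lemma L2_add: "u \<in> L2 \<Longrightarrow> v \<in> L2 \<Longrightarrow> (\<lambda>x. u x + v x) \<in> L2"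
  using L2_mult_integrable[of u v] by (auto simp: L2_def power2_sum mult.assoc)

lemma L2_diff: "u \<in> L2 \<Longrightarrow> v \<in> L2 \<Longrightarrow> (\<lambda>x. u x - v x) \<in> L2"
  using L2_add[OF _ L2_scale[of v "-1"], of u] by simp

lemma L2_zero: "(\<lambda>x. 0) \<in> L2"
  by (simp add: L2_def)

lemma L2_AE_cong:
  assumes "u \<in> L2" "v \<in> borel_measurable borel" "AE x in lborel. u x = v x"
  shows "v \<in> L2"
proof -
  have "integrable lborel (\<lambda>x. (v x)\<^sup>2) \<longleftrightarrow> integrable lborel (\<lambda>x. (u x)\<^sup>2)"
    using assms L2_measurable[OF assms(1)] by (intro integrable_cong_AE) auto
  then show ?thesis using assms by (simp add: L2_def)
qed

lemma L2_mult_bounded: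
  assumes u: "u \<in> L2" and g: "g \<in> borel_measurable borel" "AE x in lborel. \<bar>g x\<bar> \<le> M"
  shows "(\<lambda>x. g x * u x) \<in> L2"
proof -
  have "integrable lborel (\<lambda>x. (g x * u x)\<^sup>2)"
  proof (rule Bochner_Integration.integrable_bound)
    show "integrable lborel (\<lambda>x. M\<^sup>2 * (u x)\<^sup>2)" using L2_integrable_square[OF u] by simp
    show "AE x in lborel. norm ((g x * u x)\<^sup>2) \<le> norm (M\<^sup>2 * (u x)\<^sup>2)"
      using g(2)
    proof eventually_elim
      case (elim x)
      then have "(g x)\<^sup>2 \<le> M\<^sup>2" by (simp add: abs_le_square_iff[symmetric])
      then show ?case by (simp add: power_mult_distrib mult_right_mono)
    qed
  qed (use g L2_measurable[OF u] in auto)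
  then show ?thesis using g L2_measurable[OF u] by (simp add: L2_def)
qed

lemma L2_indicator: "(indicator {a..b} :: real \<Rightarrow> real) \<in> L2"
proof -
  have "set_integrable lborel {a..b} (\<lambda>x. 1::real)"
    by (rule borel_integrable_atLeastAtMost') simp
  moreover have "(\<lambda>x. (indicator {a..b} x :: real)\<^sup>2) = indicator {a..b}"
    by (auto simp: indicator_def)
  ultimately show ?thesis by (simp add: L2_def set_integrable_def)
qed

lemma L2_set_integrable: "u \<in> L2 \<Longrightarrow> set_integrable lborel {a..b} u"
  using L2_mult_integrable[OF L2_indicator] by (simp add: set_integrable_def)

lemma test_fun_L2: "test_fun \<phi> \<Longrightarrow> \<phi> \<in> L2"
  using mult_test_fun_integrable[of \<phi> \<phi>] borel_integrable_atLeastAtMost'[OF test_fun_continuous]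
    test_fun_measurable by (simp add: L2_def power2_eq_square)

abbreviation sqint :: "(real \<Rightarrow> real) \<Rightarrow> real" where
  "sqint u \<equiv> (LBINT t. (u t)\<^sup>2)"

lemma L2_Cauchy_Schwarz:
  assumes "u \<in> L2" "v \<in> L2"
  shows "(LBINT x. u x * v x)\<^sup>2 \<le> sqint u * sqint v"
proof (rule nonneg_quadratic_discriminant)
  fix c
  have "0 \<le> (LBINT x. (u x + c * v x)\<^sup>2)" by simp
  also have "(LBINT x. (u x + c * v x)\<^sup>2) =
      (LBINT x. (u x)\<^sup>2 + 2 * c * (u x * v x) + c\<^sup>2 * (v x)\<^sup>2)"
    by (intro Bochner_Integration.integral_cong) (auto simp: power2_eq_square algebra_simps)
  also have "\<dots> = sqint u + 2 * c * (LBINT x. u x * v x) + c\<^sup>2 * sqint v"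
    using L2_integrable_square[OF assms(1)] L2_integrable_square[OF assms(2)] L2_mult_integrable[OF assms]
    by simp
  finally show "0 \<le> sqint u + 2 * c * (LBINT x. u x * v x) + c\<^sup>2 * sqint v" .
qed simp

lemma L2_interval_bound:
  assumes "u \<in> L2" "a \<le> b"
  shows "\<bar>LBINT x:{a..b}. u x\<bar> \<le> sqrt ((b - a) * sqint u)"
proof -
  have "(LBINT x. (indicator {a..b} x :: real)\<^sup>2) = (LBINT x. indicator {a..b} x)"
    by (intro Bochner_Integration.integral_cong) (auto simp: indicator_def)
  then have "(LBINT x. (indicator {a..b} x :: real)\<^sup>2) = b - a" using assms(2) by simp
  then show ?thesis
    using L2_Cauchy_Schwarz[OF L2_indicator assms(1), of a b]
    by (simp add: set_lebesgue_integral_def real_le_rsqrt)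
qed

lemma L2_norm_zero_iff:
  assumes "u \<in> L2"
  shows "sqint u = 0 \<longleftrightarrow> (AE x in lborel. u x = 0)"
  using integral_nonneg_eq_0_iff_AE[OF L2_integrable_square[OF assms]] by simp

text \<open>Riesz-Fischer: a subsequence with rapidly decreasing distances converges almost
  everywhere, and its limit is shown to be the limit of the whole sequence in mean square.\<close>

lemma L2_complete:
  fixes f :: "nat \<Rightarrow> real \<Rightarrow> real"
  assumes f: "\<And>n. f n \<in> L2"
    and Cauchy: "\<And>e. 0 < e \<Longrightarrow> \<exists>N. \<forall>m\<ge>N. \<forall>n\<ge>N. (LBINT x. (f m x - f n x)\<^sup>2) < e"
  shows "\<exists>g\<in>L2. (\<lambda>n. LBINT x. (f n x - g x)\<^sup>2) \<longlonglongrightarrow> 0"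
proof -
  have fm [measurable]: "f n \<in> borel_measurable borel" for n using L2_measurable[OF f] .
  have "\<exists>N. \<forall>m\<ge>N. \<forall>n\<ge>N. (LBINT x. (f m x - f n x)\<^sup>2) < (1/4)^k" for k :: nat
    by (rule Cauchy) simp
  then obtain N where N: "\<And>k m n. N k \<le> m \<Longrightarrow> N k \<le> n \<Longrightarrow> (LBINT x. (f m x - f n x)\<^sup>2) < (1/4)^k"
    by metis
  \<comment> \<open>The sum makes \<open>r\<close> increasing with \<open>r k \<ge> N k\<close>; the
    summand \<open>k\<close> makes it tend to infinity.\<close>
  define r where "r k = (\<Sum>i\<le>k. N i) + k" for k
  have Nr: "N k \<le> r k" for k unfolding r_def by (simp add: sum_nonneg_leq_bound trans_le_add1 member_le_sum)
  have rmono: "r k \<le> r (Suc k)" for k by (simp add: r_def)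
  have rk: "k \<le> r k" for k by (simp add: r_def)
  define h where "h k x = f (r (Suc k)) x - f (r k) x" for k x
  have hL2: "h k \<in> L2" for k unfolding h_def by (intro L2_diff f)
  have hm [measurable]: "h k \<in> borel_measurable borel" for k using L2_measurable[OF hL2] .
  have hint: "(LBINT x. (h k x)\<^sup>2) < (1/4)^k" for k
    unfolding h_def by (intro N order_trans[OF Nr rmono] Nr)
  \<comment> \<open>The weights serve the AM-GM bound \<open>\<bar>h k x\<bar> \<le> 2\<^bsup>-k\<^esup> + 2\<^bsup>k\<^esup> (h k x)\<^sup>2\<close>.\<close>
  have "AE x in lborel. (\<Sum>k. ennreal (2^k * (h k x)\<^sup>2)) \<noteq> \<infinity>"
  proof (rule nn_integral_noteq_infinite)
    have "(\<integral>\<^sup>+x. (\<Sum>k. ennreal (2^k * (h k x)\<^sup>2)) \<partial>lborel) = (\<Sum>k. \<integral>\<^sup>+x. ennreal (2^k * (h k x)\<^sup>2) \<partial>lborel)"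
      by (rule nn_integral_suminf) simp
    also have "\<dots> \<le> (\<Sum>k. ennreal ((1/2)^k))"
    proof (rule suminf_le)
      fix k
      have "(\<integral>\<^sup>+x. ennreal (2^k * (h k x)\<^sup>2) \<partial>lborel) = ennreal (LBINT x. 2^k * (h k x)\<^sup>2)"
        using L2_integrable_square[OF hL2] by (intro nn_integral_eq_integral) auto
      also have "\<dots> \<le> ennreal ((1/2)^k)"
      proof (rule ennreal_leI)
        have "2^k * (LBINT x. (h k x)\<^sup>2) \<le> 2^k * (1/4)^k" using hint[of k] by simp
        also have "\<dots> = (1/2::real)^k" by (simp add: power_mult_distrib[symmetric])
        finally show "(LBINT x. 2^k * (h k x)\<^sup>2) \<le> (1/2)^k" by simp
      qed
      finally show "(\<integral>\<^sup>+x. ennreal (2^k * (h k x)\<^sup>2) \<partial>lborel) \<le> ennreal ((1/2)^k)" .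
    qed auto
    also have "\<dots> = ennreal (\<Sum>k. (1/2)^k)" by (intro suminf_ennreal2) (auto intro!: summable_geometric)
    also have "\<dots> < \<infinity>" by simp
    finally show "(\<integral>\<^sup>+x. (\<Sum>k. ennreal (2^k * (h k x)\<^sup>2)) \<partial>lborel) \<noteq> \<infinity>" by simp
  qed simp
  then have conv: "AE x in lborel. convergent (\<lambda>k. f (r k) x)"
  proof eventually_elim
    case (elim x)
    then have s1: "summable (\<lambda>k. 2^k * (h k x)\<^sup>2)"
      by (intro summable_suminf_not_top) auto
    have "summable (\<lambda>k. h k x)"
    proof (rule summable_comparison_test')
      show "summable (\<lambda>k. (1/2)^k + 2^k * (h k x)\<^sup>2)"
        by (intro summable_add s1 summable_geometric) simp
      fix k
      define p where "p = (2::real)^k"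
      have p: "p > 0" by (simp add: p_def)
      have "p * \<bar>h k x\<bar> \<le> 1 + (p * \<bar>h k x\<bar>)\<^sup>2"
      proof -
        have "2 * (p * \<bar>h k x\<bar>) \<le> 1 + (p * \<bar>h k x\<bar>)\<^sup>2"
          using sum_squares_bound[of 1 "p * \<bar>h k x\<bar>"] by simp
        moreover have "0 \<le> p * \<bar>h k x\<bar>" using p by simp
        ultimately show ?thesis by linarith
      qed
      then have "\<bar>h k x\<bar> \<le> 1 / p + p * (h k x)\<^sup>2"
        using p by (simp add: field_simps power2_eq_square)
      then show "norm (h k x) \<le> (1/2)^k + 2^k * (h k x)\<^sup>2" by (simp add: p_def power_divide)
    qed
    then have "convergent (\<lambda>n. f (r 0) x + (\<Sum>k<n. h k x))"
      by (intro convergent_add convergent_const) (simp add: summable_iff_convergent)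
    moreover have "f (r 0) x + (\<Sum>k<n. h k x) = f (r n) x" for n
      unfolding h_def by (induction n) auto
    ultimately show ?case by simp
  qed
  define g where "g x = lim (\<lambda>k. f (r k) x)" for x
  have gm [measurable]: "g \<in> borel_measurable borel" unfolding g_def by measurable
  have lim: "AE x in lborel. (\<lambda>k. f (r k) x) \<longlonglongrightarrow> g x"
    using conv by eventually_elim (simp add: g_def convergent_LIMSEQ_iff)
  \<comment> \<open>Fatou's lemma along the subsequence turns the Cauchy estimate into one for the
    distance to \<open>g\<close>, valid for every \<open>n \<ge> N K\<close> and not only along
    \<open>r\<close>.\<close>
  have key: "integrable lborel (\<lambda>x. (f n x - g x)\<^sup>2) \<and> (LBINT x. (f n x - g x)\<^sup>2) \<le> (1/4)^K"
    if n: "N K \<le> n" for n K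
  proof -
    have "(\<integral>\<^sup>+x. ennreal ((f n x - g x)\<^sup>2) \<partial>lborel) \<le> (\<integral>\<^sup>+x. liminf (\<lambda>k. ennreal ((f n x - f (r k) x)\<^sup>2)) \<partial>lborel)"
    proof (rule nn_integral_mono_AE)
      show "AE x in lborel. ennreal ((f n x - g x)\<^sup>2) \<le> liminf (\<lambda>k. ennreal ((f n x - f (r k) x)\<^sup>2))"
        using lim
      proof eventually_elim
        case (elim x)
        then have "(\<lambda>k. ennreal ((f n x - f (r k) x)\<^sup>2)) \<longlonglongrightarrow> ennreal ((f n x - g x)\<^sup>2)"
          by (intro tendsto_intros)
        from lim_imp_Liminf[OF trivial_limit_sequentially this] show ?case by simp
      qed
    qed
    also have "\<dots> \<le> liminf (\<lambda>k. \<integral>\<^sup>+x. ennreal ((f n x - f (r k) x)\<^sup>2) \<partial>lborel)"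
      by (rule nn_integral_liminf) simp
    also have "\<dots> \<le> ennreal ((1/4)^K)"
    proof -
      have "eventually (\<lambda>k. (\<integral>\<^sup>+x. ennreal ((f n x - f (r k) x)\<^sup>2) \<partial>lborel) \<le> ennreal ((1/4)^K)) sequentially"
        using eventually_ge_at_top[of "N K"]
      proof eventually_elim
        case (elim k)
        have "(\<integral>\<^sup>+x. ennreal ((f n x - f (r k) x)\<^sup>2) \<partial>lborel) = ennreal (LBINT x. (f n x - f (r k) x)\<^sup>2)"
          using L2_integrable_square[OF L2_diff[OF f f]] by (intro nn_integral_eq_integral) auto
        also have "\<dots> \<le> ennreal ((1/4)^K)"
          using N[OF n, of "r k"] elim rk[of k] by (intro ennreal_leI) simp
        finally show ?case .
      qed
      then have "liminf (\<lambda>k. \<integral>\<^sup>+x. ennreal ((f n x - f (r k) x)\<^sup>2) \<partial>lborel) \<le> liminf (\<lambda>k::nat. ennreal ((1/4)^K))"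
        by (rule Liminf_mono)
      then show ?thesis by (simp add: Liminf_const)
    qed
    finally have le: "(\<integral>\<^sup>+x. ennreal ((f n x - g x)\<^sup>2) \<partial>lborel) \<le> ennreal ((1/4)^K)" .
    have int: "integrable lborel (\<lambda>x. (f n x - g x)\<^sup>2)"
      using le by (intro integrableI_nonneg) (auto intro: le_less_trans)
    moreover have "ennreal (LBINT x. (f n x - g x)\<^sup>2) \<le> ennreal ((1/4)^K)"
      using le nn_integral_eq_integral[OF int] by simp
    ultimately show ?thesis by (simp add: ennreal_le_iff)
  qed
  have "(\<lambda>x. f (N 0) x - g x) \<in> L2" using key[of 0 "N 0"] by (simp add: L2_def)
  then have "(\<lambda>x. f (N 0) x - (f (N 0) x - g x)) \<in> L2" by (rule L2_diff[OF f])
  then have "g \<in> L2" by simp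
  moreover have "(\<lambda>n. LBINT x. (f n x - g x)\<^sup>2) \<longlonglongrightarrow> 0"
  proof (rule LIMSEQ_I)
    fix e :: real assume "0 < e"
    then obtain K where K: "(1/4)^K < e" using real_arch_pow_inv[of e "1/4"] by auto
    have "norm ((LBINT x. (f n x - g x)\<^sup>2) - 0) < e" if "N K \<le> n" for n
      using key[OF that] K by (simp add: abs_of_nonneg)
    then show "\<exists>no. \<forall>n\<ge>no. norm ((LBINT x. (f n x - g x)\<^sup>2) - 0) < e" by blast
  qed
  ultimately show ?thesis by blast
qed

section \<open>Integration by parts for primitives of integrable functions\<close>

lemma set_integral_split:
  fixes f :: "real \<Rightarrow> real"
  assumes "a \<le> b" "b \<le> c" "set_integrable lborel {a..c} f"
  shows "(LBINT x:{a..c}. f x) = (LBINT x:{a..b}. f x) + (LBINT x:{b..c}. f x)"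
proof -
  have i: "integrable lborel (\<lambda>x. indicator {a..b} x *\<^sub>R f x)" "integrable lborel (\<lambda>x. indicator {b..c} x *\<^sub>R f x)"
    using assms set_integrable_subset[OF assms(3), of "{a..b}"] set_integrable_subset[OF assms(3), of "{b..c}"]
    by (auto simp: set_integrable_def)
  have "(LBINT x. indicator {a..c} x *\<^sub>R f x) =
      (LBINT x. indicator {a..b} x *\<^sub>R f x + indicator {b..c} x *\<^sub>R f x)"
  proof (rule integral_cong_AE)
    have "AE x in lborel. x \<noteq> b" by (rule AE_lborel_singleton)
    then show "AE x in lborel. indicator {a..c} x *\<^sub>R f x = indicator {a..b} x *\<^sub>R f x + indicator {b..c} x *\<^sub>R f x"
      by eventually_elim (use assms(1,2) in \<open>auto simp: indicator_def\<close>)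
  qed (use assms(3) i in \<open>auto simp: set_integrable_def\<close>)
  then show ?thesis using i by (simp add: set_lebesgue_integral_def)
qed

text \<open>Fubini for f(t) g(x) with the plane cut along the diagonal: the local function
  \<open>H1\<close> takes the part t \<le> x, \<open>H2\<close> the part x < t. A single point is a
  null set, so the inner integral of \<open>H2\<close> may be written over a closed
  half-line.\<close>

lemma integration_by_parts_zero:
  fixes f g :: "real \<Rightarrow> real"
  assumes f: "integrable lborel f" and g: "integrable lborel g"
  shows "integrable lborel (\<lambda>x. (LBINT t:{..x}. f t) * g x)" (is "integrable _ ?A")
    and "integrable lborel (\<lambda>x. f x * (LBINT t:{..x}. g t))" (is "integrable _ ?B")
    and "(LBINT x. (LBINT t:{..x}. f t) * g x) + (LBINT x. f x * (LBINT t:{..x}. g t))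
      = (LBINT x. f x) * (LBINT x. g x)"
proof -
  have [measurable]: "f \<in> borel_measurable borel" "g \<in> borel_measurable borel" using f g by auto
  define H where "H = (\<lambda>(x, t). f t * g x)"
  define H1 where "H1 = (\<lambda>(x::real, t::real). (if t \<le> x then 1 else 0) * (f t * g x))"
  define H2 where "H2 = (\<lambda>(x::real, t::real). (if x < t then 1 else 0) * (f t * g x))"
  have Hi: "integrable (lborel \<Otimes>\<^sub>M lborel) H"
  proof (rule lborel_pair.Fubini_integrable)
    show "H \<in> borel_measurable (lborel \<Otimes>\<^sub>M lborel)" unfolding H_def by measurable
    show "integrable lborel (\<lambda>x. LBINT y. norm (H (x, y)))"
      using g by (simp add: H_def abs_mult)
    show "AE x in lborel. integrable lborel (\<lambda>y. H (x, y))" using f by (simp add: H_def)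
  qed
  have H1i: "integrable (lborel \<Otimes>\<^sub>M lborel) H1"
  proof (rule Bochner_Integration.integrable_bound[OF Hi])
    show "H1 \<in> borel_measurable (lborel \<Otimes>\<^sub>M lborel)" unfolding H1_def by measurable
  qed (auto simp: H1_def H_def)
  have H2i: "integrable (lborel \<Otimes>\<^sub>M lborel) H2"
  proof (rule Bochner_Integration.integrable_bound[OF Hi])
    show "H2 \<in> borel_measurable (lborel \<Otimes>\<^sub>M lborel)" unfolding H2_def by measurable
  qed (auto simp: H2_def H_def)
  have A: "?A = (\<lambda>x. LBINT t. H1 (x, t))"
  proof
    fix x
    have "(LBINT t. H1 (x, t)) = (LBINT t. (indicator {..x} t *\<^sub>R f t) * g x)"
      by (intro Bochner_Integration.integral_cong) (auto simp: H1_def indicator_def)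
    also have "\<dots> = ?A x" by (simp add: set_lebesgue_integral_def)
    finally show "?A x = (LBINT t. H1 (x, t))" ..
  qed
  have B: "?B = (\<lambda>t. LBINT x. H2 (x, t))"
  proof
    fix t
    have "(LBINT x. H2 (x, t)) = (LBINT x. f t * (indicator {..t} x *\<^sub>R g x))"
    proof (rule integral_cong_AE)
      have "AE x in lborel. x \<noteq> t" by (rule AE_lborel_singleton)
      then show "AE x in lborel. H2 (x, t) = f t * (indicator {..t} x *\<^sub>R g x)"
        by eventually_elim (auto simp: H2_def indicator_def)
      show "(\<lambda>x. H2 (x, t)) \<in> borel_measurable lborel" unfolding H2_def prod.case by measurable
    qed simp
    also have "\<dots> = ?B t" by (simp add: set_lebesgue_integral_def)
    finally show "?B t = (LBINT x. H2 (x, t))" ..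
  qed
  show "integrable lborel ?A" unfolding A using lborel_pair.integrable_fst'[OF H1i] .
  have H2s: "integrable (lborel \<Otimes>\<^sub>M lborel) (\<lambda>(x, y). H2 (y, x))"
    by (rule lborel_pair.integrable_product_swap[OF H2i])
  show "integrable lborel ?B" unfolding B using lborel_pair.integrable_fst'[OF H2s] by simp
  have "(LBINT x. ?A x) = (LINT p|(lborel \<Otimes>\<^sub>M lborel). H1 p)"
    unfolding A by (rule lborel_pair.integral_fst'[OF H1i])
  moreover have "(LBINT x. ?B x) = (LINT p|(lborel \<Otimes>\<^sub>M lborel). H2 p)"
    unfolding B using lborel_pair.integral_fst'[OF H2s] lborel_pair.integral_product_swap[of H2] H2i by simp
  moreover have "(LINT p|(lborel \<Otimes>\<^sub>M lborel). H1 p) + (LINT p|(lborel \<Otimes>\<^sub>M lborel). H2 p) = (LINT p|(lborel \<Otimes>\<^sub>M lborel). H1 p + H2 p)"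
    using H1i H2i by simp
  moreover have "(\<lambda>p. H1 p + H2 p) = H" by (auto simp: H1_def H2_def H_def)
  moreover have "(LINT p|(lborel \<Otimes>\<^sub>M lborel). H p) = (LBINT x. LBINT t. H (x, t))"
    by (rule lborel_pair.integral_fst'[OF Hi, symmetric])
  ultimately show "(LBINT x. ?A x) + (LBINT x. ?B x) = (LBINT x. f x) * (LBINT x. g x)"
    by (simp add: H_def)
qed

text \<open>\<open>F\<close> and \<open>G\<close> are only primitives of integrable functions, so no
  pointwise product rule is at hand. Cutting the densities off outside [a, b] reduces the claim to
  zero initial values; the terms with \<open>F a\<close> and \<open>G a\<close> are linear and added
  separately.\<close>

lemma integration_by_parts_interval:
  fixes F G f g :: "real \<Rightarrow> real"
  assumes ab: "a \<le> b"
    and f: "set_integrable lborel {a..b} f" and g: "set_integrable lborel {a..b} g"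
    and F: "\<And>x. a \<le> x \<Longrightarrow> x \<le> b \<Longrightarrow> F x = F a + (LBINT t:{a..x}. f t)"
    and G: "\<And>x. a \<le> x \<Longrightarrow> x \<le> b \<Longrightarrow> G x = G a + (LBINT t:{a..x}. g t)"
  shows "(LBINT x:{a..b}. F x * g x + f x * G x) = F b * G b - F a * G a"
proof -
  define f1 where "f1 x = indicator {a..b} x *\<^sub>R f x" for x
  define g1 where "g1 x = indicator {a..b} x *\<^sub>R g x" for x
  have i: "integrable lborel f1" "integrable lborel g1" using f g by (auto simp: f1_def[abs_def] g1_def[abs_def] set_integrable_def)
  have e: "(LBINT t:{..x}. f1 t) = (LBINT t:{a..x}. f t)"
       "(LBINT t:{..x}. g1 t) = (LBINT t:{a..x}. g t)" if "x \<in> {a..b}" for x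
    unfolding set_lebesgue_integral_def f1_def g1_def using that
    by (auto intro!: Bochner_Integration.integral_cong simp: indicator_def)
  have tot: "(LBINT t. f1 t) = F b - F a" "(LBINT t. g1 t) = G b - G a"
    using F[of b] G[of b] ab by (auto simp: f1_def g1_def set_lebesgue_integral_def)
  have "(LBINT x:{a..b}. F x * g x + f x * G x) =
     (LBINT x. (F a * g1 x + G a * f1 x) + ((LBINT t:{..x}. f1 t) * g1 x + f1 x * (LBINT t:{..x}. g1 t)))"
    unfolding set_lebesgue_integral_def[of _ "{a..b}" "\<lambda>x. F x * g x + f x * G x"]
  proof (rule Bochner_Integration.integral_cong[OF refl])
    fix x
    show "indicator {a..b} x *\<^sub>R (F x * g x + f x * G x) =
      (F a * g1 x + G a * f1 x) + ((LBINT t:{..x}. f1 t) * g1 x + f1 x * (LBINT t:{..x}. g1 t))"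
    proof (cases "x \<in> {a..b}")
      case True
      then show ?thesis unfolding e[OF True] using F[of x] G[of x]
        by (simp add: f1_def g1_def algebra_simps)
    qed (simp add: f1_def g1_def)
  qed
  also have "\<dots> = (F a * (G b - G a) + G a * (F b - F a)) + (F b - F a) * (G b - G a)"
    using i integration_by_parts_zero[OF i] by (simp add: tot[symmetric])
  also have "\<dots> = F b * G b - F a * G a" by (simp add: algebra_simps)
  finally show ?thesis .
qed

section \<open>The Sobolev space as a type of continuous functions\<close>

lemma H1D:
  assumes "u \<in> H1"
  shows "u \<in> L2" "wd u \<in> L2" "weak_deriv u (wd u)"
proof -
  have "\<exists>w. w \<in> L2 \<and> weak_deriv u w" using assms by (auto simp: H1_def)
  from someI_ex[OF this] show "wd u \<in> L2" "weak_deriv u (wd u)" by (auto simp: wd_def)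
qed (use assms in \<open>auto simp: H1_def\<close>)

lemma weak_deriv_unique:
  assumes "w \<in> L2" "w' \<in> L2" "weak_deriv u w" "weak_deriv u w'"
  shows "AE x in lborel. w x = w' x"
proof -
  have "AE x in lborel. w x - w' x = 0"
  proof (rule fundamental_lemma)
    show "set_integrable lborel {a..b} (\<lambda>x. w x - w' x)" for a b
      using assms by (intro L2_set_integrable L2_diff)
    show "(\<lambda>x. w x - w' x) \<in> borel_measurable borel" using assms L2_measurable by auto
    fix \<phi> assume \<phi>: "test_fun \<phi>"
    have "(LBINT x. (w x - w' x) * \<phi> x) = (LBINT x. w x * \<phi> x) - (LBINT x. w' x * \<phi> x)"
      using L2_mult_integrable[OF assms(1) test_fun_L2[OF \<phi>]] L2_mult_integrable[OF assms(2) test_fun_L2[OF \<phi>]]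
      by (simp add: left_diff_distrib)
    also have "\<dots> = 0" using assms(3,4) \<phi> unfolding weak_deriv_def by fastforce
    finally show "(LBINT x. (w x - w' x) * \<phi> x) = 0" .
  qed
  then show ?thesis by eventually_elim simp
qed

lemma wd_AE_eq:
  assumes "u \<in> L2" "w \<in> L2" "weak_deriv u w"
  shows "u \<in> H1" "AE x in lborel. wd u x = w x"
proof -
  show "u \<in> H1" using assms by (auto simp: H1_def)
  from H1D[OF this] show "AE x in lborel. wd u x = w x" using assms weak_deriv_unique by blast
qed

lemma weak_deriv_AE_cong:
  assumes "u \<in> borel_measurable borel" "v \<in> borel_measurable borel" "AE x in lborel. u x = v x" "weak_deriv u w"
  shows "weak_deriv v w"
  unfolding weak_deriv_def
proof (intro allI impI)
  fix \<phi> assume \<phi>: "test_fun \<phi>"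
  have [measurable]: "deriv \<phi> \<in> borel_measurable borel" by (intro test_fun_measurable test_fun_deriv \<phi>)
  have "(LBINT x. v x * deriv \<phi> x) = (LBINT x. u x * deriv \<phi> x)"
    using assms(1-3) by (intro integral_cong_AE) auto
  then show "(LBINT x. v x * deriv \<phi> x) = - (LBINT x. w x * \<phi> x)"
    using assms(4) \<phi> by (simp add: weak_deriv_def)
qed

lemma weak_deriv_lincomb:
  assumes "u \<in> L2" "v \<in> L2" "w \<in> L2" "z \<in> L2" "weak_deriv u w" "weak_deriv v z"
  shows "weak_deriv (\<lambda>x. c * u x + d * v x) (\<lambda>x. c * w x + d * z x)"
  unfolding weak_deriv_def
proof (intro allI impI)
  fix \<phi> assume \<phi>: "test_fun \<phi>"
  note L = test_fun_L2[OF \<phi>] test_fun_L2[OF test_fun_deriv[OF \<phi>]]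
  have "(LBINT x. (c * u x + d * v x) * deriv \<phi> x) =
      (LBINT x. c * (u x * deriv \<phi> x) + d * (v x * deriv \<phi> x))" by (simp add: algebra_simps)
  also have "\<dots> = c * (LBINT x. u x * deriv \<phi> x) + d * (LBINT x. v x * deriv \<phi> x)"
    using L2_mult_integrable[OF assms(1) L(2)] L2_mult_integrable[OF assms(2) L(2)] by simp
  also have "\<dots> = - (c * (LBINT x. w x * \<phi> x) + d * (LBINT x. z x * \<phi> x))"
    using assms(5,6) \<phi> unfolding weak_deriv_def by (simp add: algebra_simps)
  also have "c * (LBINT x. w x * \<phi> x) + d * (LBINT x. z x * \<phi> x) =
      (LBINT x. c * (w x * \<phi> x) + d * (z x * \<phi> x))"
    using L2_mult_integrable[OF assms(3) L(1)] L2_mult_integrable[OF assms(4) L(1)] by simp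
  also have "\<dots> = (LBINT x. (c * w x + d * z x) * \<phi> x)" by (simp add: algebra_simps)
  finally show "(LBINT x. (c * u x + d * v x) * deriv \<phi> x) = - (LBINT x. (c * w x + d * z x) * \<phi> x)" .
qed

lemma H1_lincomb:
  assumes "u \<in> H1" "v \<in> H1"
  shows "(\<lambda>x. c * u x + d * v x) \<in> H1"
    "AE x in lborel. wd (\<lambda>x. c * u x + d * v x) x = c * wd u x + d * wd v x"
proof -
  note uv = H1D[OF assms(1)] H1D[OF assms(2)]
  have "weak_deriv (\<lambda>x. c * u x + d * v x) (\<lambda>x. c * wd u x + d * wd v x)"
    using uv by (intro weak_deriv_lincomb)
  moreover have "(\<lambda>x. c * u x + d * v x) \<in> L2" "(\<lambda>x. c * wd u x + d * wd v x) \<in> L2"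
    using uv by (auto intro!: L2_add L2_scale)
  ultimately show "(\<lambda>x. c * u x + d * v x) \<in> H1"
    "AE x in lborel. wd (\<lambda>x. c * u x + d * v x) x = c * wd u x + d * wd v x"
    using wd_AE_eq by auto
qed

lemma H1_AE_cong:
  assumes "u \<in> H1" "v \<in> borel_measurable borel" "AE x in lborel. u x = v x"
  shows "v \<in> H1" "AE x in lborel. wd v x = wd u x"
proof -
  note u = H1D[OF assms(1)]
  have "weak_deriv v (wd u)" using weak_deriv_AE_cong[OF L2_measurable[OF u(1)] assms(2,3) u(3)] .
  then show "v \<in> H1" "AE x in lborel. wd v x = wd u x"
    using wd_AE_eq L2_AE_cong[OF u(1) assms(2,3)] u(2) by auto
qed

section \<open>Absolutely continuous representatives of Sobolev functions\<close>

definition ac :: "(real \<Rightarrow> real) \<Rightarrow> (real \<Rightarrow> real) \<Rightarrow> bool" where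
  "ac F w \<longleftrightarrow> (\<forall>a b. a \<le> b \<longrightarrow> F b - F a = (LBINT t:{a..b}. w t))"

lemma ac_exists:
  assumes "w \<in> L2"
  shows "\<exists>F. ac F w"
proof -
  define F where "F x = (if 0 \<le> x then (LBINT t:{0..x}. w t) else - (LBINT t:{x..0}. w t))" for x
  have "F b - F a = (LBINT t:{a..b}. w t)" if "a \<le> b" for a b
  proof -
    consider "0 \<le> a" | "a < 0" "0 \<le> b" | "b < 0" by linarith
    then show ?thesis
    proof cases
      case 1
      then show ?thesis using that set_integral_split[of 0 a b w] L2_set_integrable[OF assms] by (simp add: F_def)
    next
      case 2
      then show ?thesis using set_integral_split[of a 0 b w] L2_set_integrable[OF assms] by (simp add: F_def)
    next
      case 3
      then show ?thesis using that set_integral_split[of a b 0 w] L2_set_integrable[OF assms] by (simp add: F_def)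
    qed
  qed
  then show ?thesis unfolding ac_def by blast
qed

text \<open>Cauchy-Schwarz on the interval. The bound depends on \<open>w\<close> only through its
  \<open>L2\<close> norm, so it also supplies the equicontinuity behind compactness.\<close>

lemma ac_Hoelder:
  assumes "ac F w" "w \<in> L2"
  shows "\<bar>F x - F y\<bar> \<le> sqrt (\<bar>x - y\<bar> * sqint w)"
proof -
  have *: "\<bar>F b - F a\<bar> \<le> sqrt ((b - a) * sqint w)" if "a \<le> b" for a b
    using assms(1) that L2_interval_bound[OF assms(2) that] unfolding ac_def by simp
  show ?thesis
    using *[of x y] *[of y x] by (cases "x \<le> y") (auto simp: abs_minus_commute)
qed

lemma ac_continuous:
  assumes "ac F w" "w \<in> L2"
  shows "continuous_on A F"
proof -
  have "isCont F x" for x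
    unfolding isCont_def
  proof (rule LIM_zero_cancel)
    show "((\<lambda>y. F y - F x) \<longlongrightarrow> 0) (at x)"
    proof (rule Lim_null_comparison)
      show "\<forall>\<^sub>F y in at x. norm (F y - F x) \<le> sqrt (\<bar>y - x\<bar> * sqint w)"
        using ac_Hoelder[OF assms] by (intro always_eventually) simp
      have "((\<lambda>y. sqrt (\<bar>y - x\<bar> * sqint w)) \<longlongrightarrow> sqrt (\<bar>x - x\<bar> * sqint w)) (at x)"
        by (intro tendsto_intros)
      then show "((\<lambda>y. sqrt (\<bar>y - x\<bar> * sqint w)) \<longlongrightarrow> 0) (at x)" by simp
    qed
  qed
  then show ?thesis by (simp add: continuous_at_imp_continuous_on)
qed

lemma test_fun_ac:
  assumes "test_fun \<phi>"
  shows "ac \<phi> (deriv \<phi>)"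
  unfolding ac_def
proof (intro allI impI)
  fix a b :: real assume "a \<le> b"
  have "(LBINT x. indicator {a..b} x *\<^sub>R deriv \<phi> x) = \<phi> b - \<phi> a"
  proof (rule integral_FTC_atLeastAtMost[OF \<open>a \<le> b\<close>])
    show "(\<phi> has_vector_derivative deriv \<phi> x) (at x within {a..b})" for x
      using assms smooth_has_deriv[of \<phi> x] unfolding smooth_test_fun
      by (metis has_field_derivative_at_within has_real_derivative_iff_has_vector_derivative)
  qed (intro test_fun_continuous test_fun_deriv assms)
  then show "\<phi> b - \<phi> a = (LBINT t:{a..b}. deriv \<phi> t)" by (simp add: set_lebesgue_integral_def)
qed

lemma ac_by_parts:
  assumes "ac F f" "ac G g" "f \<in> L2" "g \<in> L2" "a \<le> b"
  shows "(LBINT x:{a..b}. F x * g x + f x * G x) = F b * G b - F a * G a"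
  using assms unfolding ac_def
  by (intro integration_by_parts_interval L2_set_integrable) (auto simp: diff_eq_eq add.commute)

text \<open>Integration by parts on an interval outside whose interior the test function vanishes,
  so there are no boundary terms.\<close>

lemma ac_weak_deriv:
  assumes F: "ac F w" and w: "w \<in> L2"
  shows "weak_deriv F w"
  unfolding weak_deriv_def
proof (intro allI impI)
  fix \<phi> assume \<phi>: "test_fun \<phi>"
  obtain R where R: "0 < R" "\<And>x. x \<notin> {-R<..<R} \<Longrightarrow> \<phi> x = 0 \<and> deriv \<phi> x = 0"
    using test_fun_support[OF \<phi>] by metis
  note L = test_fun_L2[OF \<phi>] test_fun_L2[OF test_fun_deriv[OF \<phi>]]
  have i1: "integrable lborel (\<lambda>x. F x * deriv \<phi> x)"
    using ac_continuous[OF F w] test_fun_deriv[OF \<phi>]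
    by (intro mult_test_fun_integrable borel_integrable_atLeastAtMost' borel_measurable_continuous_onI)
  have i2: "integrable lborel (\<lambda>x. w x * \<phi> x)" by (rule L2_mult_integrable[OF w L(1)])
  have "(LBINT x. F x * deriv \<phi> x + w x * \<phi> x) = (LBINT x:{-R..R}. F x * deriv \<phi> x + w x * \<phi> x)"
    unfolding set_lebesgue_integral_def
  proof (rule Bochner_Integration.integral_cong[OF refl])
    fix x show "F x * deriv \<phi> x + w x * \<phi> x = indicat_real {- R..R} x *\<^sub>R (F x * deriv \<phi> x + w x * \<phi> x)"
      using R(2)[of x] by (cases "x \<in> {-R<..<R}") auto
  qed
  also have "\<dots> = 0"
    using ac_by_parts[OF F test_fun_ac[OF \<phi>] w L(2), of "-R" R] R by simp
  finally show "(LBINT x. F x * deriv \<phi> x) = - (LBINT x. w x * \<phi> x)"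
    using i1 i2 by simp
qed

text \<open>A primitive \<open>P\<close> of the weak derivative differs from \<open>u\<close> by a
  function with zero weak derivative, which is constant by the du Bois-Reymond lemma.\<close>

lemma H1_ac_representative:
  assumes "u \<in> H1"
  shows "\<exists>F. ac F (wd u) \<and> (AE x in lborel. u x = F x)"
proof -
  note u = H1D[OF assms]
  obtain P where P: "ac P (wd u)" using ac_exists[OF u(2)] by blast
  have Pc: "continuous_on A P" for A using ac_continuous[OF P u(2)] .
  have Pm: "P \<in> borel_measurable borel" using Pc by (rule borel_measurable_continuous_onI)
  have Pi: "set_integrable lborel {a..b} P" for a b using Pc by (rule borel_integrable_atLeastAtMost')
  have "\<exists>c. AE x in lborel. u x - P x = c"
  proof (rule du_Bois_Reymond)
    show "set_integrable lborel {a..b} (\<lambda>x. u x - P x)" for a b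
      using L2_set_integrable[OF u(1)] Pi by (intro set_integral_diff)
    show "(\<lambda>x. u x - P x) \<in> borel_measurable borel" using Pm L2_measurable[OF u(1)] by simp
    fix \<phi> assume \<phi>: "test_fun \<phi>"
    have "(LBINT x. (u x - P x) * deriv \<phi> x) = (LBINT x. u x * deriv \<phi> x) - (LBINT x. P x * deriv \<phi> x)"
      using L2_mult_integrable[OF u(1) test_fun_L2[OF test_fun_deriv[OF \<phi>]]]
        mult_test_fun_integrable[OF Pi test_fun_deriv[OF \<phi>] Pm] by (simp add: left_diff_distrib)
    then show "(LBINT x. (u x - P x) * deriv \<phi> x) = 0"
      using u(3) ac_weak_deriv[OF P u(2)] \<phi> by (simp add: weak_deriv_def)
  qed
  then obtain c where c: "AE x in lborel. u x - P x = c" by blast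
  have "ac (\<lambda>x. P x + c) (wd u)" using P by (simp add: ac_def)
  moreover have "AE x in lborel. u x = P x + c" using c by eventually_elim simp
  ultimately show ?thesis by blast
qed

lemma ac_H1:
  assumes "ac F w" "w \<in> L2" "F \<in> L2"
  shows "F \<in> H1" "AE x in lborel. wd F x = w x"
  using wd_AE_eq[OF assms(3,2) ac_weak_deriv[OF assms(1,2)]] .

lemma test_fun_H1:
  assumes "test_fun \<phi>"
  shows "\<phi> \<in> H1" "AE x in lborel. wd \<phi> x = deriv \<phi> x"
  using ac_H1[OF test_fun_ac[OF assms] test_fun_L2[OF test_fun_deriv[OF assms]] test_fun_L2[OF assms]] .

text \<open>The set of disagreement is open, and a nonempty open set is not negligible.\<close>

lemma continuous_AE_eq:
  fixes f g :: "real \<Rightarrow> real"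
  assumes "continuous_on UNIV f" "continuous_on UNIV g" "AE x in lborel. f x = g x"
  shows "f = g"
proof -
  have op: "open {x. f x \<noteq> g x}" using assms(1,2) by (rule open_Collect_neq)
  have "{x. f x \<noteq> g x} \<in> null_sets lborel"
    using assms(3) op by (subst (asm) AE_iff_null_sets[symmetric] | simp add: AE_iff_null)+
  then have "negligible {x. f x \<noteq> g x}"
    by (simp add: negligible_iff_null_sets null_sets_completionI)
  then have "{x. f x \<noteq> g x} = {}" using open_not_negligible[OF op] by blast
  then show ?thesis by auto
qed

lemma H1_continuous_ac:
  assumes "u \<in> H1" "continuous_on UNIV u"
  shows "ac u (wd u)"
proof -
  obtain F where F: "ac F (wd u)" "AE x in lborel. u x = F x" using H1_ac_representative[OF assms(1)] by blast
  have "u = F" using assms(2) ac_continuous[OF F(1) H1D(2)[OF assms(1)]] F(2) by (rule continuous_AE_eq)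
  then show ?thesis using F by simp
qed

text \<open>Average u x = u y - (u y - u x) over y in [x, x+1], an interval of length one: the mean
  of \<open>u\<close> is controlled by its \<open>L2\<close> norm, the oscillation by the Hoelder
  bound.\<close>

lemma H1_sup_bound:
  assumes "u \<in> H1" "continuous_on UNIV u"
  shows "\<bar>u x\<bar> \<le> sqrt (sqint u) + sqrt (sqint (wd u))"
proof -
  note u = H1D[OF assms(1)]
  let ?W = "sqrt (sqint (wd u))"
  have i: "set_integrable lborel {x..x+1} u" "set_integrable lborel {x..x+1} (\<lambda>y. u x)"
    "set_integrable lborel {x..x+1} (\<lambda>y. ?W)"
    using L2_set_integrable[OF u(1)] by (auto intro!: borel_integrable_atLeastAtMost')
  have c: "(LBINT y:{x..x+1}. c) = c" for c :: real
    by (simp add: set_lebesgue_integral_def)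
  have "\<bar>LBINT y:{x..x+1}. u y - u x\<bar> \<le> (LBINT y:{x..x+1}. \<bar>u y - u x\<bar>)"
    using set_integral_norm_bound[OF set_integral_diff(1)[OF i(1,2)]] by simp
  also have "\<dots> \<le> (LBINT y:{x..x+1}. ?W)"
  proof (rule set_integral_mono)
    fix y assume y: "y \<in> {x..x+1}"
    have "\<bar>u y - u x\<bar> \<le> sqrt (\<bar>y - x\<bar> * sqint (wd u))"
      by (rule ac_Hoelder[OF H1_continuous_ac[OF assms] u(2)])
    also have "\<dots> \<le> sqrt (1 * sqint (wd u))"
      using y by (intro real_sqrt_le_mono mult_right_mono) auto
    finally show "\<bar>u y - u x\<bar> \<le> ?W" by simp
  qed (use set_integrable_abs[OF set_integral_diff(1)[OF i(1,2)]] i in auto)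
  finally have "\<bar>LBINT y:{x..x+1}. u y - u x\<bar> \<le> ?W" by (simp add: c)
  moreover have "(LBINT y:{x..x+1}. u y - u x) = (LBINT y:{x..x+1}. u y) - u x"
    using set_integral_diff(2)[OF i(1,2)] by (simp add: c)
  moreover have "\<bar>LBINT y:{x..x+1}. u y\<bar> \<le> sqrt (sqint u)"
    using L2_interval_bound[OF u(1), of x "x+1"] by simp
  ultimately show ?thesis by linarith
qed

lemma inner_beta_integrable:
  assumes "u \<in> H1" "v \<in> H1"
  shows "integrable lborel (\<lambda>x. u x * v x)" "integrable lborel (\<lambda>x. wd u x * wd v x)"
  using assms H1D L2_mult_integrable by blast+

text \<open>\<open>wd\<close> is a choice, so two representatives of one class may be given
  derivatives that differ on a null set; the integrals agree nevertheless.\<close>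

lemma inner_beta_AE_cong:
  assumes "u \<in> H1" "u' \<in> H1" "v \<in> H1" "v' \<in> H1" "AE x in lborel. u x = u' x" "AE x in lborel. v x = v' x"
  shows "inner_beta \<beta> u v = inner_beta \<beta> u' v'"
proof -
  note m = assms(1-4)[THEN H1D(1), THEN L2_measurable] assms(1-4)[THEN H1D(2), THEN L2_measurable]
  have "AE x in lborel. wd u' x = wd u x" "AE x in lborel. wd v' x = wd v x"
    using H1_AE_cong(2) assms m by blast+
  then have "AE x in lborel. wd u x * wd v x = wd u' x * wd v' x" by eventually_elim simp
  then have "(LBINT x. wd u x * wd v x) = (LBINT x. wd u' x * wd v' x)"
    using m by (intro integral_cong_AE) auto
  moreover have "AE x in lborel. u x * v x = u' x * v' x" using assms(5,6) by eventually_elim simp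
  then have "(LBINT x. u x * v x) = (LBINT x. u' x * v' x)"
    using m by (intro integral_cong_AE) auto
  ultimately show ?thesis by (simp add: inner_beta_def)
qed

text \<open>Every class in \<open>H\<^sup>1\<close> has exactly one continuous representative, so on this type equality almost
  everywhere is equality.\<close>

typedef h1 = "{u \<in> H1. continuous_on UNIV u}"
proof -
  have "ac (\<lambda>x. 0) (\<lambda>x. 0)" by (simp add: ac_def set_lebesgue_integral_def)
  then show ?thesis using ac_H1(1)[OF _ L2_zero L2_zero] by (intro exI[of _ "\<lambda>x. 0"]) simp
qed

setup_lifting type_definition_h1

lemma Rep_h1_H1: "Rep_h1 x \<in> H1" and Rep_h1_continuous: "continuous_on UNIV (Rep_h1 x)"
  using Rep_h1[of x] by auto

lemma h1_lincomb_closed: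
  assumes "u \<in> {u \<in> H1. continuous_on UNIV u}" "v \<in> {u \<in> H1. continuous_on UNIV u}"
  shows "(\<lambda>x. c * u x + d * v x) \<in> {u \<in> H1. continuous_on UNIV u}"
  using assms H1_lincomb(1)[of u v c d] by (simp add: continuous_on_add continuous_on_mult_left)

instantiation h1 :: real_vector
begin

lift_definition zero_h1 :: h1 is "\<lambda>x. 0"
  using h1_lincomb_closed[OF Rep_h1[of undefined] Rep_h1[of undefined], of 0 0] by simp

lift_definition plus_h1 :: "h1 \<Rightarrow> h1 \<Rightarrow> h1" is "\<lambda>u v x. u x + v x"
  using h1_lincomb_closed[of _ _ 1 1] by simp

lift_definition minus_h1 :: "h1 \<Rightarrow> h1 \<Rightarrow> h1" is "\<lambda>u v x. u x - v x"
  using h1_lincomb_closed[of _ _ 1 "-1"] by simp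

lift_definition uminus_h1 :: "h1 \<Rightarrow> h1" is "\<lambda>u x. - u x"
  using h1_lincomb_closed[of _ _ "-1" 0] by simp

lift_definition scaleR_h1 :: "real \<Rightarrow> h1 \<Rightarrow> h1" is "\<lambda>c u x. c * u x"
  using h1_lincomb_closed[of _ _ _ 0] by simp

instance
  by intro_classes (transfer; simp add: fun_eq_iff algebra_simps)+

end

lemmas h1_rep_simps = zero_h1.rep_eq plus_h1.rep_eq minus_h1.rep_eq uminus_h1.rep_eq scaleR_h1.rep_eq

lemma h1_representative:
  assumes "u \<in> H1"
  shows "\<exists>x. AE t in lborel. u t = Rep_h1 x t"
proof -
  obtain F where F: "ac F (wd u)" "AE x in lborel. u x = F x" using H1_ac_representative[OF assms] by blast
  have c: "continuous_on UNIV F" using ac_continuous[OF F(1) H1D(2)[OF assms]] .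
  then have "F \<in> H1" using H1_AE_cong(1)[OF assms _ F(2)] borel_measurable_continuous_onI by blast
  then have "Rep_h1 (Abs_h1 F) = F" using c by (simp add: Abs_h1_inverse)
  then show ?thesis using F(2) by metis
qed

lemma h1_eqI:
  assumes "AE t in lborel. Rep_h1 x t = Rep_h1 y t"
  shows "x = y"
  using continuous_AE_eq[OF Rep_h1_continuous Rep_h1_continuous assms] by (simp add: Rep_h1_inject)

section \<open>The inner products on the space of continuous representatives\<close>

definition hG :: "real \<Rightarrow> h1 \<Rightarrow> h1 \<Rightarrow> real" where
  "hG \<beta> x y = inner_beta \<beta> (Rep_h1 x) (Rep_h1 y)"

lemma wd_plus: "AE t in lborel. wd (Rep_h1 (x + y)) t = wd (Rep_h1 x) t + wd (Rep_h1 y) t"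
  using H1_lincomb(2)[OF Rep_h1_H1 Rep_h1_H1, of 1 x 1 y] by (simp add: h1_rep_simps)

lemma wd_minus: "AE t in lborel. wd (Rep_h1 (x - y)) t = wd (Rep_h1 x) t - wd (Rep_h1 y) t"
  using H1_lincomb(2)[OF Rep_h1_H1 Rep_h1_H1, of 1 x "-1" y] by (simp add: h1_rep_simps)

lemma wd_scale: "AE t in lborel. wd (Rep_h1 (c *\<^sub>R x)) t = c * wd (Rep_h1 x) t"
  using H1_lincomb(2)[OF Rep_h1_H1 Rep_h1_H1, of c x 0 x] by (simp add: h1_rep_simps)

lemma Rep_h1_L2: "Rep_h1 x \<in> L2" and wd_Rep_h1_L2: "wd (Rep_h1 x) \<in> L2"
  using H1D Rep_h1_H1 by blast+

lemma Rep_h1_measurable [measurable]: "Rep_h1 x \<in> borel_measurable borel"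
  and wd_Rep_h1_measurable [measurable]: "wd (Rep_h1 x) \<in> borel_measurable borel"
  using Rep_h1_L2 wd_Rep_h1_L2 L2_measurable by blast+

lemma sym_form_hG: "sym_form (hG \<beta>)"
proof
  fix x y z :: h1 and c :: real
  note i = inner_beta_integrable[OF Rep_h1_H1 Rep_h1_H1]
  have "(LBINT t. wd (Rep_h1 (x + y)) t * wd (Rep_h1 z) t) =
     (LBINT t. wd (Rep_h1 x) t * wd (Rep_h1 z) t + wd (Rep_h1 y) t * wd (Rep_h1 z) t)"
    using wd_plus[of x y] by (intro integral_cong_AE) (auto simp: algebra_simps)
  then show "hG \<beta> (x + y) z = hG \<beta> x z + hG \<beta> y z"
    using i by (simp add: hG_def inner_beta_def h1_rep_simps algebra_simps)
  have "(LBINT t. wd (Rep_h1 (c *\<^sub>R x)) t * wd (Rep_h1 y) t) =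
     (LBINT t. c * (wd (Rep_h1 x) t * wd (Rep_h1 y) t))"
    using wd_scale[of c x] by (intro integral_cong_AE) (auto simp: algebra_simps)
  then show "hG \<beta> (c *\<^sub>R x) y = c * hG \<beta> x y"
    using i by (simp add: hG_def inner_beta_def h1_rep_simps algebra_simps)
  show "hG \<beta> x y = hG \<beta> y x" by (simp add: hG_def inner_beta_def mult.commute)
qed

lemma hG_self: "hG \<beta> x x = sqint (wd (Rep_h1 x)) + \<beta> * sqint (Rep_h1 x)"
  by (simp add: hG_def inner_beta_def power2_eq_square)

text \<open>A Cauchy sequence for \<open>hG \<beta>\<close> is Cauchy in \<open>L2\<close> together
  with its weak derivatives. The two limits remain tied as function and weak derivative, because the
  defining integrals converge, and the limit function is then replaced by its continuous
  representative.\<close>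

lemma hilbert_form_hG:
  assumes \<beta>: "0 < \<beta>"
  shows "hilbert_form (hG \<beta>)"
proof (intro hilbert_form.intro sym_form_hG hilbert_form_axioms.intro)
  fix x :: h1 assume "x \<noteq> 0"
  have "sqint (Rep_h1 x) \<noteq> 0"
  proof
    assume "sqint (Rep_h1 x) = 0"
    then have "AE t in lborel. Rep_h1 x t = Rep_h1 0 t"
      using L2_norm_zero_iff[OF Rep_h1_L2] by (simp add: h1_rep_simps)
    then show False using h1_eqI \<open>x \<noteq> 0\<close> by blast
  qed
  moreover have "0 \<le> sqint (Rep_h1 x)" by simp
  ultimately have "0 < sqint (Rep_h1 x)" by linarith
  then show "0 < hG \<beta> x x" unfolding hG_self using \<beta> by (intro add_nonneg_pos mult_pos_pos) auto
next
  fix x :: "nat \<Rightarrow> h1"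
  assume C: "\<And>e. 0 < e \<Longrightarrow> \<exists>N. \<forall>m\<ge>N. \<forall>n\<ge>N. hG \<beta> (x m - x n) (x m - x n) < e"
  define u where "u n = Rep_h1 (x n)" for n
  define w where "w n = wd (u n)" for n
  have L: "u n \<in> L2" "w n \<in> L2" for n using Rep_h1_L2 wd_Rep_h1_L2 by (auto simp: u_def w_def)
  have diff: "hG \<beta> (x m - x n) (x m - x n) = (LBINT t. (w m t - w n t)\<^sup>2) + \<beta> * (LBINT t. (u m t - u n t)\<^sup>2)" for m n
  proof -
    have "sqint (wd (Rep_h1 (x m - x n))) = (LBINT t. (w m t - w n t)\<^sup>2)"
      using wd_minus[of "x m" "x n"] unfolding w_def u_def by (intro integral_cong_AE) auto
    then show ?thesis by (simp add: hG_self u_def h1_rep_simps)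
  qed
  have "\<exists>g\<in>L2. (\<lambda>n. LBINT t. (u n t - g t)\<^sup>2) \<longlonglongrightarrow> 0"
  proof (rule L2_complete[OF L(1)])
    fix e :: real assume "0 < e"
    then obtain N where N: "\<forall>m\<ge>N. \<forall>n\<ge>N. hG \<beta> (x m - x n) (x m - x n) < \<beta> * e" using C[of "\<beta> * e"] \<beta> by auto
    have "(LBINT t. (u m t - u n t)\<^sup>2) < e" if "N \<le> m" "N \<le> n" for m n
    proof -
      have "\<beta> * (LBINT t. (u m t - u n t)\<^sup>2) < \<beta> * e"
      proof -
        have "0 \<le> (LBINT t. (w m t - w n t)\<^sup>2)" by simp
        moreover have "hG \<beta> (x m - x n) (x m - x n) < \<beta> * e" using N that by blast
        ultimately show ?thesis using diff[of m n] by linarith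
      qed
      then show ?thesis using \<beta> by simp
    qed
    then show "\<exists>N. \<forall>m\<ge>N. \<forall>n\<ge>N. (LBINT t. (u m t - u n t)\<^sup>2) < e" by blast
  qed
  then obtain g where g: "g \<in> L2" "(\<lambda>n. LBINT t. (u n t - g t)\<^sup>2) \<longlonglongrightarrow> 0" by blast
  have "\<exists>g\<in>L2. (\<lambda>n. LBINT t. (w n t - g t)\<^sup>2) \<longlonglongrightarrow> 0"
  proof (rule L2_complete[OF L(2)])
    fix e :: real assume "0 < e"
    then obtain N where N: "\<forall>m\<ge>N. \<forall>n\<ge>N. hG \<beta> (x m - x n) (x m - x n) < e" using C[of e] by auto
    have "(LBINT t. (w m t - w n t)\<^sup>2) < e" if "N \<le> m" "N \<le> n" for m n
    proof -
      have "0 \<le> \<beta> * (LBINT t. (u m t - u n t)\<^sup>2)" using \<beta> by (intro mult_nonneg_nonneg) auto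
      moreover have "hG \<beta> (x m - x n) (x m - x n) < e" using N that by blast
      ultimately show ?thesis using diff[of m n] by linarith
    qed
    then show "\<exists>N. \<forall>m\<ge>N. \<forall>n\<ge>N. (LBINT t. (w m t - w n t)\<^sup>2) < e" by blast
  qed
  then obtain z where z: "z \<in> L2" "(\<lambda>n. LBINT t. (w n t - z t)\<^sup>2) \<longlonglongrightarrow> 0" by blast
  have "weak_deriv g z"
    unfolding weak_deriv_def
  proof (intro allI impI)
    fix \<phi> assume \<phi>: "test_fun \<phi>"
    have lim: "(\<lambda>n. LBINT t. f n t * \<psi> t) \<longlonglongrightarrow> (LBINT t. h t * \<psi> t)"
      if "\<And>n. f n \<in> L2" "h \<in> L2" "\<psi> \<in> L2" "(\<lambda>n. LBINT t. (f n t - h t)\<^sup>2) \<longlonglongrightarrow> 0"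
      for f h \<psi>
    proof (rule LIM_zero_cancel, rule Lim_null_comparison)
      show "(\<lambda>n. sqrt ((LBINT t. (f n t - h t)\<^sup>2) * sqint \<psi>)) \<longlonglongrightarrow> 0"
        using tendsto_real_sqrt[OF tendsto_mult_right[OF that(4), of "LBINT t. (\<psi> t)\<^sup>2"]] by simp
      have "norm ((LBINT t. f n t * \<psi> t) - (LBINT t. h t * \<psi> t)) \<le>
        sqrt ((LBINT t. (f n t - h t)\<^sup>2) * sqint \<psi>)" for n
      proof -
        have "(LBINT t. f n t * \<psi> t) - (LBINT t. h t * \<psi> t) = (LBINT t. (f n t - h t) * \<psi> t)"
          using L2_mult_integrable[OF that(1,3)] L2_mult_integrable[OF that(2,3)] by (simp add: left_diff_distrib)
        then show ?thesis using L2_Cauchy_Schwarz[OF L2_diff[OF that(1,2)] that(3)] by (simp add: real_le_rsqrt)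
      qed
      then show "\<forall>\<^sub>F n in sequentially. norm ((LBINT t. f n t * \<psi> t) - (LBINT t. h t * \<psi> t)) \<le>
        sqrt ((LBINT t. (f n t - h t)\<^sup>2) * sqint \<psi>)" by simp
    qed
    have "(\<lambda>n. LBINT t. u n t * deriv \<phi> t) \<longlonglongrightarrow> (LBINT t. g t * deriv \<phi> t)"
      by (rule lim[OF L(1) g(1) test_fun_L2[OF test_fun_deriv[OF \<phi>]] g(2)])
    moreover have "(LBINT t. u n t * deriv \<phi> t) = - (LBINT t. w n t * \<phi> t)" for n
      using H1D(3)[OF Rep_h1_H1[of "x n"]] \<phi> by (simp add: u_def w_def weak_deriv_def)
    moreover have "(\<lambda>n. - (LBINT t. w n t * \<phi> t)) \<longlonglongrightarrow> - (LBINT t. z t * \<phi> t)"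
      by (intro tendsto_minus lim[OF L(2) z(1) test_fun_L2[OF \<phi>] z(2)])
    ultimately show "(LBINT t. g t * deriv \<phi> t) = - (LBINT t. z t * \<phi> t)"
      using LIMSEQ_unique by simp
  qed
  then have gH: "g \<in> H1" "AE t in lborel. wd g t = z t" using wd_AE_eq g(1) z(1) by auto
  then obtain l where l: "AE t in lborel. g t = Rep_h1 l t" using h1_representative by blast
  have "AE t in lborel. wd (Rep_h1 l) t = wd g t" using H1_AE_cong(2)[OF gH(1) _ l] by simp
  then have l': "AE t in lborel. z t = wd (Rep_h1 l) t" using gH(2) by eventually_elim simp
  have [measurable]: "g \<in> borel_measurable borel" "z \<in> borel_measurable borel" using g z L2_measurable by auto
  have "hG \<beta> (x n - l) (x n - l) = (LBINT t. (w n t - z t)\<^sup>2) + \<beta> * (LBINT t. (u n t - g t)\<^sup>2)" for n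
  proof -
    have "sqint (wd (Rep_h1 (x n - l))) = (LBINT t. (w n t - z t)\<^sup>2)"
      using wd_minus[of "x n" l] l' unfolding w_def u_def by (intro integral_cong_AE) auto
    moreover have "sqint (Rep_h1 (x n - l)) = (LBINT t. (u n t - g t)\<^sup>2)"
      using l unfolding u_def by (intro integral_cong_AE) (auto simp: h1_rep_simps)
    ultimately show ?thesis by (simp add: hG_self)
  qed
  moreover have "(\<lambda>n. (LBINT t. (w n t - z t)\<^sup>2) + \<beta> * (LBINT t. (u n t - g t)\<^sup>2)) \<longlonglongrightarrow> 0 + \<beta> * 0"
    by (intro tendsto_intros g z)
  ultimately show "\<exists>l. (\<lambda>n. hG \<beta> (x n - l) (x n - l)) \<longlonglongrightarrow> 0"
    by (intro exI[of _ l]) simp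
qed

section \<open>The potential form\<close>

definition hB :: "(real \<Rightarrow> real) \<Rightarrow> h1 \<Rightarrow> h1 \<Rightarrow> real" where
  "hB V x y = (LBINT t. V t * Rep_h1 x t * Rep_h1 y t)"

lemma h1_pointwise_bound:
  assumes "0 < \<beta>" "hG \<beta> x x \<le> M"
  shows "\<bar>Rep_h1 x t\<bar> \<le> sqrt (M / \<beta>) + sqrt M"
    and "sqint (Rep_h1 x) \<le> M / \<beta>"
    and "sqint (wd (Rep_h1 x)) \<le> M"
proof -
  have n: "0 \<le> sqint (Rep_h1 x)" "0 \<le> sqint (wd (Rep_h1 x))" by simp_all
  have "\<beta> * sqint (Rep_h1 x) \<le> M" using assms n unfolding hG_self by linarith
  then show 1: "sqint (Rep_h1 x) \<le> M / \<beta>" using assms(1) by (simp add: field_simps)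
  have "0 \<le> \<beta> * sqint (Rep_h1 x)" using assms n by simp
  then show 2: "sqint (wd (Rep_h1 x)) \<le> M" using assms unfolding hG_self by linarith
  show "\<bar>Rep_h1 x t\<bar> \<le> sqrt (M / \<beta>) + sqrt M"
    using H1_sup_bound[OF Rep_h1_H1 Rep_h1_continuous, of x t] real_sqrt_le_mono[OF 1] real_sqrt_le_mono[OF 2]
    by linarith
qed

text \<open>The Arzela-Ascoli argument: boundedness gives a subsequence converging at all rationals,
  and the common Hoelder estimate carries convergence to every point.\<close>

lemma h1_bounded_pointwise_convergent_subsequence:
  assumes \<beta>: "0 < \<beta>" and x: "\<And>n. hG \<beta> (x n) (x n) \<le> M"
  shows "\<exists>r :: nat \<Rightarrow> nat. strict_mono r \<and> (\<forall>t. convergent (\<lambda>n. Rep_h1 (x (r n)) t))"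
proof -
  have "0 \<le> hG \<beta> (x 0) (x 0)" using hilbert_form.nonneg[OF hilbert_form_hG[OF \<beta>]] .
  then have M: "0 \<le> M" using x[of 0] by linarith
  obtain r :: "nat \<Rightarrow> nat" where r: "strict_mono r" "\<And>q. q \<in> \<rat> \<Longrightarrow> \<exists>l. (\<lambda>n. Rep_h1 (x (r n)) q) \<longlonglongrightarrow> l"
  proof (rule function_convergent_subsequence[of "\<rat> :: real set" "\<lambda>n. Rep_h1 (x n)"])
    show "countable (\<rat> :: real set)" by (rule countable_rat)
    show "norm (Rep_h1 (x n) q) \<le> sqrt (M / \<beta>) + sqrt M" for n q
      using h1_pointwise_bound(1)[OF \<beta> x] by simp
  qed blast
  have "Cauchy (\<lambda>n. Rep_h1 (x (r n)) t)" for t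
  proof (rule CauchyI)
    fix e :: real assume e: "0 < e"
    \<comment> \<open>Chosen so that \<open>sqrt (d * (M + 1)) = e / 3\<close>; the added 1 covers
      \<open>M = 0\<close>.\<close>
    define d where "d = (e / 3)\<^sup>2 / (M + 1)"
    have d: "0 < d" using e M by (simp add: d_def)
    obtain q where q: "q \<in> \<rat>" "t < q" "q < t + d" using Rats_dense_in_real[of t "t + d"] d by auto
    have close: "\<bar>Rep_h1 (x n) t - Rep_h1 (x n) q\<bar> \<le> e / 3" for n
    proof -
      have "\<bar>Rep_h1 (x n) t - Rep_h1 (x n) q\<bar> \<le> sqrt (\<bar>t - q\<bar> * sqint (wd (Rep_h1 (x n))))"
        by (rule ac_Hoelder[OF H1_continuous_ac[OF Rep_h1_H1 Rep_h1_continuous] wd_Rep_h1_L2])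
      also have "\<dots> \<le> sqrt (d * (M + 1))"
        using q h1_pointwise_bound(3)[OF \<beta> x, of n] d
        by (intro real_sqrt_le_mono mult_mono) auto
      also have "\<dots> = e / 3" using M e by (simp add: d_def)
      finally show ?thesis .
    qed
    have "Cauchy (\<lambda>n. Rep_h1 (x (r n)) q)" using r(2)[OF q(1)] LIMSEQ_imp_Cauchy by blast
    then obtain N where N: "\<forall>m\<ge>N. \<forall>n\<ge>N. norm (Rep_h1 (x (r m)) q - Rep_h1 (x (r n)) q) < e / 3"
      using CauchyD[of _ "e/3"] e by fastforce
    have "norm (Rep_h1 (x (r m)) t - Rep_h1 (x (r n)) t) < e" if "N \<le> m" "N \<le> n" for m n
    proof -
      have "\<bar>Rep_h1 (x (r m)) q - Rep_h1 (x (r n)) q\<bar> < e / 3" using N that by simp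
      then show ?thesis using close[of "r m"] close[of "r n"] unfolding real_norm_def by linarith
    qed
    then show "\<exists>N. \<forall>m\<ge>N. \<forall>n\<ge>N. norm (Rep_h1 (x (r m)) t - Rep_h1 (x (r n)) t) < e" by blast
  qed
  then show ?thesis using r(1) Cauchy_convergent by blast
qed

locale decaying_potential =
  fixes V :: "real \<Rightarrow> real"
  assumes V_meas: "V \<in> borel_measurable borel"
    and V_Linf: "\<exists>M. AE x in lborel. \<bar>V x\<bar> \<le> M"
    and V_decay: "((\<lambda>x. \<bar>V x\<bar>) \<longlongrightarrow> 0) at_infinity"
begin

text \<open>Some essential bound for \<open>\<bar>V\<bar>\<close>, taken strictly positive because
  it is divided by.\<close>

definition Vmax :: real where
  "Vmax = (SOME M. 0 < M \<and> (AE x in lborel. \<bar>V x\<bar> \<le> M))"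

lemma Vmax: "0 < Vmax" "AE x in lborel. \<bar>V x\<bar> \<le> Vmax"
proof -
  obtain M where "AE x in lborel. \<bar>V x\<bar> \<le> M" using V_Linf by blast
  then have "AE x in lborel. \<bar>V x\<bar> \<le> max M 1" by eventually_elim simp
  then have "\<exists>M>0. AE x in lborel. \<bar>V x\<bar> \<le> M" by (intro exI[of _ "max M 1"]) simp
  from someI_ex[OF this] show "0 < Vmax" "AE x in lborel. \<bar>V x\<bar> \<le> Vmax" by (auto simp: Vmax_def)
qed

lemma V_mult_L2: "u \<in> L2 \<Longrightarrow> (\<lambda>t. V t * u t) \<in> L2"
  using L2_mult_bounded[OF _ V_meas Vmax(2)] by blast

lemma V_form_integrable: "u \<in> L2 \<Longrightarrow> v \<in> L2 \<Longrightarrow> integrable lborel (\<lambda>t. V t * u t * v t)"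
  using L2_mult_integrable[OF V_mult_L2] by blast

lemma sym_form_hB: "sym_form (hB V)"
proof
  fix x y z :: h1 and c :: real
  note i = V_form_integrable[OF Rep_h1_L2 Rep_h1_L2]
  show "hB V (x + y) z = hB V x z + hB V y z"
    using i[of x z] i[of y z] by (simp add: hB_def h1_rep_simps algebra_simps)
  have "(LBINT t. V t * (c * Rep_h1 x t) * Rep_h1 y t) = (LBINT t. c * (V t * Rep_h1 x t * Rep_h1 y t))"
    by (simp add: algebra_simps)
  then show "hB V (c *\<^sub>R x) y = c * hB V x y"
    by (simp add: hB_def h1_rep_simps)
  show "hB V x y = hB V y x" by (simp add: hB_def mult.assoc mult.commute[of "Rep_h1 x _"])
qed

lemma hB_bound: "\<bar>hB V x x\<bar> \<le> Vmax * sqint (Rep_h1 x)"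
proof -
  have "\<bar>hB V x x\<bar> \<le> (LBINT t. \<bar>V t * Rep_h1 x t * Rep_h1 x t\<bar>)"
    unfolding hB_def by (rule integral_abs_bound)
  also have "\<dots> \<le> (LBINT t. Vmax * (Rep_h1 x t)\<^sup>2)"
  proof (rule integral_mono_AE)
    show "AE t in lborel. \<bar>V t * Rep_h1 x t * Rep_h1 x t\<bar> \<le> Vmax * (Rep_h1 x t)\<^sup>2"
      using Vmax(2) by eventually_elim (simp add: abs_mult power2_eq_square mult.assoc mult_right_mono)
  qed (use V_form_integrable[OF Rep_h1_L2 Rep_h1_L2] L2_integrable_square[OF Rep_h1_L2] in auto)
  finally show ?thesis by simp
qed

text \<open>Outside [-R, R] the potential is at most \<open>\<epsilon>\<close> and the
  \<open>L2\<close> norms suffice. Inside, \<open>x\<close> and \<open>y\<close> are compared with a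
  reference function \<open>g\<close>, which enters only through its values on the bounded
  interval.\<close>

lemma hB_diff_bound:
  assumes x: "sqint (Rep_h1 x) \<le> K" and y: "sqint (Rep_h1 y) \<le> K"
    and R: "\<And>t. t \<notin> {-R..R} \<Longrightarrow> \<bar>V t\<bar> \<le> \<epsilon>" and \<epsilon>: "0 \<le> \<epsilon>"
    and g: "g \<in> borel_measurable borel" "\<And>t. \<bar>g t\<bar> \<le> C"
  shows "\<bar>hB V (x - y) (x - y)\<bar> \<le> 4 * \<epsilon> * K +
    2 * Vmax * ((LBINT t:{-R..R}. (Rep_h1 x t - g t)\<^sup>2) + (LBINT t:{-R..R}. (Rep_h1 y t - g t)\<^sup>2))"
proof -
  have sq: "(a - b)\<^sup>2 \<le> 2 * a\<^sup>2 + 2 * b\<^sup>2" for a b :: real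
    using zero_le_power2[of "a + b"] unfolding power2_diff power2_sum by linarith
  have gI: "integrable lborel (\<lambda>t. indicator {-R..R} t * (Rep_h1 z t - g t)\<^sup>2)" for z
  proof -
    have gL: "(\<lambda>t. g t * indicator {-R..R} t) \<in> L2"
      by (rule L2_mult_bounded[OF L2_indicator g(1), of C]) (use g(2) in simp)
    have zL: "(\<lambda>t. indicator {-R..R} t * Rep_h1 z t) \<in> L2"
      by (rule L2_mult_bounded[OF Rep_h1_L2, of _ 1]) (auto simp: indicator_def)
    have "(\<lambda>t. indicator {-R..R} t * Rep_h1 z t - g t * indicator {-R..R} t) \<in> L2"
      by (rule L2_diff[OF zL gL])
    then have "integrable lborel (\<lambda>t. (indicator {-R..R} t * Rep_h1 z t - g t * indicator {-R..R} t)\<^sup>2)"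
      by (rule L2_integrable_square)
    moreover have "(\<lambda>t. (indicator {-R..R} t * Rep_h1 z t - g t * indicator {-R..R} t)\<^sup>2) =
        (\<lambda>t. indicator {-R..R} t * (Rep_h1 z t - g t)\<^sup>2)"
      by (auto simp: indicator_def)
    ultimately show ?thesis by simp
  qed
  note i = L2_integrable_square[OF Rep_h1_L2]
  have "\<bar>hB V (x - y) (x - y)\<bar> \<le> (LBINT t. \<bar>V t * Rep_h1 (x - y) t * Rep_h1 (x - y) t\<bar>)"
    unfolding hB_def by (rule integral_abs_bound)
  also have "\<dots> \<le> (LBINT t. \<epsilon> * (2 * (Rep_h1 x t)\<^sup>2 + 2 * (Rep_h1 y t)\<^sup>2) +
      2 * Vmax * (indicator {-R..R} t * (Rep_h1 x t - g t)\<^sup>2 + indicator {-R..R} t * (Rep_h1 y t - g t)\<^sup>2))"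
  proof (rule integral_mono_AE)
    show "AE t in lborel. \<bar>V t * Rep_h1 (x - y) t * Rep_h1 (x - y) t\<bar> \<le>
      \<epsilon> * (2 * (Rep_h1 x t)\<^sup>2 + 2 * (Rep_h1 y t)\<^sup>2) +
      2 * Vmax * (indicator {-R..R} t * (Rep_h1 x t - g t)\<^sup>2 + indicator {-R..R} t * (Rep_h1 y t - g t)\<^sup>2)"
      using Vmax(2)
    proof eventually_elim
      case (elim t)
      let ?d = "Rep_h1 x t - Rep_h1 y t"
      have e: "\<bar>V t * Rep_h1 (x - y) t * Rep_h1 (x - y) t\<bar> = \<bar>V t\<bar> * ?d\<^sup>2"
        by (simp add: h1_rep_simps abs_mult power2_eq_square)
      show ?case
      proof (cases "t \<in> {-R..R}")
        case True
        have "\<bar>V t\<bar> * ?d\<^sup>2 \<le> Vmax * ?d\<^sup>2" using elim by (intro mult_right_mono) auto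
        also have "\<dots> \<le> Vmax * (2 * (Rep_h1 x t - g t)\<^sup>2 + 2 * (Rep_h1 y t - g t)\<^sup>2)"
          using sq[of "Rep_h1 x t - g t" "Rep_h1 y t - g t"] Vmax(1) by (intro mult_left_mono) auto
        also have "\<dots> \<le> \<epsilon> * (2 * (Rep_h1 x t)\<^sup>2 + 2 * (Rep_h1 y t)\<^sup>2) +
           Vmax * (2 * (Rep_h1 x t - g t)\<^sup>2 + 2 * (Rep_h1 y t - g t)\<^sup>2)"
          using \<epsilon> by simp
        finally show ?thesis unfolding e using True by (simp add: algebra_simps)
      next
        case False
        have "\<bar>V t\<bar> * ?d\<^sup>2 \<le> \<epsilon> * (2 * (Rep_h1 x t)\<^sup>2 + 2 * (Rep_h1 y t)\<^sup>2)"
          using R[OF False] \<epsilon> sq by (intro mult_mono) auto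
        then show ?thesis unfolding e using False by simp
      qed
    qed
  qed (use V_form_integrable[OF Rep_h1_L2 Rep_h1_L2] i gI in auto)
  also have "\<dots> = \<epsilon> * (2 * sqint (Rep_h1 x) + 2 * sqint (Rep_h1 y)) +
    2 * Vmax * ((LBINT t:{-R..R}. (Rep_h1 x t - g t)\<^sup>2) + (LBINT t:{-R..R}. (Rep_h1 y t - g t)\<^sup>2))"
    using i gI by (simp add: set_lebesgue_integral_def)
  also have "\<epsilon> * (2 * sqint (Rep_h1 x) + 2 * sqint (Rep_h1 y)) \<le> \<epsilon> * (2 * K + 2 * K)"
    using x y \<epsilon> by (intro mult_left_mono) auto
  finally show ?thesis by (simp add: algebra_simps)
qed

text \<open>Decay of \<open>V\<close> handles the tails, dominated convergence a bounded interval.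
  The pointwise limit \<open>g\<close> is merely bounded and measurable; no convergence in
  \<open>h1\<close> is asserted.\<close>

lemma hB_compact:
  assumes \<beta>: "0 < \<beta>" and x: "\<And>n. hG \<beta> (x n) (x n) \<le> M"
  shows "\<exists>r :: nat \<Rightarrow> nat. strict_mono r \<and>
    (\<forall>e>0. \<exists>N. \<forall>m\<ge>N. \<forall>n\<ge>N. \<bar>hB V (x (r m) - x (r n)) (x (r m) - x (r n))\<bar> < e)"
proof -
  obtain r :: "nat \<Rightarrow> nat" where r: "strict_mono r" "\<And>t. convergent (\<lambda>n. Rep_h1 (x (r n)) t)"
    using h1_bounded_pointwise_convergent_subsequence[of \<beta> x M] \<beta> x by blast
  define u where "u n = Rep_h1 (x (r n))" for n
  define g where "g t = lim (\<lambda>n. u n t)" for t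
  define C where "C = sqrt (M / \<beta>) + sqrt M"
  have [measurable]: "u n \<in> borel_measurable borel" for n by (simp add: u_def)
  have gm [measurable]: "g \<in> borel_measurable borel" unfolding g_def by measurable
  have ug: "(\<lambda>n. u n t) \<longlonglongrightarrow> g t" for t
    using r(2)[of t] by (simp add: g_def u_def convergent_LIMSEQ_iff)
  have uC: "\<bar>u n t\<bar> \<le> C" for n t using h1_pointwise_bound(1)[OF \<beta> x] by (simp add: u_def C_def)
  have gC: "\<bar>g t\<bar> \<le> C" for t
    using LIMSEQ_le_const2[OF tendsto_rabs[OF ug[of t]]] uC by blast
  have lim: "(\<lambda>n. LBINT t:{-R..R}. (u n t - g t)\<^sup>2) \<longlonglongrightarrow> 0" for R
  proof -
    have "(\<lambda>n. LBINT t. indicator {-R..R} t *\<^sub>R (u n t - g t)\<^sup>2) \<longlonglongrightarrow> (LINT t|(lborel :: real measure). (0::real))"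
    proof (rule integral_dominated_convergence)
      show "integrable lborel (\<lambda>t. indicator {-R..R} t * (2 * C)\<^sup>2)"
        using borel_integrable_atLeastAtMost'[of "-R" R "\<lambda>t. (2 * C)\<^sup>2"] by (simp add: set_integrable_def)
      show "AE t in lborel. (\<lambda>n. indicator {-R..R} t *\<^sub>R (u n t - g t)\<^sup>2) \<longlonglongrightarrow> 0"
      proof (rule AE_I2)
        fix t
        have "(\<lambda>n. indicator {-R..R} t *\<^sub>R (u n t - g t)\<^sup>2) \<longlonglongrightarrow> indicator {-R..R} t *\<^sub>R (g t - g t)\<^sup>2"
          by (intro tendsto_intros ug)
        then show "(\<lambda>n. indicator {-R..R} t *\<^sub>R (u n t - g t)\<^sup>2) \<longlonglongrightarrow> 0" by simp
      qed
      show "AE t in lborel. norm (indicator {-R..R} t *\<^sub>R (u n t - g t)\<^sup>2) \<le> indicator {-R..R} t * (2 * C)\<^sup>2" for n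
      proof (rule AE_I2)
        fix t
        have "\<bar>u n t - g t\<bar> \<le> \<bar>2 * C\<bar>" using uC[of n t] gC[of t] by linarith
        then have "(u n t - g t)\<^sup>2 \<le> (2 * C)\<^sup>2" by (simp only: abs_le_square_iff)
        then show "norm (indicator {-R..R} t *\<^sub>R (u n t - g t)\<^sup>2) \<le> indicator {-R..R} t * (2 * C)\<^sup>2"
          by (simp add: indicator_def)
      qed
    qed auto
    then show ?thesis by (simp add: set_lebesgue_integral_def)
  qed
  have "\<exists>N. \<forall>m\<ge>N. \<forall>n\<ge>N. \<bar>hB V (x (r m) - x (r n)) (x (r m) - x (r n))\<bar> < e" if e: "0 < e" for e
  proof -
    have "0 \<le> hG \<beta> (x 0) (x 0)" using hilbert_form.nonneg[OF hilbert_form_hG[OF \<beta>]] .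
    then have M: "0 \<le> M" using x[of 0] by linarith
    \<comment> \<open>The tail contributes at most e/4 by the choice of \<open>\<epsilon>\<close>,
      the interval 2 \<open>Vmax\<close> times two terms below e/(16 \<open>Vmax\<close>), again
      e/4. The 1 in \<open>k\<close> covers \<open>M = 0\<close>.\<close>
    define k where "k = M / \<beta> + 1"
    have k: "0 < k" "M / \<beta> \<le> k" using M \<beta> by (simp_all add: k_def add_nonneg_pos)
    define \<epsilon> where "\<epsilon> = e / (16 * k)"
    have \<epsilon>: "0 < \<epsilon>" using e k by (simp add: \<epsilon>_def)
    have "4 * \<epsilon> * (M / \<beta>) \<le> 4 * \<epsilon> * k" using \<epsilon> k by (intro mult_left_mono) auto
    also have "\<dots> = e / 4" using k(1) by (simp add: \<epsilon>_def)
    finally have \<epsilon>K: "4 * \<epsilon> * (M / \<beta>) \<le> e / 4" .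
    have "eventually (\<lambda>t. \<bar>V t\<bar> < \<epsilon>) at_infinity"
      using order_tendstoD(2)[OF V_decay \<epsilon>] by simp
    then obtain R where R: "\<And>t. R \<le> \<bar>t\<bar> \<Longrightarrow> \<bar>V t\<bar> < \<epsilon>" by (auto simp: eventually_at_infinity)
    have RV: "\<bar>V t\<bar> \<le> \<epsilon>" if "t \<notin> {-R..R}" for t
    proof -
      have "R \<le> \<bar>t\<bar>" using that by auto
      then show ?thesis using R less_imp_le by blast
    qed
    have "0 < e / (16 * Vmax)" using e Vmax(1) by simp
    from LIMSEQ_D[OF lim[of R] this]
    obtain N where N: "\<And>n. N \<le> n \<Longrightarrow> (LBINT t:{-R..R}. (u n t - g t)\<^sup>2) < e / (16 * Vmax)"
      by (auto simp: abs_less_iff)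
    have "\<bar>hB V (x (r m) - x (r n)) (x (r m) - x (r n))\<bar> < e" if "N \<le> m" "N \<le> n" for m n
    proof -
      have "\<bar>hB V (x (r m) - x (r n)) (x (r m) - x (r n))\<bar> \<le> 4 * \<epsilon> * (M / \<beta>) +
        2 * Vmax * ((LBINT t:{-R..R}. (Rep_h1 (x (r m)) t - g t)\<^sup>2) + (LBINT t:{-R..R}. (Rep_h1 (x (r n)) t - g t)\<^sup>2))"
        by (rule hB_diff_bound[OF _ _ RV _ gm gC]) (use h1_pointwise_bound(2)[OF \<beta> x] \<epsilon> in auto)
      also have "\<dots> \<le> e / 4 + 2 * Vmax * (e / (16 * Vmax) + e / (16 * Vmax))"
        using \<epsilon>K N[OF that(1)] N[OF that(2)] Vmax(1) unfolding u_def
        by (intro add_mono mult_left_mono) auto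
      also have "\<dots> = e / 2" using Vmax(1) by (simp add: field_simps)
      also have "\<dots> < e" using e by simp
      finally show ?thesis .
    qed
    then show ?thesis by blast
  qed
  then show ?thesis using r(1) by blast
qed

end

locale potential_form = decaying_potential +
  fixes \<beta> :: real
  assumes \<beta>: "0 < \<beta>"

sublocale potential_form \<subseteq> compact_forms "hG \<beta>" "hB V" "Vmax / \<beta>"
proof -
  interpret hilbert_form "hG \<beta>" by (rule hilbert_form_hG[OF \<beta>])
  interpret B: sym_form "hB V" by (rule sym_form_hB)
  show "compact_forms (hG \<beta>) (hB V) (Vmax / \<beta>)"
  proof
    show "\<bar>hB V x x\<bar> \<le> Vmax / \<beta> * hG \<beta> x x" for x
    proof -
      have "\<bar>hB V x x\<bar> \<le> Vmax * sqint (Rep_h1 x)" by (rule hB_bound)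
      also have "\<dots> \<le> Vmax * (hG \<beta> x x / \<beta>)"
        using Vmax(1) h1_pointwise_bound(2)[OF \<beta> order_refl] by (intro mult_left_mono) auto
      finally show ?thesis by simp
    qed
  qed (rule hB_compact[OF \<beta>])
qed

section \<open>Eigenvectors of \<open>K_beta\<close> as eigenvectors of the pair of forms\<close>

context potential_form
begin

lemma inner_beta_Rep:
  assumes "u \<in> H1" "AE t in lborel. u t = Rep_h1 x t" "v \<in> H1" "AE t in lborel. v t = Rep_h1 y t"
  shows "inner_beta \<beta> u v = hG \<beta> x y"
  unfolding hG_def using assms by (intro inner_beta_AE_cong Rep_h1_H1)

lemma V_form_Rep:
  assumes "u \<in> H1" "AE t in lborel. u t = Rep_h1 x t" "v \<in> H1" "AE t in lborel. v t = Rep_h1 y t"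
  shows "(LBINT t. V t * u t * v t) = hB V x y"
  unfolding hB_def
proof (rule integral_cong_AE)
  show "AE t in lborel. V t * u t * v t = V t * Rep_h1 x t * Rep_h1 y t"
    using assms(2,4) by eventually_elim simp
qed (use assms V_meas H1D(1) L2_measurable in auto)

text \<open>For fixed \<open>x\<close> the functional \<open>hB V x\<close> is bounded with respect
  to \<open>hG \<beta>\<close>, so Riesz representation provides a witness for the choice in
  \<open>K_beta\<close>.\<close>

lemma K_beta_properties:
  assumes u: "u \<in> H1"
  shows "K_beta V \<beta> u \<in> H1"
    "\<And>\<psi>. \<psi> \<in> H1 \<Longrightarrow> inner_beta \<beta> (K_beta V \<beta> u) \<psi> = (LBINT t. V t * u t * \<psi> t)"
proof -
  obtain x where x: "AE t in lborel. u t = Rep_h1 x t" using h1_representative[OF u] by blast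
  have "\<exists>v. \<forall>y. hG \<beta> v y = hB V x y"
  proof (rule Riesz_representation[OF B.linear_right])
    fix y
    let ?I = "LBINT t. (V t * Rep_h1 x t)\<^sup>2"
    have "(hB V x y)\<^sup>2 \<le> ?I * sqint (Rep_h1 y)"
      unfolding hB_def by (rule L2_Cauchy_Schwarz[OF V_mult_L2[OF Rep_h1_L2] Rep_h1_L2])
    also have "\<dots> \<le> ?I * (hG \<beta> y y / \<beta>)"
      using h1_pointwise_bound(2)[OF \<beta> order_refl] by (intro mult_left_mono) auto
    finally show "(hB V x y)\<^sup>2 \<le> ?I / \<beta> * hG \<beta> y y" by simp
  qed
  then obtain v where v: "\<And>y. hG \<beta> v y = hB V x y" by blast
  have "\<exists>v. v \<in> H1 \<and> (\<forall>\<psi>\<in>H1. inner_beta \<beta> v \<psi> = (LBINT t. V t * u t * \<psi> t))"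
  proof (intro exI conjI ballI)
    show "Rep_h1 v \<in> H1" by (rule Rep_h1_H1)
    fix \<psi> assume \<psi>: "\<psi> \<in> H1"
    then obtain y where y: "AE t in lborel. \<psi> t = Rep_h1 y t" using h1_representative by blast
    show "inner_beta \<beta> (Rep_h1 v) \<psi> = (LBINT t. V t * u t * \<psi> t)"
      using inner_beta_Rep[OF Rep_h1_H1 _ \<psi> y, of v v] V_form_Rep[OF u x \<psi> y] v by simp
  qed
  from someI_ex[OF this] show "K_beta V \<beta> u \<in> H1"
    "\<And>\<psi>. \<psi> \<in> H1 \<Longrightarrow> inner_beta \<beta> (K_beta V \<beta> u) \<psi> = (LBINT t. V t * u t * \<psi> t)"
    unfolding K_beta_def by blast+
qed

text \<open>Let \<open>k\<close> be the continuous representative of the image of \<open>u\<close>.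
  Testing against all of \<open>h1\<close> shows that it represents \<open>hB V x\<close>, and
  \<open>k = \<mu> *\<^sub>R x\<close> is then the weak eigenvalue equation, since
  \<open>hG \<beta>\<close> is definite.\<close>

lemma K_eigenspace_iff:
  assumes u: "u \<in> H1" and x: "AE t in lborel. u t = Rep_h1 x t"
  shows "u \<in> K_eigenspace V \<beta> \<mu> \<longleftrightarrow> x \<in> eig \<mu>"
proof -
  note K = K_beta_properties[OF u]
  obtain k where k: "AE t in lborel. K_beta V \<beta> u t = Rep_h1 k t" using h1_representative[OF K(1)] by blast
  have Gk: "hG \<beta> k y = hB V x y" for y
    using K(2)[OF Rep_h1_H1[of y]] inner_beta_Rep[OF K(1) k Rep_h1_H1, of y y] V_form_Rep[OF u x Rep_h1_H1, of y y]
    by simp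
  have "u \<in> K_eigenspace V \<beta> \<mu> \<longleftrightarrow> (AE t in lborel. K_beta V \<beta> u t = \<mu> * u t)"
    using u by (simp add: K_eigenspace_def)
  also have "\<dots> \<longleftrightarrow> (AE t in lborel. Rep_h1 k t = Rep_h1 (\<mu> *\<^sub>R x) t)"
    (is "?l \<longleftrightarrow> ?r")
  proof
    assume ?l
    with k x show ?r by eventually_elim (simp add: h1_rep_simps)
  next
    assume ?r
    with k x show ?l by eventually_elim (simp add: h1_rep_simps)
  qed
  also have "\<dots> \<longleftrightarrow> k = \<mu> *\<^sub>R x" using h1_eqI by auto
  also have "\<dots> \<longleftrightarrow> x \<in> eig \<mu>"
  proof
    assume "k = \<mu> *\<^sub>R x"
    then show "x \<in> eig \<mu>" using Gk by (simp add: eig_def expand flip: Gk)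
  next
    assume "x \<in> eig \<mu>"
    then have "hG \<beta> (k - \<mu> *\<^sub>R x) y = 0" for y using Gk[of y] eigD[of x \<mu> y] by (simp add: expand)
    then have "k - \<mu> *\<^sub>R x = 0" using eq_0_iff by blast
    then show "k = \<mu> *\<^sub>R x" by simp
  qed
  finally show ?thesis .
qed

lemma K_eigenspace_eq: "K_eigenspace V \<beta> \<mu> = {u \<in> H1. \<exists>x\<in>eig \<mu>. AE t in lborel. u t = Rep_h1 x t}"
proof (intro set_eqI iffI)
  fix u assume u: "u \<in> K_eigenspace V \<beta> \<mu>"
  then have "u \<in> H1" by (simp add: K_eigenspace_def)
  moreover from this obtain x where "AE t in lborel. u t = Rep_h1 x t" using h1_representative by blast
  ultimately show "u \<in> {u \<in> H1. \<exists>x\<in>eig \<mu>. AE t in lborel. u t = Rep_h1 x t}"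
    using K_eigenspace_iff u by blast
qed (use K_eigenspace_iff in auto)

lemma K_eigenvalue_iff: "K_eigenvalue V \<beta> \<mu> \<longleftrightarrow> eig \<mu> \<noteq> {0}"
proof
  assume "K_eigenvalue V \<beta> \<mu>"
  then obtain u x where u: "u \<in> H1" "x \<in> eig \<mu>" "AE t in lborel. u t = Rep_h1 x t" "\<not> (AE t in lborel. u t = 0)"
    unfolding K_eigenvalue_def K_eigenspace_eq by blast
  have "x \<noteq> 0"
  proof
    assume "x = 0"
    then have "AE t in lborel. u t = 0" using u(3) by (simp add: h1_rep_simps)
    then show False using u(4) by blast
  qed
  then show "eig \<mu> \<noteq> {0}" using u(2) by blast
next
  assume "eig \<mu> \<noteq> {0}"
  then obtain x where x: "x \<in> eig \<mu>" "x \<noteq> 0" using subspace_0[OF subspace_eig] by blast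
  have "\<not> (AE t in lborel. Rep_h1 x t = 0)" using h1_eqI[of x 0] x(2) by (auto simp: h1_rep_simps)
  moreover have "Rep_h1 x \<in> K_eigenspace V \<beta> \<mu>" unfolding K_eigenspace_eq using x(1) Rep_h1_H1 by auto
  ultimately show "K_eigenvalue V \<beta> \<mu>" unfolding K_eigenvalue_def by blast
qed

end

lemma Rep_h1_sum: "Rep_h1 (\<Sum>i\<in>I. f i) t = (\<Sum>i\<in>I. Rep_h1 (f i) t)"
  by (induction I rule: infinite_finite_induct) (auto simp: h1_rep_simps)

text \<open>\<open>ae_lin_indep\<close> speaks of lists and \<open>independent\<close> of sets;
  repeated entries are the difference, whence \<open>distinct xs\<close>.\<close>

lemma ae_lin_indep_iff:
  assumes len: "length fs = length xs" and rep: "\<And>i. i < length xs \<Longrightarrow> AE t in lborel. (fs ! i) t = Rep_h1 (xs ! i) t"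
  shows "ae_lin_indep fs \<longleftrightarrow> distinct xs \<and> independent (set xs)"
proof -
  have "(AE t in lborel. (\<Sum>i<length fs. c i * (fs ! i) t) = 0) \<longleftrightarrow> (\<Sum>i<length xs. c i *\<^sub>R xs ! i) = 0" for c
  proof -
    have r: "AE t in lborel. \<forall>i\<in>{..<length xs}. (fs ! i) t = Rep_h1 (xs ! i) t"
      using rep by (intro AE_finite_allI) auto
    have e: "Rep_h1 (\<Sum>i<length xs. c i *\<^sub>R xs ! i) t = (\<Sum>i<length xs. c i * Rep_h1 (xs ! i) t)" for t
      by (simp add: Rep_h1_sum h1_rep_simps)
    have "(AE t in lborel. (\<Sum>i<length fs. c i * (fs ! i) t) = 0) \<longleftrightarrow>
        (AE t in lborel. Rep_h1 (\<Sum>i<length xs. c i *\<^sub>R xs ! i) t = Rep_h1 0 t)" (is "?l \<longleftrightarrow> ?r")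
    proof
      assume ?l
      with r show ?r unfolding e len by eventually_elim (simp add: h1_rep_simps)
    next
      assume ?r
      with r show ?l unfolding e len by eventually_elim (simp add: h1_rep_simps)
    qed
    then show ?thesis using h1_eqI by auto
  qed
  then have l: "ae_lin_indep fs \<longleftrightarrow> (\<forall>c. (\<Sum>i<length xs. c i *\<^sub>R xs ! i) = 0 \<longrightarrow> (\<forall>i<length xs. c i = 0))"
    unfolding ae_lin_indep_def len by simp
  show ?thesis
  proof
    assume "ae_lin_indep fs"
    then have ind: "\<And>c i. (\<Sum>i<length xs. c i *\<^sub>R xs ! i) = 0 \<Longrightarrow> i < length xs \<Longrightarrow> c i = 0" using l by blast
    have d: "distinct xs"
    proof (rule ccontr)
      assume "\<not> distinct xs"
      then obtain i j where ij: "i < length xs" "j < length xs" "i \<noteq> j" "xs ! i = xs ! j"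
        by (auto simp: distinct_conv_nth)
      \<comment> \<open>Two equal entries would satisfy the relation with coefficients 1 and
        -1.\<close>
      define c where "c k = (if k = i then 1 else 0) - (if k = j then 1 else (0::real))" for k
      have "(\<Sum>k<length xs. c k *\<^sub>R xs ! k) =
        (\<Sum>k<length xs. (if k = i then 1 else 0) *\<^sub>R xs ! k) - (\<Sum>k<length xs. (if k = j then 1 else 0) *\<^sub>R xs ! k)"
        by (simp add: c_def scaleR_left_diff_distrib sum_subtractf)
      also have "\<dots> = 0" using ij by (simp add: if_distrib[of "\<lambda>c. c *\<^sub>R _"] cong: if_cong)
      finally have "c i = 0" using ind ij by blast
      then show False using ij by (simp add: c_def)
    qed
    moreover have "independent (set xs)"
    proof (rule independent_if_scalars_zero)
      fix f v assume f: "(\<Sum>x\<in>set xs. f x *\<^sub>R x) = 0" and "v \<in> set xs"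
      then obtain i where i: "i < length xs" "v = xs ! i" by (auto simp: in_set_conv_nth)
      have "(\<Sum>i<length xs. f (xs ! i) *\<^sub>R xs ! i) = (\<Sum>x\<in>set xs. f x *\<^sub>R x)"
        using d by (intro sum.reindex_bij_betw[OF bij_betw_nth]) auto
      then show "f v = 0" using ind[of "\<lambda>i. f (xs ! i)"] f i by simp
    qed simp
    ultimately show "distinct xs \<and> independent (set xs)" by blast
  next
    assume di: "distinct xs \<and> independent (set xs)"
    show "ae_lin_indep fs"
      unfolding l
    proof (intro allI impI)
      fix c i assume c: "(\<Sum>i<length xs. c i *\<^sub>R xs ! i) = 0" and i: "i < length xs"
      have bij: "bij_betw ((!) xs) {..<length xs} (set xs)" using di by (intro bij_betw_nth) auto
      define f where "f x = c (inv_into {..<length xs} ((!) xs) x)" for x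
      have fi: "f (xs ! i) = c i" if "i < length xs" for i
        using bij that by (simp add: f_def bij_betw_def inv_into_f_f)
      have "(\<Sum>x\<in>set xs. f x *\<^sub>R x) = (\<Sum>i<length xs. f (xs ! i) *\<^sub>R xs ! i)"
        using sum.reindex_bij_betw[OF bij, of "\<lambda>x. f x *\<^sub>R x"] by simp
      also have "\<dots> = (\<Sum>i<length xs. c i *\<^sub>R xs ! i)" using fi by (intro sum.cong) auto
      finally have "(\<Sum>x\<in>set xs. f x *\<^sub>R x) = 0" using c by simp
      then have "f (xs ! i) = 0"
        using di i independentD[of "set xs" "set xs" f "xs ! i"] by simp
      then show "c i = 0" using fi i by simp
    qed
  qed
qed

context potential_form
begin

text \<open>A basis of \<open>eig \<mu>\<close> attains the supremum. For the upper bound, members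
  of \<open>K_eigenspace\<close> need not be continuous, so \<open>h\<close> passes to
  representatives before dimensions are compared.\<close>

lemma K_mult_eq_dim:
  assumes "\<mu> < 0"
  shows "K_mult V \<beta> \<mu> = dim (eig \<mu>)"
  unfolding K_mult_def
proof (rule cSup_eq_maximum)
  obtain T where T: "finite T" "independent T" "T \<subseteq> eig \<mu>" "eig \<mu> = span T" "card T = dim (eig \<mu>)"
    using eig_basis[OF assms] by metis
  obtain xs where xs: "set xs = T" "distinct xs" using finite_distinct_list[OF T(1)] by blast
  have "ae_lin_indep (map Rep_h1 xs)" using xs T(2) by (subst ae_lin_indep_iff[of _ xs]) auto
  moreover have "set (map Rep_h1 xs) \<subseteq> K_eigenspace V \<beta> \<mu>"
    unfolding K_eigenspace_eq using xs T(3) Rep_h1_H1 by auto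
  moreover have "length (map Rep_h1 xs) = dim (eig \<mu>)" using xs T(5) distinct_card by fastforce
  ultimately show "dim (eig \<mu>) \<in> {k. \<exists>fs. length fs = k \<and> set fs \<subseteq> K_eigenspace V \<beta> \<mu> \<and> ae_lin_indep fs}"
    by blast
  fix k assume "k \<in> {k. \<exists>fs. length fs = k \<and> set fs \<subseteq> K_eigenspace V \<beta> \<mu> \<and> ae_lin_indep fs}"
  then obtain fs where fs: "length fs = k" "set fs \<subseteq> K_eigenspace V \<beta> \<mu>" "ae_lin_indep fs" by blast
  have "\<forall>f\<in>set fs. \<exists>x\<in>eig \<mu>. AE t in lborel. f t = Rep_h1 x t" using fs(2) unfolding K_eigenspace_eq by blast
  then obtain h where h: "\<And>f. f \<in> set fs \<Longrightarrow> h f \<in> eig \<mu> \<and> (AE t in lborel. f t = Rep_h1 (h f) t)" by metis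
  have "distinct (map h fs) \<and> independent (set (map h fs))"
    using fs(3) h by (subst (asm) ae_lin_indep_iff[of _ "map h fs"]) auto
  moreover have "set (map h fs) \<subseteq> span T" using h T(4) by auto
  ultimately have "card (set (map h fs)) \<le> card T" using independent_span_bound[OF T(1)] by blast
  then show "k \<le> dim (eig \<mu>)" using \<open>distinct _ \<and> _\<close> distinct_card[of "map h fs"] fs(1) T(5) by simp
qed

lemma neg_count_eq_dim:
  assumes "t < 0"
  shows "neg_count V \<beta> t = dim (low t)"
proof -
  have "{\<nu>. \<nu> < 0 \<and> \<nu> \<le> t \<and> K_eigenvalue V \<beta> \<nu>} = {\<mu>. \<mu> \<le> t \<and> eig \<mu> \<noteq> {0}}"
    using assms by (auto simp: K_eigenvalue_iff)
  then show ?thesis unfolding neg_count_def dim_low[OF assms]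
    using assms by (intro sum.cong) (auto simp: K_mult_eq_dim)
qed

end

section \<open>Dependence of the eigenvalues on the parameter\<close>

context decaying_potential
begin

text \<open>By \<open>le\<close>, the space \<open>low t1\<close> for \<open>\<beta>1\<close>
  satisfies the form inequality for \<open>\<beta>2\<close> at level \<open>t2\<close>, so its
  dimension is at most the maximal one.\<close>

lemma neg_count_le:
  assumes "0 < \<beta>1" "0 < \<beta>2" "t1 < 0" "t2 < 0"
    and le: "\<And>u. hB V u u \<le> t1 * hG \<beta>1 u u \<Longrightarrow> hB V u u \<le> t2 * hG \<beta>2 u u"
  shows "neg_count V \<beta>1 t1 \<le> neg_count V \<beta>2 t2"
proof -
  interpret P1: potential_form V \<beta>1 by unfold_locales (rule assms(1))
  interpret P2: potential_form V \<beta>2 by unfold_locales (rule assms(2))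
  obtain T where T: "finite T" "independent T" "T \<subseteq> P1.low t1" "card T = dim (P1.low t1)"
    using P1.low_basis[OF assms(3)] by metis
  have "subspace (P1.low t1)" by (simp add: P1.low_def)
  then have "card T \<le> dim (P2.low t2)"
    using P2.card_le_dim_low[OF assms(4) _ T(1-3)] le P1.low_form_le by blast
  then show ?thesis using T(4) P1.neg_count_eq_dim[OF assms(3)] P2.neg_count_eq_dim[OF assms(4)] by simp
qed

lemma hG_mono: "\<beta>1 \<le> \<beta>2 \<Longrightarrow> hG \<beta>1 u u \<le> hG \<beta>2 u u"
  unfolding hG_self by (intro add_left_mono mult_right_mono) auto

lemma hG_scale:
  assumes "0 < \<beta>1" "\<beta>1 \<le> \<beta>2"
  shows "hG \<beta>2 u u \<le> \<beta>2 / \<beta>1 * hG \<beta>1 u u"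
proof -
  have "1 * sqint (wd (Rep_h1 u)) \<le> \<beta>2 / \<beta>1 * sqint (wd (Rep_h1 u))"
    using assms by (intro mult_right_mono) auto
  then show ?thesis unfolding hG_self using assms by (simp add: distrib_left)
qed

lemma neg_count_antimono_beta:
  assumes "0 < \<beta>1" "\<beta>1 \<le> \<beta>2" "t < 0"
  shows "neg_count V \<beta>2 t \<le> neg_count V \<beta>1 t"
proof (rule neg_count_le)
  fix u assume "hB V u u \<le> t * hG \<beta>2 u u"
  also have "\<dots> \<le> t * hG \<beta>1 u u"
    using assms hG_mono by (intro mult_left_mono_neg) auto
  finally show "hB V u u \<le> t * hG \<beta>1 u u" .
qed (use assms in auto)

text \<open>Raising the parameter enlarges \<open>hG\<close> by at most the factor
  \<open>\<beta>2 / \<beta>1\<close>, so it is enough to weaken the negative level by the reciprocal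
  factor.\<close>

lemma neg_count_scale_beta:
  assumes "0 < \<beta>1" "\<beta>1 \<le> \<beta>2" "t < 0"
  shows "neg_count V \<beta>1 t \<le> neg_count V \<beta>2 (\<beta>1 / \<beta>2 * t)"
proof (rule neg_count_le)
  fix u assume "hB V u u \<le> t * hG \<beta>1 u u"
  also have "\<dots> = (\<beta>1 / \<beta>2 * t) * (\<beta>2 / \<beta>1 * hG \<beta>1 u u)" using assms by simp
  also have "\<dots> \<le> (\<beta>1 / \<beta>2 * t) * hG \<beta>2 u u"
    using assms by (intro mult_left_mono_neg hG_scale less_imp_le[OF mult_pos_neg]) auto
  finally show "hB V u u \<le> (\<beta>1 / \<beta>2 * t) * hG \<beta>2 u u" .
next
  show "\<beta>1 / \<beta>2 * t < 0" using assms by (intro mult_pos_neg) auto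
qed (use assms in auto)

end

section \<open>The counting function, its jumps and the numbers \<open>mu\<close>\<close>

context potential_form
begin

text \<open>The count jumps only at eigenvalues, so lowering \<open>t\<close> to the largest
  eigenvalue not above it changes nothing. A positive count guarantees that there is one.\<close>

lemma neg_count_attained:
  assumes "t < 0" "1 \<le> neg_count V \<beta> t"
  shows "\<exists>\<nu>\<le>t. K_eigenvalue V \<beta> \<nu> \<and> neg_count V \<beta> \<nu> = neg_count V \<beta> t"
proof -
  let ?M = "\<lambda>t. {\<mu>. \<mu> \<le> t \<and> eig \<mu> \<noteq> {0}}"
  have fin: "finite (?M t)" by (rule finite_eigenvalues_le[OF assms(1)])
  have "?M t \<noteq> {}"
  proof
    assume "?M t = {}"
    then have "neg_count V \<beta> t = 0" unfolding neg_count_eq_dim[OF assms(1)] dim_low[OF assms(1)] by (simp only: sum.empty)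
    then show False using assms(2) by simp
  qed
  then have \<nu>: "Max (?M t) \<in> ?M t" by (rule Max_in[OF fin])
  have "?M (Max (?M t)) = ?M t" using \<nu> fin by (auto intro: Max_ge)
  then have "neg_count V \<beta> (Max (?M t)) = neg_count V \<beta> t"
    using \<nu> assms(1) by (simp add: neg_count_eq_dim dim_low)
  then show ?thesis using \<nu> K_eigenvalue_iff by blast
qed

text \<open>Every candidate for the infimum can be lowered to an eigenvalue not above a fixed
  \<open>t0 < 0\<close>, and there are finitely many of those; the infimum is a minimum.\<close>

lemma mu_properties:
  assumes j: "j \<in> Nminus_at V \<beta>"
  shows "mu V j \<beta> < 0" "K_eigenvalue V \<beta> (mu V j \<beta>)" "j \<le> neg_count V \<beta> (mu V j \<beta>)"
    and "\<And>t. t < 0 \<Longrightarrow> j \<le> neg_count V \<beta> t \<Longrightarrow> mu V j \<beta> \<le> t"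
proof -
  obtain t0 where t0: "1 \<le> j" "t0 < 0" "j \<le> neg_count V \<beta> t0" using j by (auto simp: Nminus_at_def)
  define A where "A = {\<nu>. \<nu> \<le> t0 \<and> K_eigenvalue V \<beta> \<nu> \<and> j \<le> neg_count V \<beta> \<nu>}"
  have "A \<subseteq> {\<mu>. \<mu> \<le> t0 \<and> eig \<mu> \<noteq> {0}}" by (auto simp: A_def K_eigenvalue_iff)
  then have fin: "finite A" using finite_eigenvalues_le[OF t0(2)] finite_subset by blast
  have att: "\<exists>\<nu>\<in>A. \<nu> \<le> t" if t: "t < 0" "j \<le> neg_count V \<beta> t" "t \<le> t0" for t
  proof -
    have "1 \<le> neg_count V \<beta> t" using t(2) t0(1) by linarith
    from neg_count_attained[OF t(1) this] show ?thesis using t by (auto simp: A_def intro: order_trans)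
  qed
  have ne: "A \<noteq> {}" using att[of t0] t0 by auto
  have minA: "Min A \<in> A" using fin ne by (rule Min_in)
  have le: "Min A \<le> t" if t: "t < 0" "j \<le> neg_count V \<beta> t" for t
  proof (cases "t \<le> t0")
    case True
    then obtain \<nu> where "\<nu> \<in> A" "\<nu> \<le> t" using att t by blast
    then show ?thesis using Min_le[OF fin] by fastforce
  next
    case False
    then show ?thesis using minA by (simp add: A_def)
  qed
  have A0: "Min A < 0" "K_eigenvalue V \<beta> (Min A)" "j \<le> neg_count V \<beta> (Min A)"
    using minA t0(2) unfolding A_def by auto
  have "mu V j \<beta> = Min A" unfolding mu_def
    using A0 le by (intro cInf_eq_minimum) auto
  then show "mu V j \<beta> < 0" "K_eigenvalue V \<beta> (mu V j \<beta>)" "j \<le> neg_count V \<beta> (mu V j \<beta>)"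
    "\<And>t. t < 0 \<Longrightarrow> j \<le> neg_count V \<beta> t \<Longrightarrow> mu V j \<beta> \<le> t"
    using A0 le by auto
qed

text \<open>The index is the whole count up to \<open>\<mu>\<close>, the last one belonging to this
  eigenvalue. At any level below \<open>\<mu>\<close> the count is smaller by at least the
  multiplicity, so \<open>j\<close> is not reached there.\<close>

lemma eigenvalue_is_mu:
  assumes ev: "K_eigenvalue V \<beta> \<mu>" and neg: "\<mu> < 0"
  shows "\<exists>j\<in>Nminus_at V \<beta>. mu V j \<beta> = \<mu>"
proof -
  let ?M = "\<lambda>t. {\<mu>. \<mu> \<le> t \<and> eig \<mu> \<noteq> {0}}"
  define j where "j = neg_count V \<beta> \<mu>"
  have "1 \<le> dim (eig \<mu>)"
  proof -
    obtain T where T: "finite T" "eig \<mu> = span T" "card T = dim (eig \<mu>)" using eig_basis[OF neg] by metis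
    have "T \<noteq> {}" using T(2) ev K_eigenvalue_iff by auto
    then have "0 < card T" using T(1) by (simp add: card_gt_0_iff)
    then show ?thesis using T(3) by linarith
  qed
  have gap: "neg_count V \<beta> t + dim (eig \<mu>) \<le> j" if "t < \<mu>" for t
  proof -
    have "dim (low t) + dim (eig \<mu>) = (\<Sum>\<nu>\<in>insert \<mu> (?M t). dim (eig \<nu>))"
      using that neg finite_eigenvalues_le[of t] by (simp add: dim_low)
    also have "\<dots> \<le> (\<Sum>\<nu>\<in>?M \<mu>. dim (eig \<nu>))"
      using that ev K_eigenvalue_iff finite_eigenvalues_le[OF neg] by (intro sum_mono2) auto
    finally show ?thesis using that neg by (simp add: j_def neg_count_eq_dim dim_low)
  qed
  have "1 \<le> j" using gap[of "\<mu> - 1"] \<open>1 \<le> dim (eig \<mu>)\<close> by simp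
  then have j: "j \<in> Nminus_at V \<beta>" using neg by (auto simp: Nminus_at_def j_def)
  have "mu V j \<beta> \<le> \<mu>" using mu_properties(4)[OF j neg] by (simp add: j_def)
  moreover have "\<not> mu V j \<beta> < \<mu>"
    using gap[of "mu V j \<beta>"] mu_properties(3)[OF j] \<open>1 \<le> dim (eig \<mu>)\<close> by auto
  ultimately show ?thesis using j by force
qed

text \<open>On an eigenvector, \<open>\<mu> * hG \<beta> x x\<close> is the potential energy, which
  is at least \<open>- a\<close> times the squared \<open>L2\<close> norm, and \<beta> times that
  squared norm is at most \<open>hG \<beta> x x\<close>.\<close>

lemma eigenvalue_lower_bound:
  assumes ev: "K_eigenvalue V \<beta> \<mu>" and a: "0 \<le> a" "AE x in lborel. max 0 (- V x) \<le> a"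
  shows "- a \<le> \<mu> * \<beta>"
proof -
  obtain x where x: "x \<in> eig \<mu>" "x \<noteq> 0"
    using ev K_eigenvalue_iff subspace_0[OF subspace_eig] by blast
  define I where "I = sqint (Rep_h1 x)"
  have "(LBINT t. - a * (Rep_h1 x t)\<^sup>2) \<le> hB V x x"
    unfolding hB_def
  proof (rule integral_mono_AE)
    show "AE t in lborel. - a * (Rep_h1 x t)\<^sup>2 \<le> V t * Rep_h1 x t * Rep_h1 x t"
      using a(2)
    proof eventually_elim
      case (elim t)
      then have "- a * (Rep_h1 x t)\<^sup>2 \<le> V t * (Rep_h1 x t)\<^sup>2" by (intro mult_right_mono) auto
      then show ?case by (simp add: power2_eq_square mult.assoc)
    qed
  qed (use V_form_integrable[OF Rep_h1_L2 Rep_h1_L2] L2_integrable_square[OF Rep_h1_L2] in auto)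
  then have "- a * I \<le> \<mu> * hG \<beta> x x" using eigD[OF x(1), of x] by (simp add: I_def)
  moreover have "\<beta> * (a * I) \<le> a * hG \<beta> x x"
  proof -
    have "\<beta> * I \<le> hG \<beta> x x" unfolding hG_self I_def by simp
    then have "a * (\<beta> * I) \<le> a * hG \<beta> x x" using a(1) by (rule mult_left_mono)
    then show ?thesis by (simp add: mult.left_commute)
  qed
  ultimately have "- a * hG \<beta> x x \<le> (\<mu> * \<beta>) * hG \<beta> x x"
    using mult_left_mono[of "- a * I" "\<mu> * hG \<beta> x x" \<beta>] \<beta> by (simp add: mult.assoc mult.left_commute)
  then show ?thesis using pos[OF x(2)] by (simp only: mult_le_cancel_right_pos)
qed

end

context decaying_potential
begin

lemma Nminus_at_subset:
  assumes "0 < \<beta>1" "0 < \<beta>2"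
  shows "Nminus_at V \<beta>1 \<subseteq> Nminus_at V \<beta>2"
proof
  fix j assume "j \<in> Nminus_at V \<beta>1"
  then obtain t where t: "1 \<le> j" "t < 0" "j \<le> neg_count V \<beta>1 t" by (auto simp: Nminus_at_def)
  show "j \<in> Nminus_at V \<beta>2"
  proof (cases "\<beta>1 \<le> \<beta>2")
    case True
    have "\<beta>1 / \<beta>2 * t < 0" using assms t by (intro mult_pos_neg) auto
    then show ?thesis using neg_count_scale_beta[OF assms(1) True t(2)] t unfolding Nminus_at_def
      by (intro CollectI conjI exI[of _ "\<beta>1 / \<beta>2 * t"]) auto
  next
    case False
    then have "\<beta>2 \<le> \<beta>1" by simp
    then show ?thesis using neg_count_antimono_beta[OF assms(2) _ t(2)] t unfolding Nminus_at_def
      by (intro CollectI conjI exI[of _ t]) (auto intro: order_trans)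
  qed
qed

lemma Nminus_eq: "0 < \<beta> \<Longrightarrow> Nminus V = Nminus_at V \<beta>"
  unfolding Nminus_def using Nminus_at_subset by auto

lemma mu_facts:
  assumes "j \<in> Nminus V" "0 < \<beta>"
  shows "mu V j \<beta> < 0" "K_eigenvalue V \<beta> (mu V j \<beta>)" "j \<le> neg_count V \<beta> (mu V j \<beta>)"
    and "\<And>t. t < 0 \<Longrightarrow> j \<le> neg_count V \<beta> t \<Longrightarrow> mu V j \<beta> \<le> t"
proof -
  interpret potential_form V \<beta> by unfold_locales (rule assms(2))
  have j: "j \<in> Nminus_at V \<beta>" using assms Nminus_eq by blast
  show "mu V j \<beta> < 0" "K_eigenvalue V \<beta> (mu V j \<beta>)" "j \<le> neg_count V \<beta> (mu V j \<beta>)"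
    "\<And>t. t < 0 \<Longrightarrow> j \<le> neg_count V \<beta> t \<Longrightarrow> mu V j \<beta> \<le> t"
    using mu_properties[OF j] by auto
qed

lemma mu_mono_beta:
  assumes "j \<in> Nminus V" "0 < \<beta>1" "\<beta>1 \<le> \<beta>2"
  shows "mu V j \<beta>1 \<le> mu V j \<beta>2"
proof -
  have b2: "0 < \<beta>2" using assms by linarith
  note m = mu_facts[OF assms(1) b2]
  have "j \<le> neg_count V \<beta>1 (mu V j \<beta>2)"
    using m(3) neg_count_antimono_beta[OF assms(2,3) m(1)] by linarith
  then show ?thesis using mu_facts(4)[OF assms(1,2) m(1)] by blast
qed

lemma mu_scale_beta:
  assumes "j \<in> Nminus V" "0 < \<beta>1" "\<beta>1 \<le> \<beta>2"
  shows "mu V j \<beta>2 \<le> \<beta>1 / \<beta>2 * mu V j \<beta>1"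
proof -
  have b2: "0 < \<beta>2" using assms by linarith
  note m = mu_facts[OF assms(1,2)]
  have "j \<le> neg_count V \<beta>2 (\<beta>1 / \<beta>2 * mu V j \<beta>1)"
    using m(3) neg_count_scale_beta[OF assms(2,3) m(1)] by linarith
  moreover have "\<beta>1 / \<beta>2 * mu V j \<beta>1 < 0" using m(1) assms b2 by (intro mult_pos_neg) auto
  ultimately show ?thesis using mu_facts(4)[OF assms(1) b2] by blast
qed

lemma mu_mono_index:
  assumes "i \<in> Nminus V" "j \<in> Nminus V" "0 < \<beta>" "i \<le> j"
  shows "mu V i \<beta> \<le> mu V j \<beta>"
  using mu_facts[OF assms(2,3)] mu_facts(4)[OF assms(1,3)] assms(4) by (meson order_trans)

text \<open>Monotonicity and scaling enclose \<open>mu V j x\<close> between \<open>mu V j b\<close>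
  and \<open>b / x * mu V j b\<close>, on either side of \<open>b\<close>.\<close>

lemma mu_continuous:
  assumes j: "j \<in> Nminus V"
  shows "continuous_on {0<..} (mu V j)"
proof (rule continuous_at_imp_continuous_on, rule ballI)
  fix b :: real assume "b \<in> {0<..}"
  then have b: "0 < b" by simp
  show "isCont (mu V j) b"
    unfolding isCont_def
  proof (rule LIM_zero_cancel, rule Lim_null_comparison)
    have "((\<lambda>x. \<bar>b / x - 1\<bar> * \<bar>mu V j b\<bar>) \<longlongrightarrow> \<bar>b / b - 1\<bar> * \<bar>mu V j b\<bar>) (at b)"
      using b by (intro tendsto_intros) auto
    then show "((\<lambda>x. \<bar>b / x - 1\<bar> * \<bar>mu V j b\<bar>) \<longlongrightarrow> 0) (at b)" using b by simp
    have "eventually (\<lambda>x. x \<in> {0<..}) (at b)"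
      using b by (intro eventually_at_in_open') auto
    then show "\<forall>\<^sub>F x in at b. norm (mu V j x - mu V j b) \<le> \<bar>b / x - 1\<bar> * \<bar>mu V j b\<bar>"
    proof eventually_elim
      case (elim x)
      then have x: "0 < x" by simp
      have neg: "mu V j b < 0" by (rule mu_facts(1)[OF j b])
      have e: "\<bar>b / x - 1\<bar> * \<bar>mu V j b\<bar> = \<bar>b / x * mu V j b - mu V j b\<bar>"
        by (simp add: abs_mult[symmetric] left_diff_distrib)
      show ?case
      proof (cases "b \<le> x")
        case True
        then show ?thesis unfolding e real_norm_def
          using mu_mono_beta[OF j b True] mu_scale_beta[OF j b True] by linarith
      next
        case False
        then have "x \<le> b" by simp
        then have 1: "mu V j x \<le> mu V j b" "mu V j b \<le> x / b * mu V j x"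
          using mu_mono_beta[OF j x] mu_scale_beta[OF j x] by auto
        have "b / x * mu V j b \<le> b / x * (x / b * mu V j x)"
          using 1(2) b x by (intro mult_left_mono) auto
        also have "\<dots> = mu V j x" using b x by simp
        finally show ?thesis unfolding e real_norm_def using 1(1) by linarith
      qed
    qed
  qed
qed

text \<open>By monotonicity the limit at 0 is the infimum, possibly -\<infinity>. Being a lower
  bound for all values, it falls below -1/2 as soon as one value does.\<close>

lemma mu_limit:
  assumes j: "j \<in> Nminus V"
  shows "\<exists>L. ((\<lambda>\<beta>. ereal (mu V j \<beta>)) \<longlongrightarrow> L) (at_right 0) \<and> (\<forall>\<beta>>0. L \<le> ereal (mu V j \<beta>))"
proof (intro exI conjI allI impI)
  let ?L = "INF \<beta>\<in>{0<..}. ereal (mu V j \<beta>)"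
  show le: "?L \<le> ereal (mu V j \<beta>)" if "0 < \<beta>" for \<beta> using that by (intro INF_lower) auto
  show "((\<lambda>\<beta>. ereal (mu V j \<beta>)) \<longlongrightarrow> ?L) (at_right 0)"
  proof (rule order_tendstoI)
    fix a assume "a < ?L"
    show "\<forall>\<^sub>F \<beta> in at_right 0. a < ereal (mu V j \<beta>)"
      using eventually_at_right_less[of "0::real"] by eventually_elim (use \<open>a < ?L\<close> le in \<open>blast intro: less_le_trans\<close>)
  next
    fix a assume "?L < a"
    then obtain b where b: "0 < b" "ereal (mu V j b) < a" by (auto simp: INF_less_iff)
    have "\<forall>\<^sub>F \<beta> in at_right 0. \<beta> \<in> {0<..<b}" using b(1) by (rule eventually_at_right_real)
    then show "\<forall>\<^sub>F \<beta> in at_right 0. ereal (mu V j \<beta>) < a"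
    proof eventually_elim
      case (elim \<beta>)
      then have "ereal (mu V j \<beta>) \<le> ereal (mu V j b)" using mu_mono_beta[OF j, of \<beta> b] by simp
      then show ?case using b(2) by (rule le_less_trans)
    qed
  qed
qed

end

section \<open>The nonlinear eigenvalue problem\<close>

lemma integrable_limit_zero:
  fixes P :: "real \<Rightarrow> real"
  assumes int: "integrable lborel P" and lim: "(P \<longlongrightarrow> l) at_top"
  shows "l = 0"
proof (rule ccontr)
  assume "l \<noteq> 0"
  define c where "c = \<bar>l\<bar> / 2"
  have c: "0 < c" using \<open>l \<noteq> 0\<close> by (simp add: c_def)
  have "eventually (\<lambda>x. c < \<bar>P x\<bar>) at_top"
    using order_tendstoD(1)[OF tendsto_rabs[OF lim], of c] c by (simp add: c_def)
  then obtain X where X: "\<And>x. X \<le> x \<Longrightarrow> c < \<bar>P x\<bar>" by (auto simp: eventually_at_top_linorder)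
  define Q where "Q = (LBINT x. \<bar>P x\<bar>)"
  have "real n * c \<le> Q" for n
  proof -
    have "(LBINT x. indicator {X..X + real n} x * c) \<le> Q"
      unfolding Q_def
    proof (rule integral_mono)
      show "integrable lborel (\<lambda>x. indicator {X..X + real n} x * c)"
        using borel_integrable_atLeastAtMost'[of X "X + real n" "\<lambda>x. c"] by (simp add: set_integrable_def)
      show "indicator {X..X + real n} x * c \<le> \<bar>P x\<bar>" for x
        using X[of x] by (auto simp: indicator_def)
    qed (use int in auto)
    then show ?thesis by simp
  qed
  moreover obtain n :: nat where "Q / c < real n" using reals_Archimedean2 by blast
  ultimately show False using c by (simp add: field_simps not_less[symmetric])
qed

text \<open>The boundary terms over [-r, r] converge as r grows, because the truncated integrals do.
  As a function of r they are also integrable, so their limit is zero.\<close>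

lemma h1_by_parts:
  "(LBINT t. Rep_h1 x t * wd (Rep_h1 y) t + wd (Rep_h1 x) t * Rep_h1 y t) = 0" (is "(LBINT t. ?h t) = 0")
proof -
  let ?F = "Rep_h1 x" and ?G = "Rep_h1 y"
  have hint: "integrable lborel ?h"
    using L2_mult_integrable[OF Rep_h1_L2 wd_Rep_h1_L2] L2_mult_integrable[OF wd_Rep_h1_L2 Rep_h1_L2] by auto
  have FG: "integrable lborel (\<lambda>t. ?F t * ?G t)" by (intro L2_mult_integrable Rep_h1_L2)
  then have FG': "integrable lborel (\<lambda>t. ?F (- t) * ?G (- t))"
    using lborel_integrable_real_affine[of "\<lambda>t. ?F t * ?G t" "-1" 0] by simp
  have parts: "(LBINT t. indicator {-r..r} t * ?h t) = ?F r * ?G r - ?F (- r) * ?G (- r)" if "0 \<le> r" for r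
    using ac_by_parts[OF H1_continuous_ac[OF Rep_h1_H1 Rep_h1_continuous] H1_continuous_ac[OF Rep_h1_H1 Rep_h1_continuous]
        wd_Rep_h1_L2 wd_Rep_h1_L2, of "-r" r x y] that
    by (simp add: set_lebesgue_integral_def)
  have "((\<lambda>r. LBINT t. indicator {-r..r} t * ?h t) \<longlongrightarrow> (LBINT t. ?h t)) at_top"
  proof (rule integral_dominated_convergence_at_top)
    show "integrable lborel (\<lambda>t. \<bar>?h t\<bar>)" using hint by auto
    show "AE t in lborel. ((\<lambda>r. indicator {-r..r} t * ?h t) \<longlongrightarrow> ?h t) at_top"
    proof (rule AE_I2)
      fix t
      have "eventually (\<lambda>r. indicator {-r..r} t * ?h t = ?h t) at_top"
        using eventually_ge_at_top[of "\<bar>t\<bar>"] by eventually_elim (auto simp: indicator_def abs_le_iff)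
      then show "((\<lambda>r. indicator {-r..r} t * ?h t) \<longlongrightarrow> ?h t) at_top" by (rule tendsto_eventually)
    qed
    show "\<forall>\<^sub>F r in at_top. AE t in lborel. norm (indicator {-r..r} t * ?h t) \<le> \<bar>?h t\<bar>"
      by (intro always_eventually allI AE_I2) (auto simp: indicator_def)
  qed auto
  then have "((\<lambda>r. ?F r * ?G r - ?F (- r) * ?G (- r)) \<longlongrightarrow> (LBINT t. ?h t)) at_top"
  proof (rule Lim_transform_eventually)
    show "\<forall>\<^sub>F r in at_top. (LBINT t. indicator {-r..r} t * ?h t) = ?F r * ?G r - ?F (- r) * ?G (- r)"
      using eventually_ge_at_top[of "0::real"] by eventually_elim (rule parts)
  qed
  then show ?thesis
    by (rule integrable_limit_zero[rotated]) (intro Bochner_Integration.integrable_diff FG FG')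
qed

context potential_form
begin

text \<open>The equation says that \<open>wd \<phi>\<close> has a weak derivative in
  \<open>L2\<close>. Hence \<open>wd \<phi>\<close> belongs to \<open>H1\<close>, and integration by
  parts extends the equation from test functions to every element of \<open>h1\<close>.\<close>

lemma star_solution_imp_eig:
  assumes sol: "star_solution V lam \<phi>" and \<beta>_eq: "\<beta> = 1 - lam\<^sup>2" and lam: "lam < 1"
    and x: "AE t in lborel. \<phi> t = Rep_h1 x t"
  shows "x \<in> eig (1 / (lam - 1))"
proof -
  have \<phi>: "\<phi> \<in> H1" using sol by (simp add: star_solution_def)
  note L = H1D[OF \<phi>]
  \<comment> \<open>The second derivative of \<phi> as prescribed by the equation.\<close>
  define g where "g t = \<beta> * \<phi> t + (1 - lam) * (V t * \<phi> t)" for t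
  have gL: "g \<in> L2" unfolding g_def by (intro L2_add L2_scale V_mult_L2 L)
  have "weak_deriv (wd \<phi>) g"
    unfolding weak_deriv_def
  proof (intro allI impI)
    fix \<psi> assume \<psi>: "test_fun \<psi>"
    have i: "integrable lborel (\<lambda>t. \<phi> t * \<psi> t)" "integrable lborel (\<lambda>t. V t * \<phi> t * \<psi> t)"
      using L2_mult_integrable[OF L(1) test_fun_L2[OF \<psi>]] V_form_integrable[OF L(1) test_fun_L2[OF \<psi>]] by auto
    have "(LBINT t. g t * \<psi> t) = (LBINT t. \<beta> * (\<phi> t * \<psi> t) + (1 - lam) * (V t * \<phi> t * \<psi> t))"
      by (intro Bochner_Integration.integral_cong) (auto simp: g_def algebra_simps)
    also have "\<dots> = \<beta> * (LBINT t. \<phi> t * \<psi> t) + (1 - lam) * (LBINT t. V t * \<phi> t * \<psi> t)"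
      using i by simp
    finally have "(LBINT t. g t * \<psi> t) = \<beta> * (LBINT t. \<phi> t * \<psi> t) + (1 - lam) * (LBINT t. V t * \<phi> t * \<psi> t)" .
    moreover have "(LBINT t. wd \<phi> t * deriv \<psi> t) + \<beta> * (LBINT t. \<phi> t * \<psi> t) =
        - (1 - lam) * (LBINT t. V t * \<phi> t * \<psi> t)"
      using sol \<psi> unfolding star_solution_def \<beta>_eq by blast
    ultimately show "(LBINT t. wd \<phi> t * deriv \<psi> t) = - (LBINT t. g t * \<psi> t)"
      by (simp add: algebra_simps)
  qed
  then have w: "wd \<phi> \<in> H1" "AE t in lborel. wd (wd \<phi>) t = g t" using wd_AE_eq[OF L(2) gL] by auto
  obtain z where z: "AE t in lborel. wd \<phi> t = Rep_h1 z t" using h1_representative[OF w(1)] by blast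
  have z': "AE t in lborel. wd (Rep_h1 z) t = g t"
    using H1_AE_cong(2)[OF w(1) _ z] w(2) by (auto elim: eventually_elim2)
  have x': "AE t in lborel. wd (Rep_h1 x) t = wd \<phi> t" using H1_AE_cong(2)[OF \<phi> _ x] by auto
  have [measurable]: "g \<in> borel_measurable borel" "wd \<phi> \<in> borel_measurable borel"
    "V \<in> borel_measurable borel" "\<phi> \<in> borel_measurable borel"
    using gL L L2_measurable V_meas by auto
  show ?thesis
    unfolding eig_def
  proof (intro CollectI allI)
    fix y
    have i: "integrable lborel (\<lambda>t. Rep_h1 z t * wd (Rep_h1 y) t)" "integrable lborel (\<lambda>t. wd (Rep_h1 z) t * Rep_h1 y t)"
      by (intro L2_mult_integrable Rep_h1_L2 wd_Rep_h1_L2)+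
    have "(LBINT t. wd (Rep_h1 x) t * wd (Rep_h1 y) t) = (LBINT t. Rep_h1 z t * wd (Rep_h1 y) t)"
    proof (rule integral_cong_AE)
      show "AE t in lborel. wd (Rep_h1 x) t * wd (Rep_h1 y) t = Rep_h1 z t * wd (Rep_h1 y) t"
        using x' z by eventually_elim simp
    qed auto
    also have "\<dots> = - (LBINT t. wd (Rep_h1 z) t * Rep_h1 y t)"
      using h1_by_parts[of z y] i by simp
    also have "(LBINT t. wd (Rep_h1 z) t * Rep_h1 y t) =
       (LBINT t. \<beta> * (Rep_h1 x t * Rep_h1 y t) + (1 - lam) * (V t * Rep_h1 x t * Rep_h1 y t))"
    proof (rule integral_cong_AE)
      show "AE t in lborel. wd (Rep_h1 z) t * Rep_h1 y t =
          \<beta> * (Rep_h1 x t * Rep_h1 y t) + (1 - lam) * (V t * Rep_h1 x t * Rep_h1 y t)"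
        using z' x
      proof eventually_elim
        case (elim t)
        then have e: "wd (Rep_h1 z) t = \<beta> * Rep_h1 x t + (1 - lam) * (V t * Rep_h1 x t)"
          by (simp add: g_def)
        show ?case unfolding e by (simp add: algebra_simps)
      qed
    qed auto
    also have "\<dots> = \<beta> * (LBINT t. Rep_h1 x t * Rep_h1 y t) + (1 - lam) * hB V x y"
      using L2_mult_integrable[OF Rep_h1_L2 Rep_h1_L2] V_form_integrable[OF Rep_h1_L2 Rep_h1_L2]
      by (simp add: hB_def)
    finally have "hG \<beta> x y = (lam - 1) * hB V x y" by (simp add: hG_def inner_beta_def algebra_simps)
    then show "hB V x y = 1 / (lam - 1) * hG \<beta> x y" using lam by simp
  qed
qed

lemma eig_imp_star_solution:
  assumes x: "x \<in> eig (1 / (lam - 1))" and \<beta>_eq: "\<beta> = 1 - lam\<^sup>2" and lam: "lam < 1"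
    and \<phi>: "\<phi> \<in> H1" "AE t in lborel. \<phi> t = Rep_h1 x t"
  shows "star_solution V lam \<phi>"
  unfolding star_solution_def
proof (intro conjI \<phi>(1) allI impI)
  fix \<psi> assume \<psi>: "test_fun \<psi>"
  note \<psi>H = test_fun_H1[OF \<psi>]
  obtain y where y: "AE t in lborel. \<psi> t = Rep_h1 y t" using h1_representative[OF \<psi>H(1)] by blast
  have [measurable]: "wd \<phi> \<in> borel_measurable borel" "wd \<psi> \<in> borel_measurable borel" "deriv \<psi> \<in> borel_measurable borel"
    using H1D[OF \<phi>(1)] H1D[OF \<psi>H(1)] L2_measurable test_fun_measurable[OF test_fun_deriv[OF \<psi>]] by auto
  have "(LBINT t. wd \<phi> t * deriv \<psi> t) = (LBINT t. wd \<phi> t * wd \<psi> t)"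
  proof (rule integral_cong_AE)
    show "AE t in lborel. wd \<phi> t * deriv \<psi> t = wd \<phi> t * wd \<psi> t" using \<psi>H(2) by eventually_elim simp
  qed auto
  then have "(LBINT t. wd \<phi> t * deriv \<psi> t) + (1 - lam\<^sup>2) * (LBINT t. \<phi> t * \<psi> t) = hG \<beta> x y"
    using inner_beta_Rep[OF \<phi> \<psi>H(1) y] by (simp add: inner_beta_def \<beta>_eq)
  also have "\<dots> = (lam - 1) * hB V x y" using eigD[OF x, of y] lam by simp
  also have "hB V x y = (LBINT t. V t * \<phi> t * \<psi> t)" using V_form_Rep[OF \<phi> \<psi>H(1) y] by simp
  finally show "(LBINT t. wd \<phi> t * deriv \<psi> t) + (1 - lam\<^sup>2) * (LBINT t. \<phi> t * \<psi> t) =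
      - (1 - lam) * (LBINT t. V t * \<phi> t * \<psi> t)" by simp
qed

text \<open>In terms of the forms the problem reads
  \<open>hG \<beta> x y = (lam - 1) * hB V x y\<close>; dividing by \<open>lam - 1\<close>, nonzero
  for \<open>lam < 1\<close>, yields the eigenvalue \<open>1 / (lam - 1)\<close>.\<close>

lemma star_eigenspace_eq:
  assumes "\<beta> = 1 - lam\<^sup>2" "lam < 1"
  shows "star_eigenspace V lam = K_eigenspace V \<beta> (1 / (lam - 1))"
proof (intro set_eqI iffI)
  fix \<phi> assume "\<phi> \<in> star_eigenspace V lam"
  then have sol: "star_solution V lam \<phi>" by (simp add: star_eigenspace_def)
  then have \<phi>: "\<phi> \<in> H1" by (simp add: star_solution_def)
  then obtain x where x: "AE t in lborel. \<phi> t = Rep_h1 x t" using h1_representative by blast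
  show "\<phi> \<in> K_eigenspace V \<beta> (1 / (lam - 1))"
    using star_solution_imp_eig[OF sol assms x] \<phi> x unfolding K_eigenspace_eq by blast
next
  fix \<phi> assume "\<phi> \<in> K_eigenspace V \<beta> (1 / (lam - 1))"
  then show "\<phi> \<in> star_eigenspace V lam"
    unfolding K_eigenspace_eq star_eigenspace_def using eig_imp_star_solution[OF _ assms] by blast
qed

end

lemma (in decaying_potential) star_eigenvalue_iff:
  assumes "-1 < lam" "lam < 1"
  shows "star_eigenvalue V lam \<longleftrightarrow> K_eigenvalue V (1 - lam\<^sup>2) (1 / (lam - 1))"
proof -
  have "0 < 1 - lam\<^sup>2" using assms by (simp add: abs_square_less_1)
  then interpret potential_form V "1 - lam\<^sup>2" by unfold_locales
  show ?thesis using star_eigenspace_eq[OF refl assms(2)]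
    unfolding star_eigenvalue_def K_eigenvalue_def star_eigenspace_def by blast
qed

section \<open>The fixed point equation\<close>

text \<open>The infimum is attained because the exceptional null sets for the bounds
  \<open>Linf_norm f + 1 / Suc n\<close> are countable in number.\<close>

lemma Linf_norm_attained:
  assumes "\<exists>M. AE x in lborel. \<bar>f x\<bar> \<le> M"
  shows "0 \<le> Linf_norm f" "AE x in lborel. \<bar>f x\<bar> \<le> Linf_norm f"
proof -
  let ?S = "{M. 0 \<le> M \<and> (AE x in lborel. \<bar>f x\<bar> \<le> M)}"
  obtain M where "AE x in lborel. \<bar>f x\<bar> \<le> M" using assms by blast
  then have "AE x in lborel. \<bar>f x\<bar> \<le> max 0 M" by eventually_elim simp
  then have ne: "?S \<noteq> {}" by (auto intro: exI[of _ "max 0 M"])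
  show "0 \<le> Linf_norm f" unfolding Linf_norm_def by (rule cInf_greatest[OF ne]) simp
  have "AE x in lborel. \<bar>f x\<bar> \<le> Linf_norm f + 1 / real (Suc n)" for n
  proof -
    have "\<exists>M\<in>?S. M < Linf_norm f + 1 / real (Suc n)"
      unfolding Linf_norm_def by (rule cInf_lessD[OF ne]) simp
    then obtain M where "AE x in lborel. \<bar>f x\<bar> \<le> M" "M < Linf_norm f + 1 / real (Suc n)" by blast
    then show ?thesis by (auto elim!: eventually_mono)
  qed
  then have "AE x in lborel. \<forall>n. \<bar>f x\<bar> \<le> Linf_norm f + 1 / real (Suc n)" by (simp only: AE_all_countable) blast
  then show "AE x in lborel. \<bar>f x\<bar> \<le> Linf_norm f"
  proof eventually_elim
    case (elim x)
    have "(\<lambda>n. Linf_norm f + 1 / real (Suc n)) \<longlonglongrightarrow> Linf_norm f + 0"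
      by (intro tendsto_intros LIMSEQ_Suc[OF lim_1_over_n])
    then have "\<bar>f x\<bar> \<le> Linf_norm f + 0" by (rule LIMSEQ_le_const) (use elim in blast)
    then show ?case by simp
  qed
qed

section \<open>Zeros of the branch equation when the negative part is at most one\<close>

locale small_negative_part = decaying_potential +
  assumes V_neg: "Linf_norm (\<lambda>x. max 0 (- V x)) \<le> 1"
begin

abbreviation neg_norm :: real where
  "neg_norm \<equiv> Linf_norm (\<lambda>x. max 0 (- V x))"

lemma negative_part_norm:
  "0 \<le> neg_norm"
  "AE x in lborel. max 0 (- V x) \<le> neg_norm"
proof -
  have "AE x in lborel. \<bar>max 0 (- V x)\<bar> \<le> Vmax" using Vmax(2) by eventually_elim (use Vmax(1) in auto)
  then have ex: "\<exists>M. AE x in lborel. \<bar>max 0 (- V x)\<bar> \<le> M" by blast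
  show "0 \<le> neg_norm"
    by (rule Linf_norm_attained(1)[OF ex])
  show "AE x in lborel. max 0 (- V x) \<le> neg_norm"
    using Linf_norm_attained(2)[OF ex] by eventually_elim simp
qed

lemma mu_lower_bound:
  assumes "j \<in> Nminus V" "0 < \<beta>"
  shows "- neg_norm \<le> mu V j \<beta> * \<beta>"
proof -
  interpret potential_form V \<beta> by unfold_locales (rule assms(2))
  show ?thesis using eigenvalue_lower_bound[OF mu_facts(2)[OF assms] negative_part_norm] .
qed

text \<open>The norm bound 1 gives \<open>- 1 \<le> \<mu> * \<beta>\<close>, and dividing by the
  negative \<open>\<mu>\<close> reverses the inequality.\<close>

lemma inverse_mu_le:
  assumes "j \<in> Nminus V" "0 < \<beta>"
  shows "1 / mu V j \<beta> \<le> - \<beta>"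
proof -
  have "- 1 \<le> mu V j \<beta> * \<beta>" using mu_lower_bound[OF assms] V_neg by linarith
  then show ?thesis using mu_facts(1)[OF assms] by (simp add: field_simps)
qed

text \<open>With \<open>\<lambda> = 1 + 1/\<mu>\<close> the equation for \<open>\<beta>\<close> reads \<open>\<lambda>\<^sup>2 = 1 - \<beta>\<close>.
  The bound on the negative part gives \<open>\<lambda> \<le> 1 - \<beta>\<close>, which rules out the root \<open>\<lambda> = \<surd>(1 - \<beta>)\<close>;
  the remaining branch is monotone in \<open>\<beta>\<close>.\<close>

definition gap :: "nat \<Rightarrow> real \<Rightarrow> real" where
  "gap j \<beta> = 1 / mu V j \<beta> + 1 + sqrt (1 - \<beta>)"

lemma fixed_point_iff_gap:
  assumes "j \<in> Nminus V" "0 < \<beta>" "\<beta> \<le> 1"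
  shows "\<beta> = - (1 / mu V j \<beta>) * (2 + 1 / mu V j \<beta>) \<longleftrightarrow> gap j \<beta> = 0"
proof -
  define s where "s = 1 / mu V j \<beta>"
  define q where "q = sqrt (1 - \<beta>)"
  have q: "0 \<le> q" "q\<^sup>2 = 1 - \<beta>" using assms by (auto simp: q_def)
  have s: "s \<le> - \<beta>" using inverse_mu_le[OF assms(1,2)] by (simp add: s_def)
  have "\<beta> = - s * (2 + s) \<longleftrightarrow> (1 + s)\<^sup>2 = q\<^sup>2"
    unfolding q(2) by (auto simp: power2_eq_square algebra_simps)
  also have "\<dots> \<longleftrightarrow> 1 + s = q \<or> 1 + s = - q" by (rule power2_eq_iff)
  also have "\<dots> \<longleftrightarrow> 1 + s = - q"
  proof -
    \<comment> \<open>On the unwanted branch \<open>q = 1 + s \<le> 1 - \<beta> = q\<^sup>2\<close>,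
      while \<open>0 \<le> q < 1\<close>. This forces \<open>q = 0\<close>, that is \<beta> = 1,
      where the two branches meet.\<close>
    have "1 + s = - q" if "1 + s = q"
    proof -
      have "q \<le> q\<^sup>2" using that s q(2) by linarith
      moreover have "q < 1" using assms q_def by (simp add: real_sqrt_lt_1_iff)
      ultimately have "q = 0" using q(1) mult_strict_right_mono[of q 1 q] by (cases "q = 0") (auto simp: power2_eq_square)
      then show ?thesis using that by simp
    qed
    then show ?thesis by blast
  qed
  also have "\<dots> \<longleftrightarrow> s + 1 + q = 0" by linarith
  finally show ?thesis by (simp add: gap_def s_def q_def)
qed

lemma gap_strict_antimono:
  assumes "j \<in> Nminus V" "0 < \<beta>1" "\<beta>1 < \<beta>2" "\<beta>2 \<le> 1"
  shows "gap j \<beta>2 < gap j \<beta>1"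
proof -
  have b2: "0 < \<beta>2" using assms by linarith
  have "1 / mu V j \<beta>2 \<le> 1 / mu V j \<beta>1"
    using mu_mono_beta[OF assms(1,2) less_imp_le[OF assms(3)]] mu_facts(1)[OF assms(1) b2] mu_facts(1)[OF assms(1,2)]
    by (simp add: divide_simps)
  \<comment> \<open>The strictness comes from the square root.\<close>
  moreover have "sqrt (1 - \<beta>2) < sqrt (1 - \<beta>1)" using assms by simp
  ultimately show ?thesis unfolding gap_def by linarith
qed

lemma gap_antimono_index:
  assumes "i \<in> Nminus V" "j \<in> Nminus V" "0 < \<beta>" "i \<le> j"
  shows "gap j \<beta> \<le> gap i \<beta>"
proof -
  have "1 / mu V j \<beta> \<le> 1 / mu V i \<beta>"
    using mu_mono_index[OF assms] mu_facts(1)[OF assms(1,3)] mu_facts(1)[OF assms(2,3)]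
    by (simp add: divide_simps)
  then show ?thesis unfolding gap_def by linarith
qed

lemma gap_root_exists:
  assumes "j \<in> Nminus0 V"
  shows "\<exists>\<beta>. 0 < \<beta> \<and> \<beta> \<le> 1 \<and> gap j \<beta> = 0"
proof -
  have j: "j \<in> Nminus V" using assms by (simp add: Nminus0_def)
  obtain L where L: "((\<lambda>\<beta>. ereal (mu V j \<beta>)) \<longlongrightarrow> L) (at_right 0)" "L < ereal (-1/2)"
    using assms by (auto simp: Nminus0_def)
  \<comment> \<open>A real number strictly between the limit and -1/2, since the limit may be
    -\<infinity>. From \<open>c < -1/2\<close> follows 1/c > -2, so \<open>gap\<close> is positive
    near 0, where the square root tends to 1.\<close>
  obtain c where c: "L < ereal c" "c < -1/2"
    using ereal_dense2[OF L(2)] by auto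
  have ev1: "\<forall>\<^sub>F \<beta> in at_right 0. mu V j \<beta> < c" using order_tendstoD(2)[OF L(1) c(1)] by simp
  have "((\<lambda>\<beta>::real. sqrt (1 - \<beta>)) \<longlongrightarrow> sqrt (1 - 0)) (at_right 0)" by (intro tendsto_intros)
  moreover have "- 1 - 1 / c < sqrt (1 - 0)" using c(2) by (simp add: field_simps)
  ultimately have ev2: "\<forall>\<^sub>F \<beta> in at_right (0::real). - 1 - 1 / c < sqrt (1 - \<beta>)" by (rule order_tendstoD(1))
  have ev3: "\<forall>\<^sub>F \<beta> in at_right (0::real). \<beta> \<in> {0<..<1}" by (rule eventually_at_right_real) simp
  have "\<forall>\<^sub>F \<beta> in at_right (0::real). 0 < \<beta> \<and> \<beta> < 1 \<and> 0 < gap j \<beta>"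
    using ev1 ev2 ev3
  proof eventually_elim
    case (elim \<beta>)
    have "1 / c \<le> 1 / mu V j \<beta>" using elim(1) c(2) mu_facts(1)[OF j, of \<beta>] elim(3) by (simp add: divide_simps)
    then show ?case using elim by (simp add: gap_def)
  qed
  then obtain b where b: "0 < b" "b < 1" "0 < gap j b"
    using eventually_happens'[OF trivial_limit_at_right_real] by blast
  \<comment> \<open>At \<beta> = 1 the square root vanishes and
    \<open>1 / mu V j 1 \<le> - 1\<close>; the sign change lies between \<open>b\<close> and
    1.\<close>
  have "gap j 1 \<le> 0" using inverse_mu_le[OF j, of 1] by (simp add: gap_def)
  moreover have "continuous_on {b..1} (gap j)"
    unfolding gap_def using b mu_facts(1)[OF j]
    by (intro continuous_intros continuous_on_subset[OF mu_continuous[OF j]]) (auto simp: less_imp_neq)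
  ultimately obtain \<beta> where "b \<le> \<beta>" "\<beta> \<le> 1" "gap j \<beta> = 0"
    using IVT2'[of "gap j" 1 0 b] b by auto
  then show ?thesis using b by (intro exI[of _ \<beta>]) auto
qed

lemma gap_root_unique:
  assumes "j \<in> Nminus V" "0 < \<beta>1" "\<beta>1 \<le> 1" "gap j \<beta>1 = 0" "0 < \<beta>2" "\<beta>2 \<le> 1" "gap j \<beta>2 = 0"
  shows "\<beta>1 = \<beta>2"
  using gap_strict_antimono[OF assms(1), of \<beta>1 \<beta>2] gap_strict_antimono[OF assms(1), of \<beta>2 \<beta>1] assms
  by (cases \<beta>1 \<beta>2 rule: linorder_cases) auto

lemma fixed_point_unique_exists:
  assumes "j \<in> Nminus0 V"
  shows "\<exists>!\<beta>. 0 < \<beta> \<and> \<beta> \<le> 1 \<and> \<beta> = - (1 / mu V j \<beta>) * (2 + 1 / mu V j \<beta>)"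
proof -
  have j: "j \<in> Nminus V" using assms by (simp add: Nminus0_def)
  obtain \<beta> where \<beta>: "0 < \<beta>" "\<beta> \<le> 1" "gap j \<beta> = 0" using gap_root_exists[OF assms] by blast
  show ?thesis
  proof (rule ex1I[of _ \<beta>])
    show "0 < \<beta> \<and> \<beta> \<le> 1 \<and> \<beta> = - (1 / mu V j \<beta>) * (2 + 1 / mu V j \<beta>)"
      using \<beta> fixed_point_iff_gap[OF j \<beta>(1,2)] by blast
    fix b assume b: "0 < b \<and> b \<le> 1 \<and> b = - (1 / mu V j b) * (2 + 1 / mu V j b)"
    then have "gap j b = 0" using fixed_point_iff_gap[OF j, of b] by blast
    then show "b = \<beta>" using gap_root_unique[OF j] b \<beta> by blast
  qed
qed

lemma beta_j_eq:
  assumes "j \<in> Nminus0 V" "0 < \<beta>" "\<beta> \<le> 1" "\<beta> = - (1 / mu V j \<beta>) * (2 + 1 / mu V j \<beta>)"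
  shows "beta_j V j = \<beta>"
  unfolding beta_j_def by (rule the1_equality[OF fixed_point_unique_exists[OF assms(1)]]) (use assms(2-4) in blast)

lemma beta_j_properties:
  assumes "j \<in> Nminus0 V"
  shows "0 < beta_j V j" "beta_j V j \<le> 1" "gap j (beta_j V j) = 0"
    "lambda_j V j = - sqrt (1 - beta_j V j)"
    "beta_j V j = 1 - (lambda_j V j)\<^sup>2" "-1 < lambda_j V j" "lambda_j V j \<le> 0"
    "mu V j (beta_j V j) = 1 / (lambda_j V j - 1)"
proof -
  have j: "j \<in> Nminus V" using assms by (simp add: Nminus0_def)
  have b: "0 < beta_j V j \<and> beta_j V j \<le> 1 \<and> beta_j V j = - (1 / mu V j (beta_j V j)) * (2 + 1 / mu V j (beta_j V j))"
    unfolding beta_j_def by (rule theI'[OF fixed_point_unique_exists[OF assms]])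
  then show b01: "0 < beta_j V j" "beta_j V j \<le> 1" by auto
  show g: "gap j (beta_j V j) = 0" using b fixed_point_iff_gap[OF j b01] by blast
  then show l: "lambda_j V j = - sqrt (1 - beta_j V j)" by (simp add: gap_def lambda_j_def)
  show "beta_j V j = 1 - (lambda_j V j)\<^sup>2" using b01 by (simp add: l)
  show "-1 < lambda_j V j" "lambda_j V j \<le> 0" using b01 by (auto simp: l)
  show "mu V j (beta_j V j) = 1 / (lambda_j V j - 1)" by (simp add: lambda_j_def)
qed

lemma lambda_j_eigenvalue_iff:
  assumes "-1 < lam" "lam < 1"
  shows "star_eigenvalue V lam \<longleftrightarrow> lam \<in> lambda_j V ` Nminus0 V"
proof
  assume "star_eigenvalue V lam"
  then have ev: "K_eigenvalue V (1 - lam\<^sup>2) (1 / (lam - 1))" using star_eigenvalue_iff[OF assms] by blast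
  define \<beta> where "\<beta> = 1 - lam\<^sup>2"
  have b01: "0 < \<beta>" "\<beta> \<le> 1" using assms by (auto simp: \<beta>_def abs_square_less_1)
  interpret potential_form V \<beta> by unfold_locales (rule b01(1))
  \<comment> \<open>Here \<open>lam > -1\<close> enters: \<open>lam - 1\<close> lies in (-2, 0). The
    value \<open>mu V j \<beta>\<close> is thus below -1/2, and so is its limit at 0, which places
    \<open>j\<close> in \<open>Nminus0\<close>.\<close>
  have neg: "1 / (lam - 1) < - (1 / 2)" using assms by (simp add: field_simps)
  obtain j where j: "j \<in> Nminus V" "mu V j \<beta> = 1 / (lam - 1)"
    using eigenvalue_is_mu[of "1 / (lam - 1)"] ev neg Nminus_eq[OF b01(1)] unfolding \<beta>_def by fastforce
  obtain L where "((\<lambda>\<beta>. ereal (mu V j \<beta>)) \<longlongrightarrow> L) (at_right 0)" "L \<le> ereal (mu V j \<beta>)"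
    using mu_limit[OF j(1)] b01(1) by blast
  moreover from this(2) have "L < ereal (-1/2)"
    by (rule le_less_trans) (use neg j(2) in simp)
  ultimately have j0: "j \<in> Nminus0 V" using j(1) by (auto simp: Nminus0_def)
  have "1 / mu V j \<beta> = lam - 1" by (simp add: j(2))
  moreover have "\<beta> = - (lam - 1) * (2 + (lam - 1))"
    by (simp add: \<beta>_def power2_eq_square algebra_simps)
  ultimately have "\<beta> = - (1 / mu V j \<beta>) * (2 + 1 / mu V j \<beta>)" by simp
  then have "beta_j V j = \<beta>" using beta_j_eq[OF j0 b01] by blast
  then have "lambda_j V j = lam" by (simp add: lambda_j_def j(2))
  then show "lam \<in> lambda_j V ` Nminus0 V" using j0 by blast
next
  assume "lam \<in> lambda_j V ` Nminus0 V"
  then obtain j where j: "j \<in> Nminus0 V" "lam = lambda_j V j" by blast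
  have "K_eigenvalue V (beta_j V j) (mu V j (beta_j V j))"
    using mu_facts(2)[OF _ beta_j_properties(1)[OF j(1)]] j(1) by (simp add: Nminus0_def)
  then show "star_eigenvalue V lam"
    using star_eigenvalue_iff[OF assms] beta_j_properties(5,8)[OF j(1)] j(2) by simp
qed

lemma star_eigenspace_lambda_j:
  assumes "j \<in> Nminus0 V"
  shows "star_eigenspace V (lambda_j V j) = K_eigenspace V (beta_j V j) (mu V j (beta_j V j))"
proof -
  note b = beta_j_properties[OF assms]
  interpret potential_form V "beta_j V j" by unfold_locales (rule b(1))
  show ?thesis using star_eigenspace_eq[OF b(5)] b(7,8) by simp
qed

text \<open>A larger index has the smaller \<open>gap\<close>, and since these functions decrease
  strictly in \<beta>, its zero lies further left. On this branch \<open>lambda_j\<close> is an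
  increasing function of that zero.\<close>

lemma lambda_j_antimono:
  assumes i: "i \<in> Nminus0 V" and j: "j \<in> Nminus0 V" and "i \<le> j"
  shows "lambda_j V j \<le> lambda_j V i"
proof -
  note bi = beta_j_properties[OF i] and bj = beta_j_properties[OF j]
  have ij: "i \<in> Nminus V" "j \<in> Nminus V" using i j by (auto simp: Nminus0_def)
  have "beta_j V j \<le> beta_j V i"
  proof (rule ccontr)
    assume "\<not> ?thesis"
    then have "gap i (beta_j V j) < gap i (beta_j V i)"
      using gap_strict_antimono[OF ij(1) bi(1) _ bj(2)] by simp
    moreover have "gap j (beta_j V j) \<le> gap i (beta_j V j)"
      by (rule gap_antimono_index[OF ij bj(1) \<open>i \<le> j\<close>])
    ultimately show False using bi(3) bj(3) by simp
  qed
  then show ?thesis by (simp add: bi(4) bj(4))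
qed

text \<open>Since \<beta> = (1 - \<lambda>)(1 + \<lambda>) and \<mu> = 1/(\<lambda> - 1), the
  product \<mu> \<beta> equals -(\<lambda> + 1), so the upper bound is the lower bound on \<mu>
  \<beta>.\<close>

lemma lambda_j_bounds:
  assumes j: "j \<in> Nminus0 V"
  shows "0 < lambda_j V j + 1" "lambda_j V j + 1 \<le> neg_norm"
proof -
  note b = beta_j_properties[OF j]
  have jN: "j \<in> Nminus V" using j by (simp add: Nminus0_def)
  define l where "l = lambda_j V j"
  have l: "l \<noteq> 1" "beta_j V j = (1 - l) * (1 + l)" using b(5,7)
    by (auto simp: l_def power2_eq_square algebra_simps)
  show "0 < lambda_j V j + 1" using b(6) by simp
  have "mu V j (beta_j V j) * beta_j V j = 1 / (l - 1) * ((1 - l) * (1 + l))"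
    by (simp only: b(8) l_def[symmetric] l(2)[symmetric])
  also have "\<dots> = - (l + 1)" using l(1) by (simp add: field_simps)
  finally have "mu V j (beta_j V j) * beta_j V j = - (l + 1)" .
  then show "lambda_j V j + 1 \<le> neg_norm"
    using mu_lower_bound[OF jN b(1)] by (simp add: l_def)
qed

end

theorem theorem3p2:
  fixes V :: "real \<Rightarrow> real"
  assumes V_meas: "V \<in> borel_measurable lborel"
    and V_Linf: "\<exists>M. AE x in lborel. \<bar>V x\<bar> \<le> M"
    and V_decay: "((\<lambda>x. \<bar>V x\<bar>) \<longlongrightarrow> 0) at_infinity"
    and V_neg: "Linf_norm (\<lambda>x. max 0 (- V x)) \<le> 1"
  shows "(\<forall>j\<in>Nminus0 V. \<exists>!\<beta>. 0 < \<beta> \<and> \<beta> \<le> 1 \<and>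
            \<beta> = - (1 / mu V j \<beta>) * (2 + 1 / mu V j \<beta>))
       \<and> {lam. -1 < lam \<and> lam < 1 \<and> star_eigenvalue V lam} = lambda_j V ` Nminus0 V
       \<and> lambda_j V ` Nminus0 V \<subseteq> {-1<..<1}
       \<and> (\<forall>j\<in>Nminus0 V. star_eigenspace V (lambda_j V j)
                            = K_eigenspace V (beta_j V j) (mu V j (beta_j V j)))
       \<and> (\<forall>i\<in>Nminus0 V. \<forall>j\<in>Nminus0 V. i \<le> j \<longrightarrow> lambda_j V j \<le> lambda_j V i)
       \<and> (\<forall>j\<in>Nminus0 V. 0 < lambda_j V j + 1
                          \<and> lambda_j V j + 1 \<le> Linf_norm (\<lambda>x. max 0 (- V x)))"
proof -
  interpret small_negative_part V
    using assms by unfold_locales simp_all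
  show ?thesis
  proof (intro conjI ballI impI)
    show "{lam. -1 < lam \<and> lam < 1 \<and> star_eigenvalue V lam} = lambda_j V ` Nminus0 V"
      using lambda_j_eigenvalue_iff beta_j_properties(6,7) by fastforce
    show "lambda_j V ` Nminus0 V \<subseteq> {-1<..<1}"
      using beta_j_properties(6,7) by fastforce
  qed (simp_all only: fixed_point_unique_exists star_eigenspace_lambda_j lambda_j_antimono lambda_j_bounds)
qed

end
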